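(* Let the system be weakly $(\varepsilon,r,\tau)$-reducible with (weak) transition manifold $\mathbb{M}$ and nearest point projection $\mathcal{Q}:\mathbb{X}\to\mathbb{M}$. Assume that there exists a parametrization $\mathcal{E}:\mathbb{M}\to\mathbb{Z}\subset\mathbb{R}^r$ (a bijection onto $\mathbb{Z}$) such that $\xi(x):=\mathcal{E}(\mathcal{Q}(x))$ is a smooth RC. Then there exists a family of functions $p_L^t:\mathbb{Z}\times\mathbb{X}\to[0,\infty)$ such that $$\frac1{|\mathbb{Z}|}\left\|p^t(\ast,\cdot)-p_L^t(\xi(\ast),\cdot)\right\|_{\mathbb{K}}\le\varepsilon\qquad\text{for all }t\ge\tau,$$ i.e. the system is $\varepsilon$-lumpable with respect to $\xi$.
   Context: Setting. $\mathbb{X}\subset\mathbb{R}^n$ is Lebesgue-measurable, and $(X_t)$ is an ergodic time- and space-continuous Markov process on $\mathbb{X}$ with unique stationary probability measure $\mu$, $d\mu=\pi\,dx$, where the density $\pi$ is continuous and strictly positive. For $t>0$ the transition probabilities have densities: $\operatorname{Prob}[X_{t_0+t}\in B\mid X_{t_0}=x]=\int_B p^t(x,y)\,dy$ with $p^t:\mathbb{X}\times\mathbb{X}\to[0,\infty)$. The process is reversible: $p^t(x,y)\pi(x)=p^t(y,x)\pi(y)$ for all $x,y,t$. Norms. $\|h\|_{L^2_{1/\pi}}^2=\int_{\mathbb{X}}|h(y)|^2\pi(y)^{-1}\,dy$; for functions of two variables $\|k(\ast,\cdot)\|_{\mathbb{K}}:=\int_{\mathbb{X}}\int_{\mathbb{X}}|k(x,y)|\,dy\,d\mu(x)$.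 Reaction coordinates (RCs). $r<n$, $\mathbb{Z}\subset\mathbb{R}^r$ is a domain with Lebesgue measure $|\mathbb{Z}|$. A smooth RC is a continuously differentiable map $\xi:\mathbb{X}\to\mathbb{Z}$ all of whose level sets $\Sigma_\xi(z):=\{x\in\mathbb{X}:\xi(x)=z\}$, $z\in\mathbb{Z}$, are $(n-r)$-dimensional topological submanifolds of $\mathbb{X}$. The marginal stationary measure on $\Sigma_\xi(z)$ is $d\mu_z(x)=\pi(x)\det(\nabla\xi(x)^\intercal\nabla\xi(x))^{-1/2}\,dH_{n-r}(x)$, with $H_{n-r}$ the $(n-r)$-dimensional Hausdorff measure. Weak reducibility. Let $\mathbb{M}\subset\{p^\tau(x,\cdot):x\in\mathbb{X}\}$ be an $r$-dimensionally parametrizable manifold, with nearest point projection $\mathcal{Q}(x):=\operatorname{arg\,min}_{q\in\mathbb{M}}\|p^\tau(x,\cdot)-q\|_{L^2_{1/\pi}}$. $\mathbb{M}$ is called smooth if $\mathcal{Q}$ is continuously differentiable and for each $q\in\mathbb{M}$ the level set $\Sigma_{\mathcal{Q}}(q)=\{x\in\mathbb{X}:\mathcal{Q}(x)=q\}$ is an $(n-r)$-dimensional topological submanifold of $\mathbb{X}$. For $\varepsilon>0$, the system is weakly $(\varepsilon,r,\tau)$-reducible if there is a smooth such $\mathbb{M}$ (called a weak transition manifold) with $$\int_{\Sigma_{\mathcal{Q}}(\mathcal{Q}(x))}\|\mathcal{Q}(x)-p^\tau(x',\cdot)\|_{L^2_{1/\pi}}\,d\mu_{\mathcal{Q}(x)}(x')\le\varepsilon\qquad\text{for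 all }x\in\mathbb{X}.$$ Here $\mu_{\mathcal{Q}(x)}$ is the marginal invariant measure on $\Sigma_{\mathcal{Q}}(\mathcal{Q}(x))$; since $\Sigma_{\mathcal{Q}}(\mathcal{Q}(x))=\Sigma_\xi(\xi(x))$ for $\xi=\mathcal{E}\circ\mathcal{Q}$, it is the measure $\mu_z$ of $\xi$ with $z=\xi(x)$.
   Formalization: The formal theorem additionally assumes that det(∇ξᵀ∇ξ) is nonzero at Lebesgue-almost every point of X; where it vanishes, the density det(∇ξᵀ∇ξ)^{-1/2} defining μ_z is undefined, which the stated definition of a smooth RC does not exclude. *)

theory Defs
  imports "HOL-Probability.Probability"
begin

section \<open>The Markov process\<close>

definition state_space :: "(real ^ 'n) set \<Rightarrow> (real ^ 'n) measure" where
  "state_space X = restrict_space borel X"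

definition transition_prob ::
  "(real ^ 'n) set \<Rightarrow> (real \<Rightarrow> real ^ 'n \<Rightarrow> real ^ 'n \<Rightarrow> real) \<Rightarrow>
   real \<Rightarrow> real ^ 'n \<Rightarrow> (real ^ 'n) set \<Rightarrow> ennreal" where
  "transition_prob X p t x B = (\<integral>\<^sup>+ y \<in> B. ennreal (p t x y) \<partial>lebesgue_on X)"

definition natural_algebra ::
  "(real ^ 'n) set \<Rightarrow> 'w measure \<Rightarrow> (real \<Rightarrow> 'w \<Rightarrow> real ^ 'n) \<Rightarrow> real \<Rightarrow> 'w measure" where
  "natural_algebra X P Y s =
     sigma (space P) {Y u -` B \<inter> space P | u B. 0 \<le> u \<and> u \<le> s \<and> B \<in> sets (state_space X)}"

text \<open>
  A time-homogeneous Markov process with time set \<open>[0, \<infinity>)\<close> and state space \<open>X\<close>, given as a family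
  of laws \<open>P x\<close> (the process started in \<open>x\<close>), whose transition probabilities have the densities
  \<open>p t x\<close> for \<open>t > 0\<close>. The last clause is
  \<open>Prob [Y (s + t) \<in> B | Y u, u \<le> s] = \<integral>\<^bsub>B\<^esub> p t (Y s) y dy\<close>.
\<close>

definition markov_process ::
  "(real ^ 'n) set \<Rightarrow> (real \<Rightarrow> real ^ 'n \<Rightarrow> real ^ 'n \<Rightarrow> real) \<Rightarrow>
   (real ^ 'n \<Rightarrow> 'w measure) \<Rightarrow> (real \<Rightarrow> 'w \<Rightarrow> real ^ 'n) \<Rightarrow> bool" where
  "markov_process X p P Y \<longleftrightarrow>
     (\<forall>t>0. \<forall>x\<in>X. \<forall>y\<in>X. 0 \<le> p t x y) \<and>
     (\<forall>t>0. (\<lambda>(x, y). p t x y) \<in> borel_measurable (state_space X \<Otimes>\<^sub>M state_space X)) \<and>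
     (\<forall>x\<in>X. prob_space (P x) \<and>
        (\<forall>t\<ge>0. Y t \<in> P x \<rightarrow>\<^sub>M state_space X) \<and>
        (AE \<omega> in P x. Y 0 \<omega> = x) \<and>
        (\<forall>s\<ge>0. \<forall>t>0. \<forall>B\<in>sets (state_space X).
           AE \<omega> in P x.
             nn_cond_exp (P x) (natural_algebra X (P x) Y s) (\<lambda>\<omega>'. indicator B (Y (s + t) \<omega>')) \<omega>
             = transition_prob X p t (Y s \<omega>) B))"

definition density_measure :: "(real ^ 'n) set \<Rightarrow> (real ^ 'n \<Rightarrow> real) \<Rightarrow> (real ^ 'n) measure" where
  "density_measure X \<pi> = density (lebesgue_on X) (\<lambda>x. ennreal (\<pi> x))"

definition stationary ::
  "(real ^ 'n) set \<Rightarrow> (real \<Rightarrow> real ^ 'n \<Rightarrow> real ^ 'n \<Rightarrow> real) \<Rightarrow> (real ^ 'n) measure \<Rightarrow> bool" where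
  "stationary X p \<nu> \<longleftrightarrow>
     (\<forall>t>0. \<forall>B\<in>sets (state_space X).
        emeasure \<nu> B = (\<integral>\<^sup>+ x. transition_prob X p t x B \<partial>\<nu>))"

definition ergodic ::
  "(real ^ 'n) set \<Rightarrow> (real \<Rightarrow> real ^ 'n \<Rightarrow> real ^ 'n \<Rightarrow> real) \<Rightarrow> (real ^ 'n) measure \<Rightarrow> bool" where
  "ergodic X p \<mu> \<longleftrightarrow>
     (\<forall>B\<in>sets (state_space X).
        (\<forall>t>0. AE x in \<mu>. transition_prob X p t x B = indicator B x) \<longrightarrow>
        emeasure \<mu> B = 0 \<or> emeasure \<mu> B = 1)"

text \<open>
  In the uniqueness clause competing measures live on the Borel sets of \<open>X\<close>, whereas
  \<^term>\<open>density_measure X \<pi>\<close> lives on the Lebesgue measurable subsets of \<open>X\<close>; hence the comparison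
  on Borel sets only.
\<close>

definition reversible_ergodic_process ::
  "(real ^ 'n) set \<Rightarrow> (real ^ 'n \<Rightarrow> real) \<Rightarrow> (real \<Rightarrow> real ^ 'n \<Rightarrow> real ^ 'n \<Rightarrow> real) \<Rightarrow>
   (real ^ 'n \<Rightarrow> 'w measure) \<Rightarrow> (real \<Rightarrow> 'w \<Rightarrow> real ^ 'n) \<Rightarrow> bool" where
  "reversible_ergodic_process X \<pi> p P Y \<longleftrightarrow>
     X \<in> sets lebesgue \<and>
     markov_process X p P Y \<and>
     continuous_on X \<pi> \<and> (\<forall>x\<in>X. 0 < \<pi> x) \<and>
     prob_space (density_measure X \<pi>) \<and>
     stationary X p (density_measure X \<pi>) \<and>
     (\<forall>\<nu>. prob_space \<nu> \<and> sets \<nu> = sets (state_space X) \<and> stationary X p \<nu> \<longrightarrow>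
        (\<forall>B\<in>sets (state_space X). emeasure \<nu> B = emeasure (density_measure X \<pi>) B)) \<and>
     ergodic X p (density_measure X \<pi>) \<and>
     (\<forall>t>0. \<forall>x\<in>X. \<forall>y\<in>X. p t x y * \<pi> x = p t y x * \<pi> y)"


section \<open>Norms\<close>

definition ennreal_sqrt :: "ennreal \<Rightarrow> ennreal" where
  "ennreal_sqrt a = (if a = \<infinity> then \<infinity> else ennreal (sqrt (enn2real a)))"

text \<open>The norm of \<open>L\<^sup>2\<^bsub>1/\<pi>\<^esub>\<close>; it takes the value \<open>\<infinity>\<close> on functions outside the space.\<close>

definition L2_norm :: "(real ^ 'n) set \<Rightarrow> (real ^ 'n \<Rightarrow> real) \<Rightarrow> (real ^ 'n \<Rightarrow> real) \<Rightarrow> ennreal" where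
  "L2_norm X \<pi> h = ennreal_sqrt (\<integral>\<^sup>+ y. ennreal (\<bar>h y\<bar>\<^sup>2 / \<pi> y) \<partial>lebesgue_on X)"

definition L2_space :: "(real ^ 'n) set \<Rightarrow> (real ^ 'n \<Rightarrow> real) \<Rightarrow> (real ^ 'n \<Rightarrow> real) set" where
  "L2_space X \<pi> = {h \<in> borel_measurable (lebesgue_on X). L2_norm X \<pi> h < \<infinity>}"

definition L2_dist ::
  "(real ^ 'n) set \<Rightarrow> (real ^ 'n \<Rightarrow> real) \<Rightarrow> (real ^ 'n \<Rightarrow> real) \<Rightarrow> (real ^ 'n \<Rightarrow> real) \<Rightarrow> real" where
  "L2_dist X \<pi> g h = enn2real (L2_norm X \<pi> (\<lambda>y. g y - h y))"

definition K_norm ::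
  "(real ^ 'n) set \<Rightarrow> (real ^ 'n \<Rightarrow> real) \<Rightarrow> (real ^ 'n \<Rightarrow> real ^ 'n \<Rightarrow> real) \<Rightarrow> ennreal" where
  "K_norm X \<pi> k =
     (\<integral>\<^sup>+ x. (\<integral>\<^sup>+ y. ennreal \<bar>k x y\<bar> \<partial>lebesgue_on X) \<partial>density_measure X \<pi>)"


section \<open>Hausdorff measure and topological manifolds\<close>

text \<open>
  The usual normalization, under which \<open>k\<close>-dimensional Hausdorff measure on a \<open>k\<close>-dimensional
  Euclidean space is Lebesgue measure. The covering sets have to be bounded because
  \<^const>\<open>diameter\<close> is meaningless otherwise.
\<close>

definition hausdorff_pre :: "nat \<Rightarrow> real \<Rightarrow> 'a::metric_space set \<Rightarrow> ennreal" where
  "hausdorff_pre k \<delta> A =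
     (INF C \<in> {C :: nat \<Rightarrow> 'a set. A \<subseteq> (\<Union>i. C i) \<and> (\<forall>i. bounded (C i) \<and> diameter (C i) \<le> \<delta>)}.
        \<Sum>i. if C i = {} then 0 else ennreal (unit_ball_vol (real k) * (diameter (C i) / 2) ^ k))"

definition hausdorff_outer :: "nat \<Rightarrow> 'a::metric_space set \<Rightarrow> ennreal" where
  "hausdorff_outer k A = (SUP \<delta> \<in> {0<..}. hausdorff_pre k \<delta> A)"

definition hausdorff_measure :: "nat \<Rightarrow> 'a::metric_space measure" where
  "hausdorff_measure k = measure_of UNIV (sets borel) (hausdorff_outer k)"

definition topological_manifold :: "nat \<Rightarrow> 'a topology \<Rightarrow> bool" where
  "topological_manifold k T \<longleftrightarrow>
     Hausdorff_space T \<and> second_countable T \<and>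
     (\<forall>x\<in>topspace T. \<exists>U V. openin T U \<and> x \<in> U \<and> openin (Euclidean_space k) V \<and>
        subtopology T U homeomorphic_space subtopology (Euclidean_space k) V)"

definition level_set :: "'a set \<Rightarrow> ('a \<Rightarrow> 'b) \<Rightarrow> 'b \<Rightarrow> 'a set" where
  "level_set X f z = {x \<in> X. f x = z}"


section \<open>Smooth reaction coordinates\<close>

text \<open>
  \<open>G x\<close> is the gradient \<open>\<nabla>\<xi>(x)\<close>, an \<open>n \<times> r\<close> matrix whose columns are the gradients of the components
  of \<open>\<xi>\<close>. It is a parameter because on a general measurable set \<open>X\<close> the derivative within \<open>X\<close> need
  not be unique.
\<close>

definition continuously_differentiable ::
  "(real ^ 'n) set \<Rightarrow> (real ^ 'n \<Rightarrow> real ^ 'r) \<Rightarrow> (real ^ 'n \<Rightarrow> real ^ 'r ^ 'n) \<Rightarrow> bool" where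
  "continuously_differentiable X \<xi> G \<longleftrightarrow>
     (\<forall>x\<in>X. (\<xi> has_derivative (\<lambda>v. transpose (G x) *v v)) (at x within X)) \<and>
     continuous_on X G"

definition smooth_RC ::
  "(real ^ 'n) set \<Rightarrow> (real ^ 'r) set \<Rightarrow> (real ^ 'n \<Rightarrow> real ^ 'r) \<Rightarrow> (real ^ 'n \<Rightarrow> real ^ 'r ^ 'n) \<Rightarrow> bool" where
  "smooth_RC X Z \<xi> G \<longleftrightarrow>
     \<xi> ` X \<subseteq> Z \<and>
     continuously_differentiable X \<xi> G \<and>
     (\<forall>z\<in>Z. topological_manifold (CARD('n) - CARD('r)) (top_of_set (level_set X \<xi> z)))"

definition gram_det :: "(real ^ 'n \<Rightarrow> real ^ 'r ^ 'n) \<Rightarrow> real ^ 'n \<Rightarrow> real" where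
  "gram_det G x = det (transpose (G x) ** G x)"

text \<open>
  The division is the one of \<^typ>\<open>ennreal\<close>, so the density is \<open>\<infinity>\<close> (and not \<open>0\<close>) where the gradient
  is rank deficient. Level sets that are topological manifolds are \<open>\<sigma>\<close>-compact, hence Borel, so
  restricting the Borel measure \<^const>\<open>hausdorff_measure\<close> to them is harmless even if \<open>X\<close> is not
  Borel. The formula makes sense as a stationary marginal only if the Gram determinant does not vanish:
  by the coarea formula these measures do not see any part of \<open>X\<close> of positive Lebesgue measure on
  which it does.
\<close>

definition marginal_measure ::
  "(real ^ 'n) set \<Rightarrow> (real ^ 'n \<Rightarrow> real) \<Rightarrow> (real ^ 'n \<Rightarrow> real ^ 'r) \<Rightarrow>
   (real ^ 'n \<Rightarrow> real ^ 'r ^ 'n) \<Rightarrow> real ^ 'r \<Rightarrow> (real ^ 'n) measure" where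
  "marginal_measure X \<pi> \<xi> G z =
     density (restrict_space (hausdorff_measure (CARD('n) - CARD('r))) (level_set X \<xi> z))
       (\<lambda>x. ennreal (\<pi> x) / ennreal (sqrt (gram_det G x)))"


section \<open>Weak transition manifolds\<close>

text \<open>
  A subset of \<open>L\<^sup>2\<^bsub>1/\<pi>\<^esub>\<close> is given by one function for each of its elements: \<^const>\<open>Metric_space\<close>
  requires functions of \<open>M\<close> at distance \<open>0\<close> to be equal.
\<close>

definition parametrizable_manifold ::
  "nat \<Rightarrow> (real ^ 'n) set \<Rightarrow> (real ^ 'n \<Rightarrow> real) \<Rightarrow> (real ^ 'n \<Rightarrow> real) set \<Rightarrow> bool" where
  "parametrizable_manifold r X \<pi> M \<longleftrightarrow>
     M \<subseteq> L2_space X \<pi> \<and>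
     Metric_space M (L2_dist X \<pi>) \<and>
     (\<exists>V. openin (Euclidean_space r) V \<and>
        Metric_space.mtopology M (L2_dist X \<pi>) homeomorphic_space
          subtopology (Euclidean_space r) V)"

definition nearest_point_projection ::
  "(real ^ 'n) set \<Rightarrow> (real ^ 'n \<Rightarrow> real) \<Rightarrow> (real \<Rightarrow> real ^ 'n \<Rightarrow> real ^ 'n \<Rightarrow> real) \<Rightarrow> real \<Rightarrow>
   (real ^ 'n \<Rightarrow> real) set \<Rightarrow> (real ^ 'n \<Rightarrow> real ^ 'n \<Rightarrow> real) \<Rightarrow> bool" where
  "nearest_point_projection X \<pi> p \<tau> M Q \<longleftrightarrow>
     (\<forall>x\<in>X. is_arg_min (\<lambda>q. L2_norm X \<pi> (\<lambda>y. p \<tau> x y - q y)) (\<lambda>q. q \<in> M) (Q x))"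

text \<open>
  Continuous Frechet differentiability of a map \<open>Q\<close> from \<open>X\<close> to \<open>L\<^sup>2\<^bsub>1/\<pi>\<^esub>\<close>. The derivative, a linear
  map from the \<open>n\<close>-dimensional space to \<open>L\<^sup>2\<^bsub>1/\<pi>\<^esub>\<close>, is given by its values \<open>D x i\<close> on the
  coordinate vectors.
\<close>

definition L2_continuously_differentiable ::
  "(real ^ 'n) set \<Rightarrow> (real ^ 'n \<Rightarrow> real) \<Rightarrow> (real ^ 'n \<Rightarrow> real ^ 'n \<Rightarrow> real) \<Rightarrow> bool" where
  "L2_continuously_differentiable X \<pi> Q \<longleftrightarrow>
     (\<forall>x\<in>X. Q x \<in> L2_space X \<pi>) \<and>
     (\<exists>D :: real ^ 'n \<Rightarrow> 'n \<Rightarrow> real ^ 'n \<Rightarrow> real.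
        (\<forall>x\<in>X. \<forall>i. D x i \<in> L2_space X \<pi>) \<and>
        (\<forall>x\<in>X. ((\<lambda>w. L2_dist X \<pi> (\<lambda>y. Q w y - Q x y) (\<lambda>y. \<Sum>i\<in>UNIV. (w - x) $ i * D x i y)
                      / norm (w - x)) \<longlongrightarrow> 0) (at x within X)) \<and>
        (\<forall>x\<in>X. \<forall>i. ((\<lambda>w. L2_dist X \<pi> (D w i) (D x i)) \<longlongrightarrow> 0) (at x within X)))"

definition smooth_projection ::
  "nat \<Rightarrow> (real ^ 'n) set \<Rightarrow> (real ^ 'n \<Rightarrow> real) \<Rightarrow> (real ^ 'n \<Rightarrow> real) set \<Rightarrow>
   (real ^ 'n \<Rightarrow> real ^ 'n \<Rightarrow> real) \<Rightarrow> bool" where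
  "smooth_projection r X \<pi> M Q \<longleftrightarrow>
     L2_continuously_differentiable X \<pi> Q \<and>
     (\<forall>q\<in>M. topological_manifold (CARD('n) - r) (top_of_set (level_set X Q q)))"

text \<open>
  \<open>M\<close> is a weak transition manifold with nearest point projection \<open>Q\<close>. The marginal measure on
  \<^term>\<open>level_set X Q (Q x)\<close> is taken from a map \<open>\<xi>\<close> with the same level sets as \<open>Q\<close> and with
  gradient \<open>G\<close>.
\<close>

definition weak_transition_manifold ::
  "(real ^ 'n) set \<Rightarrow> (real ^ 'n \<Rightarrow> real) \<Rightarrow> (real \<Rightarrow> real ^ 'n \<Rightarrow> real ^ 'n \<Rightarrow> real) \<Rightarrow> real \<Rightarrow> real \<Rightarrow>
   (real ^ 'n \<Rightarrow> real ^ 'r) \<Rightarrow> (real ^ 'n \<Rightarrow> real ^ 'r ^ 'n) \<Rightarrow>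
   (real ^ 'n \<Rightarrow> real) set \<Rightarrow> (real ^ 'n \<Rightarrow> real ^ 'n \<Rightarrow> real) \<Rightarrow> bool" where
  "weak_transition_manifold X \<pi> p \<epsilon> \<tau> \<xi> G M Q \<longleftrightarrow>
     M \<subseteq> p \<tau> ` X \<and>
     parametrizable_manifold CARD('r) X \<pi> M \<and>
     nearest_point_projection X \<pi> p \<tau> M Q \<and>
     smooth_projection CARD('r) X \<pi> M Q \<and>
     (\<forall>x\<in>X. (\<integral>\<^sup>+ x'. L2_norm X \<pi> (\<lambda>y. Q x y - p \<tau> x' y) \<partial>marginal_measure X \<pi> \<xi> G (\<xi> x))
              \<le> ennreal \<epsilon>)"

end

theory Submission
  imports Defs
begin

text \<open>
  The reduced densities come from the transition manifold itself: for \<open>z = \<xi> x\<close> take \<open>Q x\<close> at time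
  \<open>\<tau>\<close>, and for \<open>t > \<tau>\<close> let the process act on \<open>Q x\<close> for the remaining time \<open>t - \<tau>\<close>. Since \<open>E\<close> is
  injective, \<open>Q x\<close> is determined by \<open>\<xi> x = E (Q x)\<close>.

  The error at time \<open>t\<close> is controlled by the one at time \<open>\<tau>\<close>. By the Chapman-Kolmogorov equation the density
  \<open>p t x\<close> is the image of \<open>p \<tau> x\<close> under the same action, and because transition densities have mass
  one this action does not increase \<open>L\<^sup>1\<close> distances (\<open>markov_L1_contraction\<close>). So for every
  \<open>t \<ge> \<tau>\<close> the inner integral of the error is at most \<open>\<integral> \<bar>Q x y - p \<tau> x y\<bar> dy\<close>, which by the
  Cauchy-Schwarz inequality and \<open>\<integral> \<pi> = 1\<close> is at most the distance \<open>f x\<close> of \<open>Q x\<close> and \<open>p \<tau> x\<close> in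
  \<open>L\<^sup>2\<^bsub>1/\<pi>\<^esub>\<close>.

  Weak reducibility bounds the integral of \<open>f\<close> over each level set of \<open>\<xi>\<close> with
  respect to the marginal measure, so \<open>\<integral> f d\<mu> \<le> \<epsilon> \<bar>Z\<bar>\<close> follows once \<open>\<mu>\<close> is dominated by the integral
  of the marginal measures over \<open>Z\<close>. This is one half of the coarea formula, proved here as
  \<open>coarea_inequality\<close> for a map that is continuously differentiable in the relative sense on a
  Lebesgue measurable set:
  \[ \int_X f(x)\, \sqrt{\det (G(x)^T G(x))}\, dx \le \int \int_{\xi^{-1}(z)} f\, dH^{n-r}\, dz . \]
  Near a point \<open>x\<^sub>0\<close> where the Gram determinant does not vanish, \<open>\<xi>\<close> is completed to a square map by the
  coordinates \<open>u\<^sub>j \<bullet> x\<close> with respect to an orthonormal frame \<open>u\<close> of the kernel of its derivative at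
  \<open>x\<^sub>0\<close>. At \<open>x\<^sub>0\<close> the Jacobian determinant of the completed map is the square root of the Gram
  determinant, and by continuity it is almost that large nearby. The formula for the volume of an
  image, followed by integration over slices, turns the left-hand side into an integral over \<open>z\<close> of
  \<open>n-r\<close>-dimensional volumes of projected level sets. Only an upper bound for these volumes is
  required, and projecting onto an orthonormal frame does not increase distances; so it suffices that
  Lebesgue measure is at most Hausdorff measure. With the normalization of \<^const>\<open>hausdorff_pre\<close>
  this amounts to the isodiametric inequality \<open>isodiametric_PiM\<close>, proved by Steiner symmetrization.
  The set where the Gram determinant does not vanish is exhausted by countably many such pieces, and
  the loss in the Jacobian is made arbitrarily small.

  Three measurability questions need separate arguments. Caratheodory's criterion for metric outer
  measures shows that \<^const>\<open>hausdorff_measure\<close> really has the values of \<^const>\<open>hausdorff_outer\<close>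
  on Borel sets. Level sets are Borel because topological manifolds are \<open>\<sigma>\<close>-compact. Finally, the
  elements of the manifold are individual functions, and \<open>Q x y\<close> need not be jointly measurable in
  \<open>x\<close> and \<open>y\<close>; \<open>exists_measurable_version\<close> changes each of them on a null set so that it is.
\<close>


section \<open>Hausdorff measure as a metric outer measure\<close>

text \<open>
  Caratheodory's criterion. To split a set \<open>T\<close> by a closed set \<open>C\<close>, approximate \<open>T - C\<close> by the sets \<open>D n\<close>
  of points at distance at least \<open>1 / (n + 1)\<close> from \<open>C\<close>, for which additivity is assumed. What is left
  out consists of thin shells \<open>R k\<close> around \<open>C\<close>. Every second shell is separated from the others, so
  their measures are summable whenever \<open>T\<close> has finite measure, and the remainder tends to \<open>0\<close>.
\<close>

lemma metric_outer_measure_space_borel: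
  fixes f :: "'a::metric_space set \<Rightarrow> ennreal"
  assumes empty: "f {} = 0"
    and mono: "\<And>A B. A \<subseteq> B \<Longrightarrow> f A \<le> f B"
    and sub: "\<And>A. f (\<Union>i. A i) \<le> (\<Sum>i. f (A (i::nat)))"
    and sep: "\<And>A B d. 0 < d \<Longrightarrow> (\<And>x y. x \<in> A \<Longrightarrow> y \<in> B \<Longrightarrow> d \<le> dist x y) \<Longrightarrow> f A + f B \<le> f (A \<union> B)"
  shows "measure_space UNIV (sets borel) f"
proof -
  have sub2: "f (A \<union> B) \<le> f A + f B" for A B
  proof -
    define C where "C i = (if i = 0 then A else if i = 1 then B else {})" for i :: nat
    have "f (A \<union> B) \<le> f (\<Union>i. C i)"
      by (rule mono) (auto simp: C_def split: if_splits)
    also have "\<dots> \<le> (\<Sum>i. f (C i))" by (rule sub)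
    also have "\<dots> = (\<Sum>i\<in>{0,1}. f (C i))"
      by (rule suminf_finite) (auto simp: C_def empty)
    also have "\<dots> = f A + f B" by (simp add: C_def)
    finally show ?thesis .
  qed
  have split: "f (T \<inter> C) + f (T - C) \<le> f T" if "closed C" for C T
  proof (cases "C = {} \<or> f T = \<infinity>")
    case True then show ?thesis by (auto simp: empty)
  next
    case False
    then have ne: "C \<noteq> {}" and fin: "f T < \<infinity>" by (auto simp: less_top)
    define D where "D n = {x\<in>T. 1 / real (Suc n) \<le> infdist x C}" for n
    \<comment> \<open>The shells between the distances \<open>1 / (n + 2)\<close> and \<open>1 / (n + 1)\<close>. Two of them with indices that
      differ by at least \<open>2\<close> have positive distance.\<close>
    define R where "R n = {x\<in>T. 1 / real (n + 2) \<le> infdist x C \<and> infdist x C < 1 / real (n + 1)}" for n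
    have Rsep: "1 / real (m + 2) - 1 / real (n + 1) \<le> dist x y"
      if "x \<in> R m" "y \<in> R n" for x y m n
    proof -
      have "infdist x C \<le> infdist y C + dist x y" by (rule infdist_triangle)
      with that show ?thesis by (simp add: R_def)
    qed
    have every_other: "(\<Sum>k<N. f (R (2 * k + i))) \<le> f T" for N i
    proof -
      have "(\<Sum>k<N. f (R (2 * k + i))) \<le> f (\<Union>k<N. R (2 * k + i))"
      proof (induction N)
        case (Suc N)
        have "(\<Sum>k<Suc N. f (R (2 * k + i))) \<le> f (\<Union>k<N. R (2 * k + i)) + f (R (2 * N + i))"
          using Suc by (simp add: add_right_mono)
        also have "\<dots> \<le> f ((\<Union>k<N. R (2 * k + i)) \<union> R (2 * N + i))"
        proof (cases N)
          case 0 then show ?thesis by (simp add: empty)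
        next
          case (Suc M)
          show ?thesis
          proof (rule sep)
            show "0 < 1 / real (2 * M + i + 2) - 1 / real (2 * N + i + 1)"
              using divide_strict_left_mono[of "real (2 * M + i + 2)" "real (2 * N + i + 1)" 1]
              by (simp add: Suc)
            fix x y assume "x \<in> (\<Union>k<N. R (2 * k + i))" "y \<in> R (2 * N + i)"
            then obtain k where k: "k < N" "x \<in> R (2 * k + i)" by auto
            have "1 / real (2 * M + i + 2) \<le> 1 / real (2 * k + i + 2)"
              using k(1) Suc by (intro divide_left_mono) auto
            with Rsep[OF k(2) \<open>y \<in> R (2 * N + i)\<close>]
            show "1 / real (2 * M + i + 2) - 1 / real (2 * N + i + 1) \<le> dist x y" by linarith
          qed
        qed
        also have "\<dots> = f (\<Union>k<Suc N. R (2 * k + i))" by (simp add: lessThan_Suc Un_commute)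
        finally show ?case .
      qed (simp add: empty)
      also have "\<dots> \<le> f T" by (rule mono) (auto simp: R_def)
      finally show ?thesis .
    qed
    have sumR: "(\<Sum>k. f (R k)) < \<infinity>"
    proof -
      have "(\<Sum>k<n. f (R k)) \<le> f T + f T" for n
      proof -
        have "(\<Sum>k<n. f (R k)) \<le> (\<Sum>k<2*n. f (R k))"
          by (rule sum_mono2) auto
        also have "\<dots> = (\<Sum>k<n. f (R (2 * k + 0))) + (\<Sum>k<n. f (R (2 * k + 1)))"
          by (induction n) (auto simp: algebra_simps)
        also have "\<dots> \<le> f T + f T" by (intro add_mono every_other)
        finally show ?thesis .
      qed
      then have "(\<Sum>k. f (R k)) \<le> f T + f T"
        by (intro suminf_le_const) auto
      also have "\<dots> < \<infinity>" using fin by (simp add: ennreal_add_eq_top less_top)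
      finally show ?thesis .
    qed
    have bound: "f (T \<inter> C) + f (T - C) \<le> f T + (\<Sum>k. f (R (k + n)))" for n
    proof -
      have "T - C \<subseteq> D n \<union> (\<Union>k. R (k + n))"
      proof
        fix x assume x: "x \<in> T - C"
        then have pos: "0 < infdist x C"
          using ne \<open>closed C\<close> in_closed_iff_infdist_zero infdist_nonneg[of x C] by (metis DiffE less_eq_real_def)
        show "x \<in> D n \<union> (\<Union>k. R (k + n))"
        proof (cases "x \<in> D n")
          case False
          define k where "k = (LEAST k. 1 / real (Suc k) \<le> infdist x C)"
          obtain j where "1 / real (Suc j) < infdist x C"
            by (rule nat_approx_posE[OF pos])
          then have "1 / real (Suc j) \<le> infdist x C" by simp
          then have k: "1 / real (Suc k) \<le> infdist x C" unfolding k_def by (rule LeastI)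
          have "n < k"
          proof (rule ccontr)
            assume "\<not> n < k"
            then have "1 / real (Suc n) \<le> 1 / real (Suc k)" by (intro divide_left_mono) auto
            with k False x show False by (simp add: D_def)
          qed
          then obtain i where i: "k = Suc (i + n)" using less_imp_Suc_add[of n k] by (auto simp: ac_simps)
          have "\<not> 1 / real (Suc (i + n)) \<le> infdist x C"
            using not_less_Least[of "i + n" "\<lambda>k. 1 / real (Suc k) \<le> infdist x C"] i k_def by auto
          then have "x \<in> R (i + n)" using k x by (simp add: R_def i)
          then show ?thesis by blast
        qed simp
      qed
      then have "f (T - C) \<le> f (D n) + f (\<Union>k. R (k + n))"
        using mono sub2 order_trans by blast
      also have "\<dots> \<le> f (D n) + (\<Sum>k. f (R (k + n)))"
        by (intro add_left_mono sub)
      finally have "f (T \<inter> C) + f (T - C) \<le> (f (T \<inter> C) + f (D n)) + (\<Sum>k. f (R (k + n)))"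
        by (simp add: add.assoc add_left_mono)
      also have "f (T \<inter> C) + f (D n) \<le> f (T \<inter> C \<union> D n)"
      proof (rule sep[of "1 / real (Suc n)"])
        fix x y assume "x \<in> T \<inter> C" "y \<in> D n"
        then show "1 / real (Suc n) \<le> dist x y"
          using infdist_le[of x C y] by (simp add: D_def dist_commute)
      qed simp
      also have "\<dots> \<le> f T" by (rule mono) (auto simp: D_def)
      finally show ?thesis by (simp add: add_right_mono)
    qed
    have "(\<lambda>n. \<Sum>k. f (R (k + n))) \<longlonglongrightarrow> 0"
    proof -
      have fin': "f (R k) < top" for k
        using sumR ennreal_suminf_lessD by (metis infinity_ennreal_def)
      define r where "r k = enn2real (f (R k))" for k
      have r: "f (R k) = ennreal (r k)" "0 \<le> r k" for k
        using fin' by (auto simp: r_def)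
      have sm: "summable r"
        using sumR r by (intro summable_suminf_not_top) (auto simp: less_top)
      have "(\<lambda>n. \<Sum>k. r (k + n)) \<longlonglongrightarrow> 0"
        by (rule suminf_exist_split2[OF sm])
      then have "(\<lambda>n. ennreal (\<Sum>k. r (k + n))) \<longlonglongrightarrow> ennreal 0"
        by (rule tendsto_ennrealI)
      moreover have "(\<Sum>k. f (R (k + n))) = ennreal (\<Sum>k. r (k + n))" for n
        unfolding r(1) using r(2) sm by (intro suminf_ennreal2) (auto simp: summable_iff_shift)
      ultimately show ?thesis by simp
    qed
    then have "(\<lambda>n. f T + (\<Sum>k. f (R (k + n)))) \<longlonglongrightarrow> f T + 0"
      by (intro tendsto_intros) auto
    then show ?thesis
      using bound by (intro LIMSEQ_le_const[where X="\<lambda>n. f T + (\<Sum>k. f (R (k + n)))"]) auto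
  qed
  have oms: "outer_measure_space (Pow UNIV) f"
    by (auto simp: outer_measure_space_def positive_def empty increasing_def mono
        countably_subadditive_def sub)
  interpret P: sigma_algebra "UNIV :: 'a set" "Pow UNIV" by (rule sigma_algebra_Pow)
  have ms: "measure_space UNIV (lambda_system UNIV (Pow UNIV) f) f"
    by (rule P.caratheodory_lemma[OF oms])
  then interpret L: sigma_algebra UNIV "lambda_system UNIV (Pow UNIV) f"
    by (simp add: measure_space_def)
  have "C \<in> lambda_system UNIV (Pow UNIV) f" if "closed C" for C
    unfolding P.lambda_system_eq
  proof (intro CollectI conjI ballI)
    fix T :: "'a set"
    have "f T \<le> f (T \<inter> C) + f (T - C)" using sub2[of "T \<inter> C" "T - C"] by (simp add: Int_Diff_Un)
    with split[OF that, of T] show "f (T \<inter> C) + f (T - C) = f T" by simp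
  qed simp
  then have "sigma_sets UNIV (Collect closed) \<subseteq> lambda_system UNIV (Pow UNIV) f"
    by (intro L.sigma_sets_subset) auto
  then have "sets borel \<subseteq> lambda_system UNIV (Pow UNIV) f"
    by (simp add: borel_eq_closed)
  from measure_down[OF ms _ this] show ?thesis
    by (metis sets.sigma_algebra_axioms space_borel)
qed

abbreviation (input) hausdorff_cost :: "nat \<Rightarrow> 'a::metric_space set \<Rightarrow> ennreal" where
  "hausdorff_cost k C \<equiv> (if C = {} then 0 else ennreal (unit_ball_vol (real k) * (diameter C / 2) ^ k))"

lemma hausdorff_pre_le:
  assumes "A \<subseteq> (\<Union>i. C i)" "\<And>i. bounded (C i)" "\<And>i. diameter (C i) \<le> \<delta>"
  shows "hausdorff_pre k \<delta> A \<le> (\<Sum>i. hausdorff_cost k (C i))"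
  unfolding hausdorff_pre_def using assms by (intro INF_lower) auto

lemma hausdorff_pre_greatest:
  assumes "\<And>C. A \<subseteq> (\<Union>i. C i) \<Longrightarrow> (\<And>i. bounded (C i)) \<Longrightarrow> (\<And>i. diameter (C i) \<le> \<delta>) \<Longrightarrow>
             a \<le> (\<Sum>i. hausdorff_cost k (C i))"
  shows "a \<le> hausdorff_pre k \<delta> A"
  unfolding hausdorff_pre_def using assms by (intro INF_greatest) auto

lemma hausdorff_pre_mono:
  assumes "A \<subseteq> B" "\<delta> \<le> \<delta>'"
  shows "hausdorff_pre k \<delta>' A \<le> hausdorff_pre k \<delta> B"
  using assms by (intro hausdorff_pre_greatest hausdorff_pre_le) (auto intro: order_trans[OF _ assms(2)])

lemma hausdorff_pre_empty:
  assumes "0 < \<delta>" shows "hausdorff_pre k \<delta> {} = 0"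
  using hausdorff_pre_le[of "{}" "\<lambda>_. {}" \<delta> k] assms by (simp add: diameter_def)

lemma hausdorff_pre_countable_subadditive:
  "hausdorff_pre k \<delta> (\<Union>i. A i) \<le> (\<Sum>i. hausdorff_pre k \<delta> (A (i::nat)))"
proof (rule ennreal_le_epsilon)
  fix e :: real assume e: "0 < e" and fin: "(\<Sum>n. hausdorff_pre k \<delta> (A n)) < top"
  have "\<exists>C. A n \<subseteq> (\<Union>i. C i) \<and> (\<forall>i. bounded (C i) \<and> diameter (C i) \<le> \<delta>) \<and>
      (\<Sum>i. hausdorff_cost k (C i)) \<le> hausdorff_pre k \<delta> (A n) + e * (1/2)^Suc n" for n
  proof -
    have "hausdorff_pre k \<delta> (A n) < hausdorff_pre k \<delta> (A n) + e * (1/2)^Suc n"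
      using e fin by (auto simp: less_top dest!: ennreal_suminf_lessD)
    then show ?thesis
      unfolding hausdorff_pre_def INF_less_iff by (auto intro: less_imp_le)
  qed
  then have "\<exists>B. \<forall>n. A n \<subseteq> (\<Union>i. B n i) \<and> (\<forall>i. bounded (B n i) \<and> diameter (B n i) \<le> \<delta>) \<and>
      (\<Sum>i. hausdorff_cost k (B n i)) \<le> hausdorff_pre k \<delta> (A n) + e * (1/2)^Suc n"
    by (intro choice allI)
  then obtain B where B: "\<And>n. A n \<subseteq> (\<Union>i. B n i)" "\<And>n i. bounded (B n i)" "\<And>n i. diameter (B n i) \<le> \<delta>"
    and Ble: "\<And>n. (\<Sum>i. hausdorff_cost k (B n i)) \<le> hausdorff_pre k \<delta> (A n) + e * (1/2)^Suc n"
    by blast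
  define C where "C = case_prod B o prod_decode"
  have "(\<Union>i. A i) \<subseteq> (\<Union>i. C i)"
    using B(1) by (auto simp add: C_def subset_eq) (metis prod.case prod_encode_inverse)
  then have "hausdorff_pre k \<delta> (\<Union>i. A i) \<le> (\<Sum>i. hausdorff_cost k (C i))"
    by (rule hausdorff_pre_le) (auto simp: C_def B split: prod.split)
  also have "\<dots> = (\<Sum>i. (\<lambda>(n, i). hausdorff_cost k (B n i)) (prod_decode i))"
    by (intro suminf_cong) (simp add: C_def split_beta)
  also have "\<dots> = (\<Sum>n. \<Sum>i. hausdorff_cost k (B n i))"
    by (rule suminf_ennreal_2dimen) simp
  also have "\<dots> \<le> (\<Sum>n. hausdorff_pre k \<delta> (A n) + e * (1/2) ^ Suc n)"
    by (intro suminf_le Ble) auto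
  also have "\<dots> = (\<Sum>n. hausdorff_pre k \<delta> (A n)) + (\<Sum>n. ennreal e * ennreal ((1/2) ^ Suc n))"
    using e by (subst suminf_add[symmetric])
       (auto simp del: ennreal_suminf_cmult simp add: ennreal_mult[symmetric])
  also have "\<dots> = (\<Sum>n. hausdorff_pre k \<delta> (A n)) + e"
    unfolding ennreal_suminf_cmult
    by (subst suminf_ennreal_eq[OF zero_le_power power_half_series]) auto
  finally show "hausdorff_pre k \<delta> (\<Union>i. A i) \<le> (\<Sum>n. hausdorff_pre k \<delta> (A n)) + e" .
qed

text \<open>
  A set of diameter at most \<open>\<delta>\<close> meets only one of two sets at distance \<open>d > \<delta>\<close>, so a covering of the
  union splits into a covering of each.
\<close>

lemma hausdorff_pre_separated:
  assumes "\<delta> < d" and d: "\<And>x y. x \<in> A \<Longrightarrow> y \<in> B \<Longrightarrow> d \<le> dist x y"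
  shows "hausdorff_pre k \<delta> A + hausdorff_pre k \<delta> B \<le> hausdorff_pre k \<delta> (A \<union> B)"
proof (rule hausdorff_pre_greatest)
  fix C :: "nat \<Rightarrow> 'a set"
  assume C: "A \<union> B \<subseteq> (\<Union>i. C i)" "\<And>i. bounded (C i)" "\<And>i. diameter (C i) \<le> \<delta>"
  define T where "T S i = (if C i \<inter> S = {} then {} else C i)" for S i
  have disj: "T A i = {} \<or> T B i = {}" for i
  proof (rule ccontr)
    assume "\<not> (T A i = {} \<or> T B i = {})"
    then obtain x y where xy: "x \<in> C i" "x \<in> A" "y \<in> C i" "y \<in> B"
      by (auto simp: T_def split: if_splits)
    with diameter_bounded_bound[OF C(2) xy(1,3)] C(3)[of i] d[OF xy(2,4)] assms(1)
    show False by linarith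
  qed
  have \<delta>: "0 \<le> \<delta>" using C(3)[of 0] diameter_ge_0[OF C(2)[of 0]] by linarith
  have T: "hausdorff_pre k \<delta> S \<le> (\<Sum>i. hausdorff_cost k (T S i))" if S: "S \<subseteq> A \<union> B" for S
  proof (rule hausdorff_pre_le)
    show "S \<subseteq> (\<Union>i. T S i)"
    proof
      fix x assume "x \<in> S"
      then obtain i where "x \<in> C i" using C(1) S by blast
      then show "x \<in> (\<Union>i. T S i)" using \<open>x \<in> S\<close> by (intro UN_I[of i]) (auto simp: T_def)
    qed
  qed (use C \<delta> in \<open>auto simp: T_def\<close>)
  have "hausdorff_pre k \<delta> A \<le> (\<Sum>i. hausdorff_cost k (T A i))"
    "hausdorff_pre k \<delta> B \<le> (\<Sum>i. hausdorff_cost k (T B i))" by (intro T Un_upper1 Un_upper2)+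
  then have "hausdorff_pre k \<delta> A + hausdorff_pre k \<delta> B
      \<le> (\<Sum>i. hausdorff_cost k (T A i)) + (\<Sum>i. hausdorff_cost k (T B i))"
    by (rule add_mono)
  also have "\<dots> = (\<Sum>i. hausdorff_cost k (T A i) + hausdorff_cost k (T B i))"
    by (rule suminf_add) auto
  also have "\<dots> \<le> (\<Sum>i. hausdorff_cost k (C i))"
  proof (rule suminf_le)
    show "hausdorff_cost k (T A i) + hausdorff_cost k (T B i) \<le> hausdorff_cost k (C i)" for i
      using disj[of i] by (cases "C i \<inter> A = {}"; cases "C i \<inter> B = {}") (auto simp: T_def)
  qed auto
  finally show "hausdorff_pre k \<delta> A + hausdorff_pre k \<delta> B \<le> (\<Sum>i. hausdorff_cost k (C i))" .
qed

lemma hausdorff_pre_le_outer: "0 < \<delta> \<Longrightarrow> hausdorff_pre k \<delta> A \<le> hausdorff_outer k A"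
  unfolding hausdorff_outer_def by (rule SUP_upper) simp

text \<open>
  Along a sequence of scales the supremum is one of a monotone sequence and hence additive.
\<close>

lemma hausdorff_outer_SUP_seq:
  "hausdorff_outer k A = (SUP n. hausdorff_pre k (1 / real (Suc n)) A)"
proof (rule antisym)
  show "hausdorff_outer k A \<le> (SUP n. hausdorff_pre k (1 / real (Suc n)) A)"
    unfolding hausdorff_outer_def
  proof (rule SUP_least)
    fix \<delta> :: real assume "\<delta> \<in> {0<..}"
    then have "0 < \<delta>" by simp
    then obtain n where "1 / real (Suc n) < \<delta>" by (rule nat_approx_posE)
    then show "hausdorff_pre k \<delta> A \<le> (SUP n. hausdorff_pre k (1 / real (Suc n)) A)"
      by (intro SUP_upper2[of n] hausdorff_pre_mono) auto
  qed
qed (auto intro!: SUP_least hausdorff_pre_le_outer)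

lemma hausdorff_outer_mono: "A \<subseteq> B \<Longrightarrow> hausdorff_outer k A \<le> hausdorff_outer k B"
  unfolding hausdorff_outer_def by (intro SUP_mono') (auto intro: hausdorff_pre_mono)

lemma measure_space_hausdorff_outer:
  "measure_space UNIV (sets borel) (hausdorff_outer k :: 'a::metric_space set \<Rightarrow> ennreal)"
proof (rule metric_outer_measure_space_borel)
  show "hausdorff_outer k ({} :: 'a set) = 0"
    by (simp add: hausdorff_outer_SUP_seq hausdorff_pre_empty del: of_nat_Suc)
  show "hausdorff_outer k A \<le> hausdorff_outer k B" if "A \<subseteq> B" for A B :: "'a set"
    using that by (rule hausdorff_outer_mono)
  show "hausdorff_outer k (\<Union>i. A i) \<le> (\<Sum>i. hausdorff_outer k (A i))" for A :: "nat \<Rightarrow> 'a set"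
  proof -
    have "hausdorff_pre k \<delta> (\<Union>i. A i) \<le> (\<Sum>i. hausdorff_outer k (A i))" if "0 < \<delta>" for \<delta>
      by (rule order_trans[OF hausdorff_pre_countable_subadditive])
        (intro suminf_le hausdorff_pre_le_outer that; simp)
    then show ?thesis unfolding hausdorff_outer_def[of k "\<Union>i. A i"] by (intro SUP_least) auto
  qed
  show "hausdorff_outer k A + hausdorff_outer k B \<le> hausdorff_outer k (A \<union> B)"
    if d: "0 < d" "\<And>x y. x \<in> A \<Longrightarrow> y \<in> B \<Longrightarrow> d \<le> dist x y" for A B :: "'a set" and d
  proof -
    have inc: "incseq (\<lambda>n. hausdorff_pre k (1 / real (Suc n)) S)" for S :: "'a set"
      by (intro monoI hausdorff_pre_mono divide_left_mono) auto
    have "hausdorff_outer k A + hausdorff_outer k B =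
        (SUP n. hausdorff_pre k (1 / real (Suc n)) A + hausdorff_pre k (1 / real (Suc n)) B)"
      unfolding hausdorff_outer_SUP_seq by (rule ennreal_SUP_add[OF inc inc, symmetric])
    also have "\<dots> \<le> hausdorff_outer k (A \<union> B)"
    proof (rule SUP_least)
      fix n
      define \<delta> where "\<delta> = min (1 / real (Suc n)) (d / 2)"
      have \<delta>: "0 < \<delta>" "\<delta> < d" "\<delta> \<le> 1 / real (Suc n)" using d(1) by (auto simp: \<delta>_def)
      have "hausdorff_pre k (1 / real (Suc n)) A + hausdorff_pre k (1 / real (Suc n)) B
          \<le> hausdorff_pre k \<delta> A + hausdorff_pre k \<delta> B"
        using \<delta> by (intro add_mono hausdorff_pre_mono) auto
      also have "\<dots> \<le> hausdorff_pre k \<delta> (A \<union> B)"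
        by (rule hausdorff_pre_separated[OF \<delta>(2) d(2)])
      also have "\<dots> \<le> hausdorff_outer k (A \<union> B)"
        by (rule hausdorff_pre_le_outer[OF \<delta>(1)])
      finally show "hausdorff_pre k (1 / real (Suc n)) A + hausdorff_pre k (1 / real (Suc n)) B
          \<le> hausdorff_outer k (A \<union> B)" .
    qed
    finally show ?thesis .
  qed
qed

lemma sets_hausdorff_measure [simp, measurable_cong]: "sets (hausdorff_measure k) = sets borel"
  unfolding hausdorff_measure_def using sets.sigma_sets_eq[of borel] by (subst sets_measure_of) auto

lemma space_hausdorff_measure [simp]: "space (hausdorff_measure k) = UNIV"
  unfolding hausdorff_measure_def by (simp add: space_measure_of_conv)

lemma emeasure_hausdorff_measure:
  fixes A :: "'a::metric_space set"
  assumes "A \<in> sets borel"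
  shows "emeasure (hausdorff_measure k) A = hausdorff_outer k A"
  unfolding hausdorff_measure_def
  using measure_space_hausdorff_outer[of k, where 'a='a] assms
  by (intro emeasure_measure_of_sigma) (auto simp: measure_space_def)


section \<open>The isodiametric inequality\<close>

abbreviation lborel_on :: "'i set \<Rightarrow> ('i \<Rightarrow> real) measure" where
  "lborel_on J \<equiv> Pi\<^sub>M J (\<lambda>_. lborel)"

definition slice :: "'i \<Rightarrow> ('i \<Rightarrow> real) set \<Rightarrow> ('i \<Rightarrow> real) \<Rightarrow> real set" where
  "slice i A x = {t. x(i := t) \<in> A}"

text \<open>
  Each line in direction \<open>i\<close> meets the symmetrized set in a centred open interval of the same length as
  its intersection with \<open>A\<close>. The strict inequality makes lines that miss \<open>A\<close> miss its symmetrization.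
\<close>

definition steiner :: "'i set \<Rightarrow> 'i \<Rightarrow> ('i \<Rightarrow> real) set \<Rightarrow> ('i \<Rightarrow> real) set" where
  "steiner J i A = {x \<in> space (lborel_on J). ennreal (2 * \<bar>x i\<bar>) < emeasure lborel (slice i A x)}"

text \<open>
  Let \<open>[l, s]\<close> be the smallest interval containing \<open>U\<close>. If all distances were smaller than \<open>a + b\<close>, then
  \<open>V\<close> would lie in \<open>[s - (a + b), l + (a + b)]\<close>; the lengths of these intervals add up to \<open>2 * (a + b)\<close>.
\<close>

lemma exists_distant_points_real:
  fixes a b :: real
  assumes "0 \<le> a" "0 \<le> b" and U: "U \<in> sets borel" and V: "V \<in> sets borel"
    and "ennreal (2 * a) < emeasure lborel U" "ennreal (2 * b) < emeasure lborel V"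
  shows "\<exists>u\<in>U. \<exists>v\<in>V. a + b \<le> \<bar>u - v\<bar>"
proof (rule ccontr)
  assume "\<not> ?thesis"
  then have close: "\<bar>u - v\<bar> < a + b" if "u \<in> U" "v \<in> V" for u v
    using that by (meson not_le)
  have "U \<noteq> {}" "V \<noteq> {}" using assms(5,6) by auto
  then obtain u0 v0 where uv: "u0 \<in> U" "v0 \<in> V" by auto
  have "u \<le> v0 + (a + b)" "v0 - (a + b) \<le> u" if "u \<in> U" for u
    using close[OF that uv(2)] by auto
  then have bdd: "bdd_above U" "bdd_below U" unfolding bdd_above_def bdd_below_def by blast+
  define s where "s = Sup U"
  define l where "l = Inf U"
  have Ule: "U \<subseteq> {l..s}"
    using bdd by (auto simp: s_def l_def intro: cSup_upper cInf_lower)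
  have Vle: "V \<subseteq> {s - (a + b)..l + (a + b)}"
  proof
    fix v assume v: "v \<in> V"
    have "s \<le> v + (a + b)" unfolding s_def
      using close[OF _ v] \<open>U \<noteq> {}\<close> by (intro cSup_least) (auto simp: abs_less_iff less_imp_le algebra_simps)
    moreover have "v - (a + b) \<le> l" unfolding l_def
      using close[OF _ v] \<open>U \<noteq> {}\<close> by (intro cInf_greatest) (auto simp: abs_less_iff less_imp_le algebra_simps)
    ultimately show "v \<in> {s - (a + b)..l + (a + b)}" by auto
  qed
  have "l \<le> s" "s - (a + b) \<le> l + (a + b)" using uv Ule Vle by fastforce+
  then have "emeasure lborel {l..s} = ennreal (s - l)"
      "emeasure lborel {s - (a + b)..l + (a + b)} = ennreal (l + (a + b) - (s - (a + b)))" by auto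
  then have "ennreal (2 * a) < ennreal (s - l)" "ennreal (2 * b) < ennreal (l + (a + b) - (s - (a + b)))"
    using assms(5,6) emeasure_mono[OF Ule, of lborel] emeasure_mono[OF Vle, of lborel] by auto
  then have "2 * a < s - l" "2 * b < l + (a + b) - (s - (a + b))"
    using \<open>0 \<le> a\<close> \<open>0 \<le> b\<close> by (auto simp: ennreal_less_iff)
  then show False using \<open>0 \<le> a\<close> by linarith
qed

lemma measurable_update_pair:
  assumes "i \<in> J"
  shows "(\<lambda>(x, t). x(i := t)) \<in> lborel_on J \<Otimes>\<^sub>M lborel \<rightarrow>\<^sub>M lborel_on J"
  unfolding split_beta using assms
  by (intro measurable_fun_upd[where J=J]) auto

lemma sets_slice:
  assumes "i \<in> J" "A \<in> sets (lborel_on J)" "x \<in> space (lborel_on J)"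
  shows "slice i A x \<in> sets borel"
proof -
  have "(\<lambda>t. x(i := t)) \<in> lborel \<rightarrow>\<^sub>M lborel_on J"
    using measurable_Pair2[OF measurable_update_pair[OF assms(1)] assms(3)] by simp
  from measurable_sets[OF this assms(2)] show ?thesis by (simp add: slice_def vimage_def)
qed

lemma emeasure_slice_measurable:
  assumes "i \<in> J" "A \<in> sets (lborel_on J)"
  shows "(\<lambda>x. emeasure lborel (slice i A x)) \<in> borel_measurable (lborel_on J)"
proof -
  let ?S = "(\<lambda>(x, t). x(i := t)) -` A \<inter> space (lborel_on J \<Otimes>\<^sub>M lborel)"
  have "?S \<in> sets (lborel_on J \<Otimes>\<^sub>M lborel)"
    using measurable_sets[OF measurable_update_pair[OF assms(1)] assms(2)] .
  then have "(\<lambda>x. emeasure lborel (Pair x -` ?S)) \<in> borel_measurable (lborel_on J)"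
    by (rule lborel.measurable_emeasure_Pair)
  moreover have "Pair x -` ?S = slice i A x" if "x \<in> space (lborel_on J)" for x
    using that by (auto simp: slice_def space_pair_measure)
  ultimately show ?thesis by (simp cong: measurable_cong)
qed

lemma steiner_sets:
  assumes "i \<in> J" "A \<in> sets (lborel_on J)"
  shows "steiner J i A \<in> sets (lborel_on J)"
proof -
  note [measurable] = emeasure_slice_measurable[OF assms]
  have [measurable]: "(\<lambda>x. x i) \<in> lborel_on J \<rightarrow>\<^sub>M borel"
    using measurable_component_singleton[OF assms(1), of "\<lambda>_. lborel"] by simp
  show ?thesis unfolding steiner_def by measurable
qed

lemma emeasure_eq_nn_integral_slice:
  assumes "finite J" "i \<in> J" "A \<in> sets (lborel_on J)"
  shows "emeasure (lborel_on J) A =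
     (\<integral>\<^sup>+ x. emeasure lborel (slice i A x) \<partial>lborel_on (J - {i}))"
proof -
  interpret product_sigma_finite "\<lambda>_::'a. lborel :: real measure"
    by (simp add: product_sigma_finite_def lborel.sigma_finite_measure_axioms)
  have J: "insert i (J - {i}) = J" using assms by auto
  have "emeasure (lborel_on J) A = (\<integral>\<^sup>+ x. indicator A x \<partial>lborel_on J)"
    using assms(3) by simp
  also have "\<dots> = (\<integral>\<^sup>+ x. (\<integral>\<^sup>+ t. indicator A (x(i := t)) \<partial>lborel) \<partial>lborel_on (J - {i}))"
    using product_nn_integral_insert[of "J - {i}" i "indicator A"] assms J by simp
  also have "\<dots> = (\<integral>\<^sup>+ x. emeasure lborel (slice i A x) \<partial>lborel_on (J - {i}))"
  proof (rule nn_integral_cong)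
    fix x :: "'a \<Rightarrow> real" assume x: "x \<in> space (lborel_on (J - {i}))"
    have "slice i A x = slice i A (x(i := 0))" by (simp add: slice_def)
    moreover have "x(i := 0) \<in> space (lborel_on J)"
      using x assms(2) by (auto simp: space_PiM PiE_def extensional_def)
    ultimately have "slice i A x \<in> sets borel" using sets_slice assms by metis
    moreover have "indicator A (x(i := t)) = (indicator (slice i A x) t :: ennreal)" for t
      by (simp add: slice_def indicator_def)
    ultimately show "(\<integral>\<^sup>+ t. indicator A (x(i := t)) \<partial>lborel) = emeasure lborel (slice i A x)"
      by simp
  qed
  finally show ?thesis .
qed

lemma emeasure_centred_interval:
  "emeasure lborel {t :: real. ennreal (2 * \<bar>t\<bar>) < m} = m"
proof (cases m)
  case (real r)
  have "{t :: real. ennreal (2 * \<bar>t\<bar>) < m} = {- r / 2 <..< r / 2}"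
    using real by (auto simp: ennreal_less_iff)
  then show ?thesis using real by simp
next
  case top
  then have "{t :: real. ennreal (2 * \<bar>t\<bar>) < m} = UNIV" by auto
  then show ?thesis using top by simp
qed

lemma emeasure_steiner:
  assumes "finite J" "i \<in> J" "A \<in> sets (lborel_on J)"
  shows "emeasure (lborel_on J) (steiner J i A) = emeasure (lborel_on J) A"
proof -
  have "emeasure lborel (slice i (steiner J i A) x) = emeasure lborel (slice i A x)"
    if x: "x \<in> space (lborel_on (J - {i}))" for x
  proof -
    have "x(i := t) \<in> space (lborel_on J)" for t
      using x assms(2) by (auto simp: space_PiM PiE_def extensional_def)
    then have "slice i (steiner J i A) x = {t. ennreal (2 * \<bar>t\<bar>) < emeasure lborel (slice i A x)}"
      by (auto simp: slice_def steiner_def)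
    then show ?thesis by (simp add: emeasure_centred_interval)
  qed
  then show ?thesis
    using emeasure_eq_nn_integral_slice[OF assms(1,2)] assms(3) steiner_sets[OF assms(2,3)]
    by (simp cong: nn_integral_cong)
qed

text \<open>
  The Euclidean diameter, which is not the metric of the function type.
\<close>

definition diam_le :: "'i set \<Rightarrow> real \<Rightarrow> ('i \<Rightarrow> real) set \<Rightarrow> bool" where
  "diam_le J d A \<longleftrightarrow> (\<forall>x\<in>A. \<forall>y\<in>A. (\<Sum>j\<in>J. (x j - y j)\<^sup>2) \<le> d\<^sup>2)"

text \<open>
  Replacing the \<open>i\<close>-th coordinates of two points by those of suitable points of the two slices moves
  the points into \<open>A\<close> without decreasing their distance.
\<close>

lemma steiner_diam_le:
  assumes "finite J" "i \<in> J" "A \<in> sets (lborel_on J)" "diam_le J d A"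
  shows "diam_le J d (steiner J i A)"
  unfolding diam_le_def
proof (intro ballI)
  fix x y assume x: "x \<in> steiner J i A" and y: "y \<in> steiner J i A"
  then have "slice i A x \<in> sets borel" "slice i A y \<in> sets borel"
    using sets_slice[OF assms(2,3)] by (auto simp: steiner_def)
  with x y obtain u v where uv: "x(i := u) \<in> A" "y(i := v) \<in> A" "\<bar>x i\<bar> + \<bar>y i\<bar> \<le> \<bar>u - v\<bar>"
    using exists_distant_points_real[of "\<bar>x i\<bar>" "\<bar>y i\<bar>" "slice i A x" "slice i A y"]
    by (auto simp: steiner_def slice_def)
  have "(\<Sum>j\<in>J. (x j - y j)\<^sup>2) = (x i - y i)\<^sup>2 + (\<Sum>j\<in>J - {i}. (x j - y j)\<^sup>2)"
    using assms by (simp add: sum.remove)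
  also have "(x i - y i)\<^sup>2 \<le> (u - v)\<^sup>2"
    using uv(3) by (intro abs_le_square_iff[THEN iffD1]) linarith
  also have "(u - v)\<^sup>2 + (\<Sum>j\<in>J - {i}. (x j - y j)\<^sup>2) = (\<Sum>j\<in>J. ((x(i := u)) j - (y(i := v)) j)\<^sup>2)"
    using assms by (simp add: sum.remove)
  also have "\<dots> \<le> d\<^sup>2" using uv assms(4) unfolding diam_le_def by blast
  finally show "(\<Sum>j\<in>J. (x j - y j)\<^sup>2) \<le> d\<^sup>2" by simp
qed

definition reflection_invariant :: "'i \<Rightarrow> ('i \<Rightarrow> real) set \<Rightarrow> bool" where
  "reflection_invariant j A \<longleftrightarrow> (\<forall>x\<in>A. x(j := - x j) \<in> A)"

lemma steiner_reflection_invariant: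
  assumes "i \<in> J" "j \<in> J" "A \<in> sets (lborel_on J)"
    and "j = i \<or> reflection_invariant j A"
  shows "reflection_invariant j (steiner J i A)"
  unfolding reflection_invariant_def
proof
  fix x assume x: "x \<in> steiner J i A"
  have sp: "x(j := - x j) \<in> space (lborel_on J)"
    using x assms(2) by (auto simp: steiner_def space_PiM PiE_def extensional_def)
  show "x(j := - x j) \<in> steiner J i A"
  proof (cases "j = i")
    case True
    then show ?thesis using x sp by (simp add: steiner_def slice_def)
  next
    case False
    then have refl: "reflection_invariant j A" using assms(4) by simp
    have "slice i A x \<subseteq> slice i A (x(j := - x j))"
    proof
      fix t assume "t \<in> slice i A x"
      then have "(x(i := t))(j := - (x(i := t)) j) \<in> A"
        using refl unfolding slice_def reflection_invariant_def by blast
      then show "t \<in> slice i A (x(j := - x j))"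
        using False by (simp add: slice_def fun_upd_twist)
    qed
    then have "emeasure lborel (slice i A x) \<le> emeasure lborel (slice i A (x(j := - x j)))"
      using sets_slice[OF assms(1,3) sp] by (intro emeasure_mono) auto
    with x sp False show ?thesis by (auto simp: steiner_def)
  qed
qed

text \<open>
  Symmetrizing in a further coordinate keeps the reflections already achieved.
\<close>

lemma exists_symmetrization:
  assumes "finite J" "A \<in> sets (lborel_on J)" "diam_le J d A" "I \<subseteq> J"
  shows "\<exists>B \<in> sets (lborel_on J).
     emeasure (lborel_on J) B = emeasure (lborel_on J) A \<and>
     diam_le J d B \<and> (\<forall>i\<in>I. reflection_invariant i B)"
  using finite_subset[OF assms(4,1)] assms(4)
proof (induction I rule: finite_induct)
  case empty
  then show ?case using assms by blast
next
  case (insert i I)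
  then obtain B where B: "B \<in> sets (lborel_on J)"
     "emeasure (lborel_on J) B = emeasure (lborel_on J) A"
     "diam_le J d B" "\<forall>i\<in>I. reflection_invariant i B" by auto
  show ?case
    using insert.prems B assms(1)
    by (intro bexI[of _ "steiner J i B"] conjI ballI emeasure_steiner[THEN trans]
        steiner_diam_le steiner_sets steiner_reflection_invariant) auto
qed

text \<open>
  A set invariant under all coordinate reflections contains \<open>- x\<close> together with \<open>x\<close>. If its diameter is
  at most \<open>d\<close> then \<open>2 \<bar>x\<bar> \<le> d\<close>, so it lies in the ball of radius \<open>d / 2\<close> about the origin.
\<close>

lemma isodiametric_PiM_pos:
  assumes "finite J" "A \<in> sets (lborel_on J)" "diam_le J d A" "0 < d"
  shows "emeasure (lborel_on J) A \<le> ennreal (unit_ball_vol (real (card J)) * (d / 2) ^ card J)"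
proof -
  obtain B where B: "B \<in> sets (lborel_on J)"
     "emeasure (lborel_on J) B = emeasure (lborel_on J) A"
     "diam_le J d B" "\<forall>i\<in>J. reflection_invariant i B"
    using exists_symmetrization[OF assms(1-3) order_refl] by auto
  \<comment> \<open>Composing the reflections in the coordinates of \<open>I\<close>.\<close>
  have flip: "(\<lambda>j. if j \<in> I then - x j else x j) \<in> B" if "x \<in> B" "I \<subseteq> J" for x I
    using finite_subset[OF that(2) assms(1)] that(2)
  proof (induction I rule: finite_induct)
    case empty
    then show ?case using that(1) by simp
  next
    case (insert i I)
    let ?y = "\<lambda>j. if j \<in> I then - x j else x j"
    have "?y \<in> B" "i \<in> J" using insert by auto
    then have "?y(i := - ?y i) \<in> B" using B(4) unfolding reflection_invariant_def by blast
    moreover have "?y(i := - ?y i) = (\<lambda>j. if j \<in> insert i I then - x j else x j)"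
      using insert(2) by (auto simp: fun_eq_iff)
    ultimately show ?case by simp
  qed
  have "B \<subseteq> {f. sqrt (\<Sum>i\<in>J. (f i)\<^sup>2) \<le> d / 2} \<inter> space (lborel_on J)"
  proof
    fix x assume x: "x \<in> B"
    have "(\<Sum>j\<in>J. (x j - (if j \<in> J then - x j else x j))\<^sup>2) \<le> d\<^sup>2"
      by (rule B(3)[unfolded diam_le_def, rule_format, OF x flip[OF x order_refl]])
    moreover have "(\<Sum>j\<in>J. (x j - (if j \<in> J then - x j else x j))\<^sup>2) = 4 * (\<Sum>j\<in>J. (x j)\<^sup>2)"
      unfolding sum_distrib_left by (rule sum.cong) (auto simp: power2_eq_square)
    ultimately have "(\<Sum>j\<in>J. (x j)\<^sup>2) \<le> (d / 2)\<^sup>2" by (simp add: power_divide)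
    then have "sqrt (\<Sum>j\<in>J. (x j)\<^sup>2) \<le> d / 2"
      using assms(4) by (intro real_le_lsqrt) auto
    then show "x \<in> {f. sqrt (\<Sum>i\<in>J. (f i)\<^sup>2) \<le> d / 2} \<inter> space (lborel_on J)"
      using sets.sets_into_space[OF B(1)] x by auto
  qed
  moreover have "{f. sqrt (\<Sum>i\<in>J. (f i)\<^sup>2) \<le> d / 2} \<inter> space (lborel_on J) \<in> sets (lborel_on J)"
  proof -
    have [measurable]: "(\<lambda>x. x i) \<in> lborel_on J \<rightarrow>\<^sub>M (borel :: real measure)" if "i \<in> J" for i
      using measurable_component_singleton[OF that, of "\<lambda>_. lborel"] by simp
    have "{f \<in> space (lborel_on J). sqrt (\<Sum>i\<in>J. (f i)\<^sup>2) \<le> d / 2} \<in> sets (lborel_on J)"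
      by measurable
    then show ?thesis by (simp add: Int_def conj_commute)
  qed
  ultimately have "emeasure (lborel_on J) B \<le>
     emeasure (lborel_on J) ({f. sqrt (\<Sum>i\<in>J. (f i)\<^sup>2) \<le> d / 2} \<inter> space (lborel_on J))"
    by (rule emeasure_mono)
  also have "\<dots> = ennreal (unit_ball_vol (real (card J)) * (d / 2) ^ card J)"
    using assms(1,4) by (intro emeasure_cball_aux) auto
  finally show ?thesis using B(2) by simp
qed

text \<open>
  Degenerate diameters are obtained in the limit; in dimension \<open>0\<close> the bound is \<open>0 ^ 0 = 1\<close>.
\<close>

theorem isodiametric_PiM:
  assumes "finite J" "A \<in> sets (lborel_on J)" "diam_le J d A" "0 \<le> d"
  shows "emeasure (lborel_on J) A \<le> ennreal (unit_ball_vol (real (card J)) * (d / 2) ^ card J)"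
proof (rule LIMSEQ_le_const)
  show "\<exists>N. \<forall>n\<ge>N. emeasure (lborel_on J) A \<le>
      ennreal (unit_ball_vol (real (card J)) * ((d + 1 / real (Suc n)) / 2) ^ card J)"
  proof (intro exI allI impI isodiametric_PiM_pos assms)
    fix n :: nat
    have "d\<^sup>2 \<le> (d + 1 / real (Suc n))\<^sup>2"
      using assms(4) by (intro power_mono) auto
    then show "diam_le J (d + 1 / real (Suc n)) A"
      using assms(3) order_trans unfolding diam_le_def by blast
    show "0 < d + 1 / real (Suc n)" using assms(4) by (simp add: add_nonneg_pos)
  qed
  have "(\<lambda>n. d + 1 / real (Suc n)) \<longlonglongrightarrow> d + 0"
    by (intro tendsto_intros) (rule LIMSEQ_Suc[OF lim_1_over_n])
  then have "(\<lambda>n. unit_ball_vol (real (card J)) * ((d + 1 / real (Suc n)) / 2) ^ card J)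
      \<longlonglongrightarrow> unit_ball_vol (real (card J)) * ((d + 0) / 2) ^ card J"
    by (intro tendsto_mult tendsto_const tendsto_power tendsto_divide) simp_all
  then show "(\<lambda>n. ennreal (unit_ball_vol (real (card J)) * ((d + 1 / real (Suc n)) / 2) ^ card J))
      \<longlonglongrightarrow> ennreal (unit_ball_vol (real (card J)) * (d / 2) ^ card J)"
    by (intro tendsto_ennrealI) simp
qed


section \<open>Lebesgue measure of projections and Hausdorff measure\<close>

definition orthonormal_on :: "'i set \<Rightarrow> ('i \<Rightarrow> 'a::euclidean_space) \<Rightarrow> bool" where
  "orthonormal_on J u \<longleftrightarrow> (\<forall>i\<in>J. \<forall>j\<in>J. u i \<bullet> u j = (if i = j then 1 else 0))"

definition frame_coords :: "'i set \<Rightarrow> ('i \<Rightarrow> 'a::euclidean_space) \<Rightarrow> 'a \<Rightarrow> 'i \<Rightarrow> real" where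
  "frame_coords J u x = (\<lambda>j\<in>J. u j \<bullet> x)"

lemma norm_orthonormal_combination:
  assumes "finite J" "orthonormal_on J u"
  shows "(norm (\<Sum>j\<in>J. w j *\<^sub>R u j))\<^sup>2 = (\<Sum>j\<in>J. (w j)\<^sup>2)"
proof -
  have "(norm (\<Sum>j\<in>J. w j *\<^sub>R u j))\<^sup>2 = (\<Sum>j\<in>J. \<Sum>i\<in>J. w j * (w i * (u j \<bullet> u i)))"
    by (simp add: power2_norm_eq_inner inner_sum_left inner_sum_right sum_distrib_left inner_commute mult.left_commute)
  also have "\<dots> = (\<Sum>j\<in>J. \<Sum>i\<in>J. if j = i then (w j)\<^sup>2 else 0)"
    using assms(2) by (intro sum.cong) (auto simp: orthonormal_on_def power2_eq_square)
  also have "\<dots> = (\<Sum>j\<in>J. (w j)\<^sup>2)" using assms(1) by simp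
  finally show ?thesis .
qed

lemma bessel_inequality:
  assumes "finite J" "orthonormal_on J u"
  shows "(\<Sum>j\<in>J. (u j \<bullet> x)\<^sup>2) \<le> (norm x)\<^sup>2"
proof -
  let ?p = "\<Sum>j\<in>J. (u j \<bullet> x) *\<^sub>R u j"
  have p: "(norm ?p)\<^sup>2 = (\<Sum>j\<in>J. (u j \<bullet> x)\<^sup>2)" by (rule norm_orthonormal_combination[OF assms])
  have "x \<bullet> ?p = (\<Sum>j\<in>J. (u j \<bullet> x)\<^sup>2)"
    by (simp add: inner_sum_right power2_eq_square inner_commute)
  moreover have "0 \<le> (norm (x - ?p))\<^sup>2" by simp
  ultimately have "0 \<le> (norm x)\<^sup>2 - (\<Sum>j\<in>J. (u j \<bullet> x)\<^sup>2)"
    using p by (simp add: power2_norm_eq_inner inner_diff_left inner_diff_right inner_commute)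
  then show ?thesis by simp
qed

text \<open>
  The coordinates with respect to an orthonormal frame do not increase distances, so a covering of \<open>S\<close>
  yields a covering of its projection by sets of no larger diameter, each of which satisfies the
  isodiametric inequality. Taking closures makes the covering measurable without changing diameters.
\<close>

theorem emeasure_frame_coords_le_hausdorff_outer:
  fixes S :: "'a::euclidean_space set"
  assumes J: "finite J" and u: "orthonormal_on J u"
    and C: "C \<in> sets (lborel_on J)" "C \<subseteq> frame_coords J u ` S"
  shows "emeasure (lborel_on J) C \<le> hausdorff_outer (card J) S"
proof -
  let ?M = "lborel_on J"
  define e where "e w = (\<Sum>j\<in>J. w j *\<^sub>R u j)" for w
  have e_meas [measurable]: "e \<in> ?M \<rightarrow>\<^sub>M borel"
  proof -
    have [measurable]: "(\<lambda>x. x i) \<in> ?M \<rightarrow>\<^sub>M borel" if "i \<in> J" for i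
      using measurable_component_singleton[OF that, of "\<lambda>_. lborel"] by simp
    show ?thesis unfolding e_def by measurable
  qed
  have e_isometry: "(\<Sum>j\<in>J. (w j - w' j)\<^sup>2) = (dist (e w) (e w'))\<^sup>2" for w w'
    unfolding dist_norm e_def
    by (simp add: sum_subtractf[symmetric] scaleR_left_diff_distrib[symmetric]
        norm_orthonormal_combination[OF J u])
  define p where "p x = e (frame_coords J u x)" for x
  have p_contraction: "dist (p x) (p y) \<le> dist x y" for x y
  proof (rule power2_le_imp_le)
    have "(dist (p x) (p y))\<^sup>2 = (\<Sum>j\<in>J. (u j \<bullet> (x - y))\<^sup>2)"
      unfolding p_def e_isometry[symmetric] by (simp add: frame_coords_def inner_diff_right)
    also have "\<dots> \<le> (norm (x - y))\<^sup>2" by (rule bessel_inequality[OF J u])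
    finally show "(dist (p x) (p y))\<^sup>2 \<le> (dist x y)\<^sup>2" by (simp add: dist_norm)
  qed simp
  have "emeasure ?M C \<le> hausdorff_pre (card J) 1 S"
  proof (rule hausdorff_pre_greatest)
    fix D :: "nat \<Rightarrow> 'a set"
    assume D: "S \<subseteq> (\<Union>i. D i)" "\<And>i. bounded (D i)" "\<And>i. diameter (D i) \<le> 1"
    \<comment> \<open>The distance in coordinates is the one of \<^typ>\<open>'a\<close> via the isometry \<open>e\<close>.\<close>
    define B where "B i = e -` closure (p ` D i) \<inter> space ?M" for i
    have B: "B i \<in> sets ?M" for i
      unfolding B_def by (rule measurable_sets[OF e_meas]) simp
    have bd: "bounded (p ` D i)" for i
    proof -
      obtain c r where cr: "\<And>x. x \<in> D i \<Longrightarrow> dist c x \<le> r" using D(2) unfolding bounded_def by metis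
      then have "\<forall>y\<in>p ` D i. dist (p c) y \<le> r" using p_contraction order_trans by blast
      then show ?thesis unfolding bounded_def by blast
    qed
    have diam: "diameter (p ` D i) \<le> diameter (D i)" for i
    proof (cases "D i = {}")
      case False
      have "dist (p x) (p y) \<le> diameter (D i)" if "x \<in> D i" "y \<in> D i" for x y
        using p_contraction diameter_bounded_bound[OF D(2) that] order_trans by blast
      with False show ?thesis by (intro diameter_le) (auto simp: dist_norm)
    qed simp
    have "diam_le J (diameter (D i)) (B i)" for i
      unfolding diam_le_def e_isometry
    proof (intro ballI)
      fix x y assume "x \<in> B i" "y \<in> B i"
      then have "dist (e x) (e y) \<le> diameter (closure (p ` D i))"
        using bd by (intro diameter_bounded_bound) (auto simp: B_def)
      also have "\<dots> \<le> diameter (D i)" using diam bd by (simp add: diameter_closure)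
      finally show "(dist (e x) (e y))\<^sup>2 \<le> (diameter (D i))\<^sup>2" by (intro power_mono) auto
    qed
    then have "emeasure ?M (B i) \<le> ennreal (unit_ball_vol (real (card J)) * (diameter (D i) / 2) ^ card J)" for i
      using B J diameter_ge_0[OF D(2)] by (intro isodiametric_PiM) auto
    then have B_le: "emeasure ?M (B i) \<le> hausdorff_cost (card J) (D i)" for i
      by (cases "D i = {}") (auto simp: B_def)
    have "C \<subseteq> (\<Union>i. B i)"
    proof
      fix w assume w: "w \<in> C"
      then obtain x where x: "x \<in> S" "w = frame_coords J u x" using C(2) by auto
      then obtain i where "x \<in> D i" using D(1) by auto
      then have "e w \<in> closure (p ` D i)" using x closure_subset by (fastforce simp: p_def)
      then show "w \<in> (\<Union>i. B i)" using sets.sets_into_space[OF C(1)] w by (auto simp: B_def)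
    qed
    then have "emeasure ?M C \<le> emeasure ?M (\<Union>i. B i)"
      using B by (intro emeasure_mono) auto
    also have "\<dots> \<le> (\<Sum>i. emeasure ?M (B i))"
      using B by (intro emeasure_subadditive_countably) auto
    also have "\<dots> \<le> (\<Sum>i. hausdorff_cost (card J) (D i))"
      by (intro suminf_le B_le) auto
    finally show "emeasure ?M C \<le> (\<Sum>i. hausdorff_cost (card J) (D i))" .
  qed
  also have "\<dots> \<le> hausdorff_outer (card J) S" by (rule hausdorff_pre_le_outer) simp
  finally show ?thesis .
qed


section \<open>Volumes of images of compact sets\<close>

text \<open>
  Only permutations that fix the indices of all identity rows contribute to the Leibniz formula.
\<close>

lemma det_block_identity_rows:
  fixes A :: "'a::comm_ring_1^'m^'m" and B :: "'a^'n^'n" and e :: "'m::finite \<Rightarrow> 'n::finite"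
  assumes "inj e"
    and block: "\<And>i j. B $ e i $ e j = A $ i $ j"
    and rows: "\<And>i j. i \<notin> range e \<Longrightarrow> B $ i $ j = (if i = j then 1 else 0)"
  shows "det B = det A"
proof -
  let ?R = "range e"
  have "det B = (\<Sum>p | p permutes UNIV. of_int (sign p) * (\<Prod>i\<in>UNIV. B $ i $ p i))"
    by (simp add: det_def)
  also have "\<dots> = (\<Sum>p | p permutes ?R. of_int (sign p) * (\<Prod>i\<in>UNIV. B $ i $ p i))"
  proof (rule sum.mono_neutral_right)
    show "finite {p. p permutes (UNIV :: 'n set)}" by (simp add: finite_permutations)
    show "{p. p permutes ?R} \<subseteq> {p. p permutes UNIV}" using permutes_subset by auto
    show "\<forall>p\<in>{p. p permutes UNIV} - {p. p permutes ?R}. of_int (sign p) * (\<Prod>i\<in>UNIV. B $ i $ p i) = 0"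
    proof
      fix p assume p: "p \<in> {p. p permutes UNIV} - {p. p permutes ?R}"
      then obtain i where "i \<notin> ?R" "p i \<noteq> i"
        using permutes_superset[of p UNIV ?R] by auto
      then have "B $ i $ p i = 0" using rows by auto
      then have "(\<Prod>i\<in>UNIV. B $ i $ p i) = 0" by (intro prod_zero) auto
      then show "of_int (sign p) * (\<Prod>i\<in>UNIV. B $ i $ p i) = 0" by simp
    qed
  qed
  also have "\<dots> = (\<Sum>p | p permutes ?R. of_int (sign p) * (\<Prod>i\<in>UNIV. A $ i $ inv e (p (e i))))"
  proof (rule sum.cong)
    fix p assume "p \<in> {p. p permutes ?R}"
    then have p: "p permutes ?R" by simp
    have "(\<Prod>i\<in>UNIV. B $ i $ p i) = (\<Prod>i\<in>?R. B $ i $ p i)"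
      using rows permutes_not_in[OF p] by (intro prod.mono_neutral_right) auto
    also have "\<dots> = (\<Prod>i\<in>UNIV. B $ e i $ p (e i))"
      by (simp add: prod.reindex[OF \<open>inj e\<close>])
    also have "\<dots> = (\<Prod>i\<in>UNIV. A $ i $ inv e (p (e i)))"
    proof (rule prod.cong)
      fix i
      have "p (e i) \<in> ?R" using permutes_in_image[OF p] by blast
      then have "e (inv e (p (e i))) = p (e i)" by (simp add: f_inv_into_f)
      then show "B $ e i $ p (e i) = A $ i $ inv e (p (e i))" using block by metis
    qed simp
    finally show "of_int (sign p) * (\<Prod>i\<in>UNIV. B $ i $ p i) =
        of_int (sign p) * (\<Prod>i\<in>UNIV. A $ i $ inv e (p (e i)))" by simp
  qed simp
  also have "\<dots> = (\<Sum>q | q permutes UNIV. of_int (sign q) * (\<Prod>i\<in>UNIV. A $ i $ q i))"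
  proof (rule sum.reindex_bij_witness[where i = "map_permutation UNIV e" and j = "map_permutation ?R (inv e)"])
    have be: "bij_betw e UNIV ?R" and bi: "bij_betw (inv e) ?R UNIV"
      using \<open>inj e\<close> by (auto intro: inj_on_imp_bij_betw bij_betw_inv_into)
    fix p assume "p \<in> {p. p permutes ?R}"
    then have p: "p permutes ?R" by simp
    show "map_permutation ?R (inv e) p \<in> {p. p permutes UNIV}"
      using map_permutation_permutes[OF bi p] by simp
    have eq: "map_permutation ?R (inv e) p i = inv e (p (e i))" for i
      using bi \<open>inj e\<close> map_permutation_apply[of "inv e" ?R "e i" p] by (simp add: bij_betw_def)
    show "map_permutation UNIV e (map_permutation ?R (inv e) p) = p"
      by (intro map_permutation_compose_inv[OF bi p]) (simp add: f_inv_into_f)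
    have "sign (map_permutation ?R (inv e) p) = sign p"
      using bi p by (intro sign_map_permutation) (auto simp: bij_betw_def)
    then show "of_int (sign (map_permutation ?R (inv e) p)) * (\<Prod>i\<in>UNIV. A $ i $ map_permutation ?R (inv e) p i)
       = of_int (sign p) * (\<Prod>i\<in>UNIV. A $ i $ inv e (p (e i)))"
      by (simp add: eq)
  next
    have be: "bij_betw e UNIV ?R" and bi: "bij_betw (inv e) ?R UNIV"
      using \<open>inj e\<close> by (auto intro: inj_on_imp_bij_betw bij_betw_inv_into)
    fix q :: "'m \<Rightarrow> 'm" assume "q \<in> {q. q permutes UNIV}"
    then have q: "q permutes UNIV" by simp
    have qe: "map_permutation UNIV e q permutes ?R" by (rule map_permutation_permutes[OF be q])
    then show "map_permutation UNIV e q \<in> {p. p permutes ?R}" by simp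
    show "map_permutation ?R (inv e) (map_permutation UNIV e q) = q"
      using \<open>inj e\<close> by (intro map_permutation_compose_inv[OF be q]) simp
  qed
  finally show ?thesis by (simp add: det_def)
qed

lemma continuous_on_det_cart:
  fixes A :: "'a::topological_space \<Rightarrow> real^'m^'m"
  assumes "continuous_on S A"
  shows "continuous_on S (\<lambda>x. det (A x))"
  unfolding det_def using assms by (intro continuous_intros)

text \<open>
  On a compact set the Jacobian is bounded and the image is compact, so the change of variables for
  sets of finite measure applies.
\<close>

lemma emeasure_image_compact_wellorder:
  fixes f :: "real^'m::{finite,wellorder} \<Rightarrow> real^'m::_" and A :: "real^'m::_ \<Rightarrow> real^'m::_^'m::_"
  assumes "compact S" and der: "\<And>x. x \<in> S \<Longrightarrow> (f has_derivative (\<lambda>v. A x *v v)) (at x within S)"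
    and "continuous_on S A" "inj_on f S"
  shows "emeasure lborel (f ` S) = (\<integral>\<^sup>+x. ennreal \<bar>det (A x)\<bar> * indicator S x \<partial>lborel)"
proof -
  have cont: "continuous_on S f"
    using der by (meson continuous_on_eq_continuous_within has_derivative_continuous)
  have S: "S \<in> sets lebesgue" using assms(1) by (simp add: compact_imp_closed borel_closed)
  have "set_integrable lborel S (\<lambda>x. \<bar>det (A x)\<bar>)"
    unfolding set_integrable_def
    by (intro borel_integrable_compact assms continuous_intros continuous_on_det_cart)
  then have "(\<lambda>x. \<bar>det (A x)\<bar>) integrable_on S" by (rule set_borel_integral_eq_integral)
  then obtain I where I: "((\<lambda>x. \<bar>det (A x)\<bar>) has_integral I) S" by (auto simp: integrable_on_def)
  then have "f ` S \<in> lmeasurable \<and> measure lebesgue (f ` S) = I"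
    using has_measure_differentiable_image[OF S der assms(4), of I]
    by (simp add: matrix_of_matrix_vector_mul)
  then have "emeasure lebesgue (f ` S) = ennreal I"
    by (auto simp: emeasure_eq_measure2)
  moreover have "compact (f ` S)" by (rule compact_continuous_image[OF cont assms(1)])
  ultimately have "emeasure lborel (f ` S) = ennreal I"
    by (simp add: compact_imp_closed borel_closed emeasure_completion)
  then show ?thesis using nn_integral_has_integral_lebesgue'[OF _ I] by simp
qed

text \<open>
  An arbitrary finite index type, reindexed by an initial segment of the natural numbers and thereby
  well-ordered. Volumes and determinants do not depend on the indexing.
\<close>

typedef ('a::finite) ordered_copy = "{..<CARD('a)}"
  using zero_less_card_finite[where 'a='a] by blast

instantiation ordered_copy :: (finite) "{finite,wellorder}"
begin

definition less_eq_ordered_copy :: "'a ordered_copy \<Rightarrow> 'a ordered_copy \<Rightarrow> bool" where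
  "x \<le> y \<longleftrightarrow> Rep_ordered_copy x \<le> Rep_ordered_copy y"

definition less_ordered_copy :: "'a ordered_copy \<Rightarrow> 'a ordered_copy \<Rightarrow> bool" where
  "x < y \<longleftrightarrow> Rep_ordered_copy x < Rep_ordered_copy y"

instance
proof
  show "finite (UNIV :: 'a ordered_copy set)"
    unfolding type_definition.univ[OF type_definition_ordered_copy[where 'a='a]] by simp
  fix P :: "'a ordered_copy \<Rightarrow> bool" and a :: "'a ordered_copy"
  assume step: "\<And>x. (\<And>y. y < x \<Longrightarrow> P y) \<Longrightarrow> P x"
  show "P a"
    by (induction "Rep_ordered_copy a" arbitrary: a rule: less_induct)
      (rule step, simp add: less_ordered_copy_def)
qed (auto simp: less_eq_ordered_copy_def less_ordered_copy_def Rep_ordered_copy_inject)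

end

lemma card_ordered_copy: "CARD('a::finite ordered_copy) = CARD('a)"
  using type_definition.card[OF type_definition_ordered_copy] by simp

lemma emeasure_lborel_box_cart:
  fixes l u :: "real^'n"
  assumes "\<And>i. l $ i \<le> u $ i"
  shows "emeasure lborel (box l u) = ennreal (\<Prod>i\<in>UNIV. u $ i - l $ i)"
proof -
  have B: "(Basis :: (real^'n) set) = range (\<lambda>i. axis i 1)" by (auto simp: Basis_vec_def)
  have inj: "inj (\<lambda>i. axis i (1::real) :: real^'n)" by (auto simp: inj_on_def axis_eq_axis)
  show ?thesis using assms
    by (simp add: emeasure_lborel_box_eq B prod.reindex[OF inj] inner_axis)
qed

lemma lborel_cart_eqI:
  fixes M :: "(real^'n) measure"
  assumes "sets M = sets borel"
    and "\<And>l u. (\<And>i. l $ i \<le> u $ i) \<Longrightarrow> emeasure M (box l u) = ennreal (\<Prod>i\<in>UNIV. u $ i - l $ i)"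
  shows "lborel = M"
proof (rule lborel_eqI)
  fix l u :: "real^'n" assume "\<And>b. b \<in> Basis \<Longrightarrow> l \<bullet> b \<le> u \<bullet> b"
  then have le: "l $ i \<le> u $ i" for i using axis_in_Basis_iff[of i "1::real"] by (metis cart_eq_inner_axis Basis_real_def singletonI)
  have B: "(Basis :: (real^'n) set) = range (\<lambda>i. axis i 1)" by (auto simp: Basis_vec_def)
  have inj: "inj (\<lambda>i. axis i (1::real) :: real^'n)" by (auto simp: inj_on_def axis_eq_axis)
  show "emeasure M (box l u) = ennreal (\<Prod>b\<in>Basis. (u - l) \<bullet> b)"
    using assms(2)[OF le] by (simp add: B prod.reindex[OF inj] inner_axis)
qed (simp add: assms)

text \<open>
  Permuting and renaming coordinates preserves Lebesgue measure, as it permutes the sides of a box.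
\<close>

lemma lborel_reindex_cart:
  fixes h :: "'m::finite \<Rightarrow> 'n::finite"
  assumes "bij h"
  shows "(lborel :: (real^'m) measure) = distr (lborel :: (real^'n) measure) borel (\<lambda>x. \<chi> a. x $ h a)"
proof (rule lborel_cart_eqI)
  fix l u :: "real^'m" assume le: "\<And>i. l $ i \<le> u $ i"
  let ?\<phi> = "\<lambda>x :: real^'n. (\<chi> a. x $ h a) :: real^'m"
  have meas: "?\<phi> \<in> borel_measurable borel" by (intro borel_measurable_continuous_onI continuous_intros)
  have inv: "h (inv h i) = i" "inv h (h a) = a" for i a
    using assms by (simp_all add: bij_is_surj surj_f_inv_f bij_is_inj)
  have "?\<phi> -` box l u = box (\<chi> i. l $ inv h i) (\<chi> i. u $ inv h i)"
  proof (intro set_eqI iffI)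
    fix x assume "x \<in> ?\<phi> -` box l u"
    then have "l $ inv h i < x $ h (inv h i) \<and> x $ h (inv h i) < u $ inv h i" for i
      by (simp add: mem_box_cart)
    then show "x \<in> box (\<chi> i. l $ inv h i) (\<chi> i. u $ inv h i)" by (simp add: mem_box_cart inv)
  next
    fix x assume "x \<in> box (\<chi> i. l $ inv h i) (\<chi> i. u $ inv h i)"
    then have "l $ inv h (h a) < x $ h a \<and> x $ h a < u $ inv h (h a)" for a
      unfolding mem_box_cart by (metis vec_lambda_beta)
    then show "x \<in> ?\<phi> -` box l u" by (simp add: mem_box_cart inv)
  qed
  then have "emeasure (distr lborel borel ?\<phi>) (box l u) = ennreal (\<Prod>i\<in>UNIV. u $ inv h i - l $ inv h i)"
    using meas le by (simp add: emeasure_distr emeasure_lborel_box_cart)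
  also have "(\<Prod>i\<in>UNIV. u $ inv h i - l $ inv h i) = (\<Prod>a\<in>UNIV. u $ a - l $ a)"
    using bij_imp_bij_inv[OF assms] by (intro prod.reindex_bij_betw)
  finally show "emeasure (distr lborel borel ?\<phi>) (box l u) = ennreal (\<Prod>a\<in>UNIV. u $ a - l $ a)" .
qed simp

text \<open>
  The general case follows from the one of a well-ordered index type by conjugating \<open>f\<close> with the
  renaming of coordinates \<open>\<phi>\<close>.
\<close>

theorem emeasure_image_compact:
  fixes f :: "real^'n \<Rightarrow> real^'n" and A :: "real^'n \<Rightarrow> real^'n^'n"
  assumes "compact S" and der: "\<And>x. x \<in> S \<Longrightarrow> (f has_derivative (\<lambda>v. A x *v v)) (at x within S)"
    and contA: "continuous_on S A" and "inj_on f S"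
  shows "emeasure lborel (f ` S) = (\<integral>\<^sup>+x. ennreal \<bar>det (A x)\<bar> * indicator S x \<partial>lborel)"
proof -
  obtain h :: "'n ordered_copy \<Rightarrow> 'n" where h: "bij h"
    using finite_same_card_bij[of "UNIV :: 'n ordered_copy set" "UNIV :: 'n set"] card_ordered_copy[where 'a='n]
    by auto
  have inv: "h (inv h i) = i" "inv h (h a) = a" for i a
    using h by (simp_all add: bij_is_surj surj_f_inv_f bij_is_inj)
  define \<phi> :: "real^'n \<Rightarrow> real^'n ordered_copy" where "\<phi> x = (\<chi> a. x $ h a)" for x
  define \<psi> :: "real^'n ordered_copy \<Rightarrow> real^'n" where "\<psi> x = (\<chi> i. x $ inv h i)" for x
  have \<phi>\<psi> [simp]: "\<phi> (\<psi> y) = y" "\<psi> (\<phi> x) = x" for x y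
    by (simp_all add: \<phi>_def \<psi>_def vec_eq_iff inv)
  have lin: "linear \<phi>" "linear \<psi>"
    by (auto intro!: linearI simp: \<phi>_def \<psi>_def vec_eq_iff)
  then have cont: "continuous_on T \<phi>" "continuous_on T' \<psi>" for T T'
    by (auto intro: linear_continuous_on linear_conv_bounded_linear[THEN iffD1])
  have meas [measurable]: "\<phi> \<in> borel_measurable borel" "\<psi> \<in> borel_measurable borel"
    by (intro borel_measurable_continuous_onI cont)+
  have lb: "(lborel :: (real^'n ordered_copy) measure) = distr lborel borel \<phi>"
    using lborel_reindex_cart[OF h] by (simp add: \<phi>_def[abs_def])
  define A' where "A' y = (\<chi> a b. A (\<psi> y) $ h a $ h b)" for y
  have det: "det (A' y) = det (A (\<psi> y))" for y
    using h by (intro det_block_identity_rows[of h, symmetric]) (auto simp: A'_def bij_def)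
  have "emeasure lborel (\<phi> ` f ` S) = emeasure lborel (f ` S)"
  proof -
    have "compact (f ` S)"
      using der assms(1) by (intro compact_continuous_image)
        (auto simp: continuous_on_eq_continuous_within intro: has_derivative_continuous)
    then have "compact (\<phi> ` f ` S)" by (rule compact_continuous_image[OF cont(1)])
    moreover have "\<phi> -` (\<phi> ` f ` S) = f ` S" by (auto simp: image_iff) (metis \<phi>\<psi>(2))
    ultimately show ?thesis
      unfolding lb by (subst emeasure_distr) (auto intro: borel_closed compact_imp_closed)
  qed
  moreover have "\<phi> ` f ` S = (\<lambda>y. \<phi> (f (\<psi> y))) ` \<phi> ` S" by (simp add: image_image)
  moreover have "emeasure lborel ((\<lambda>y. \<phi> (f (\<psi> y))) ` \<phi> ` S) =
      (\<integral>\<^sup>+y. ennreal \<bar>det (A' y)\<bar> * indicator (\<phi> ` S) y \<partial>lborel)"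
  proof (rule emeasure_image_compact_wellorder)
    show "compact (\<phi> ` S)" by (intro compact_continuous_image cont assms)
    show "continuous_on (\<phi> ` S) A'"
    proof -
      have "continuous_on (\<phi> ` S) (\<lambda>y. A (\<psi> y))"
        by (rule continuous_on_compose2[OF contA cont(2)]) auto
      then show ?thesis unfolding A'_def by (intro continuous_intros)
    qed
    show "inj_on (\<lambda>y. \<phi> (f (\<psi> y))) (\<phi> ` S)"
      using assms(4) by (auto simp: inj_on_def) (metis \<phi>\<psi>(2))
    fix y assume y: "y \<in> \<phi> ` S"
    have "(f has_derivative (\<lambda>v. A (\<psi> y) *v v)) (at (\<psi> y) within (\<psi> ` \<phi> ` S))"
      using y der[of "\<psi> y"] by (auto simp: image_image)
    then have "((\<lambda>y. f (\<psi> y)) has_derivative (\<lambda>v. A (\<psi> y) *v \<psi> v)) (at y within \<phi> ` S)"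
      by (intro has_derivative_in_compose[where g=f and f=\<psi>]
          bounded_linear_imp_has_derivative linear_conv_bounded_linear[THEN iffD1] lin)
    then have "((\<lambda>y. \<phi> (f (\<psi> y))) has_derivative (\<lambda>v. \<phi> (A (\<psi> y) *v \<psi> v))) (at y within \<phi> ` S)"
      by (intro bounded_linear.has_derivative[of \<phi>] linear_conv_bounded_linear[THEN iffD1] lin)
    moreover have "\<phi> (A (\<psi> y) *v \<psi> v) = A' y *v v" for v
    proof -
      have "(\<Sum>i\<in>UNIV. A (\<psi> y) $ h a $ i * v $ inv h i) = (\<Sum>b\<in>UNIV. A (\<psi> y) $ h a $ h b * v $ b)" for a
        using sum.reindex_bij_betw[OF h, of "\<lambda>i. A (\<psi> y) $ h a $ i * v $ inv h i"] by (simp add: inv)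
      then show ?thesis
        by (simp add: vec_eq_iff \<phi>_def \<psi>_def A'_def matrix_vector_mult_def)
    qed
    ultimately show "((\<lambda>y. \<phi> (f (\<psi> y))) has_derivative (\<lambda>v. A' y *v v)) (at y within \<phi> ` S)" by simp
  qed
  moreover have "(\<integral>\<^sup>+y. ennreal \<bar>det (A' y)\<bar> * indicator (\<phi> ` S) y \<partial>lborel) =
      (\<integral>\<^sup>+x. ennreal \<bar>det (A' (\<phi> x))\<bar> * indicator (\<phi> ` S) (\<phi> x) \<partial>lborel)"
  proof -
    have c: "compact (\<phi> ` S)" by (intro compact_continuous_image cont assms)
    have "continuous_on (\<phi> ` S) (\<lambda>y. A (\<psi> y))"
      by (rule continuous_on_compose2[OF contA cont(2)]) auto
    then have "continuous_on (\<phi> ` S) (\<lambda>y. \<bar>det (A' y)\<bar>)"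
      unfolding det by (intro continuous_intros continuous_on_det_cart)
    then have "(\<lambda>y. indicator (\<phi> ` S) y *\<^sub>R \<bar>det (A' y)\<bar>) \<in> borel_measurable borel"
      using borel_measurable_integrable[OF borel_integrable_compact[OF c, of "\<lambda>y. \<bar>det (A' y)\<bar>"]] by simp
    then have "(\<lambda>y. ennreal (indicator (\<phi> ` S) y *\<^sub>R \<bar>det (A' y)\<bar>)) \<in> borel_measurable borel"
      by measurable
    also have "(\<lambda>y. ennreal (indicator (\<phi> ` S) y *\<^sub>R \<bar>det (A' y)\<bar>)) =
        (\<lambda>y. ennreal \<bar>det (A' y)\<bar> * indicator (\<phi> ` S) y)"
      by (auto simp: fun_eq_iff indicator_def)
    finally show ?thesis
      by (subst lb, subst nn_integral_distr) auto
  qed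
  moreover have "\<phi> x \<in> \<phi> ` S \<longleftrightarrow> x \<in> S" for x by (auto simp: image_iff) (metis \<phi>\<psi>(2))
  ultimately show ?thesis by (simp add: det indicator_def)
qed


section \<open>Completing a map to a square map\<close>

text \<open>
  Inverse of the splitting of a vector into the coordinates selected by \<open>e\<close> and the remaining ones.
\<close>

definition glue :: "('r::finite \<Rightarrow> 'n::finite) \<Rightarrow> real^'r \<Rightarrow> ('n \<Rightarrow> real) \<Rightarrow> real^'n" where
  "glue e z w = (\<chi> i. if i \<in> range e then z $ inv e i else w i)"

lemma borel_measurable_cart_iff:
  fixes f :: "'a \<Rightarrow> real^'n"
  shows "f \<in> borel_measurable M \<longleftrightarrow> (\<forall>i. (\<lambda>x. f x $ i) \<in> borel_measurable M)"
proof -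
  have "(\<forall>b\<in>Basis. (\<lambda>x. f x \<bullet> b) \<in> borel_measurable M) \<longleftrightarrow> (\<forall>i. (\<lambda>x. f x \<bullet> axis i 1) \<in> borel_measurable M)"
    by (auto simp: Basis_vec_def)
  then show ?thesis
    using borel_measurable_euclidean_space[of f M] by (simp add: inner_axis)
qed

lemma glue_measurable:
  fixes e :: "'r::finite \<Rightarrow> 'n::finite"
  shows "(\<lambda>(z, w). glue e z w) \<in> borel \<Otimes>\<^sub>M lborel_on (- range e) \<rightarrow>\<^sub>M borel"
  unfolding borel_measurable_cart_iff
proof
  fix i
  show "(\<lambda>x. (case x of (z, w) \<Rightarrow> glue e z w) $ i) \<in> borel_measurable (borel \<Otimes>\<^sub>M lborel_on (- range e))"
  proof (cases "i \<in> range e")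
    case True
    have "(\<lambda>z :: real^'r. z $ inv e i) \<in> borel_measurable borel"
      using borel_measurable_cart_iff[of "\<lambda>z. z"] by simp
    then have "(\<lambda>x :: (real^'r) \<times> ('n \<Rightarrow> real). fst x $ inv e i) \<in> borel_measurable (borel \<Otimes>\<^sub>M lborel_on (- range e))"
      by (rule measurable_compose[OF measurable_fst])
    then show ?thesis using True by (simp add: glue_def split_beta)
  next
    case False
    then have "(\<lambda>w. w i) \<in> lborel_on (- range e) \<rightarrow>\<^sub>M (borel :: real measure)"
      using measurable_component_singleton[of i "- range e" "\<lambda>_. lborel"] by simp
    then have "(\<lambda>x :: (real^'r) \<times> ('n \<Rightarrow> real). snd x i) \<in> borel_measurable (borel \<Otimes>\<^sub>M lborel_on (- range e))"
      by (rule measurable_compose[OF measurable_snd])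
    then show ?thesis using False by (simp add: glue_def split_beta)
  qed
qed

text \<open>
  Fubini's theorem for the splitting of the coordinates by \<open>e\<close>: both measures agree on boxes.
\<close>

lemma lborel_eq_distr_glue:
  fixes e :: "'r::finite \<Rightarrow> 'n::finite"
  assumes "inj e"
  shows "(lborel :: (real^'n) measure) =
    distr (lborel \<Otimes>\<^sub>M lborel_on (- range e)) borel (\<lambda>(z, w). glue e z w)"
proof (rule lborel_cart_eqI)
  let ?P = "lborel_on (- range e)"
  interpret product_sigma_finite "\<lambda>_::'n. lborel :: real measure"
    by (simp add: product_sigma_finite_def lborel.sigma_finite_measure_axioms)
  interpret P: sigma_finite_measure ?P by (rule sigma_finite) simp
  have meas: "(\<lambda>(z, w). glue e z w) \<in> lborel \<Otimes>\<^sub>M ?P \<rightarrow>\<^sub>M borel"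
    using glue_measurable[of e] by (simp cong: measurable_cong_sets)
  fix l u :: "real^'n" assume le: "\<And>i. l $ i \<le> u $ i"
  let ?B = "box (\<chi> a. l $ e a) (\<chi> a. u $ e a)" and ?C = "\<Pi>\<^sub>E j\<in>- range e. {l $ j<..<u $ j}"
  have "(\<lambda>(z, w). glue e z w) -` box l u \<inter> space (lborel \<Otimes>\<^sub>M ?P) = ?B \<times> ?C"
  proof (intro set_eqI iffI; clarify)
    fix z w assume a: "(z, w) \<in> space (lborel \<Otimes>\<^sub>M ?P)" "glue e z w \<in> box l u"
    then have b: "l $ i < glue e z w $ i \<and> glue e z w $ i < u $ i" for i by (simp add: mem_box_cart)
    have "l $ e a < z $ a \<and> z $ a < u $ e a" for a
      using b[of "e a"] \<open>inj e\<close> by (simp add: glue_def)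
    moreover have "l $ j < w j \<and> w j < u $ j" if "j \<in> - range e" for j
      using b[of j] that by (simp add: glue_def)
    ultimately show "z \<in> ?B \<and> w \<in> ?C"
      using a(1) by (auto simp: mem_box_cart space_pair_measure space_PiM PiE_def)
  next
    fix z w assume a: "z \<in> ?B" "w \<in> ?C"
    have "l $ i < glue e z w $ i \<and> glue e z w $ i < u $ i" for i
    proof (cases "i \<in> range e")
      case True
      then obtain b where "i = e b" by auto
      then show ?thesis using a(1) \<open>inj e\<close> by (simp add: glue_def mem_box_cart)
    next
      case False
      then show ?thesis using a(2) by (auto simp: glue_def PiE_iff)
    qed
    then show "(z, w) \<in> (\<lambda>(z, w). glue e z w) -` box l u \<inter> space (lborel \<Otimes>\<^sub>M ?P)"
      using a(2) by (auto simp: mem_box_cart space_pair_measure space_PiM PiE_iff)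
  qed
  then have "emeasure (distr (lborel \<Otimes>\<^sub>M ?P) borel (\<lambda>(z, w). glue e z w)) (box l u)
      = emeasure (lborel \<Otimes>\<^sub>M ?P) (?B \<times> ?C)"
    by (subst emeasure_distr[OF meas]) auto
  also have "\<dots> = emeasure lborel ?B * emeasure ?P ?C"
    by (intro P.emeasure_pair_measure_Times) (auto intro!: sets_PiM_I_finite)
  also have "emeasure lborel ?B = ennreal (\<Prod>a\<in>UNIV. u $ e a - l $ e a)"
    using le by (subst emeasure_lborel_box_cart) auto
  also have "emeasure ?P ?C = (\<Prod>j\<in>- range e. emeasure lborel {l $ j<..<u $ j})"
    by (intro emeasure_PiM) auto
  also have "\<dots> = ennreal (\<Prod>j\<in>- range e. u $ j - l $ j)"
    using le by (simp add: prod_ennreal)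
  also have "ennreal (\<Prod>a\<in>UNIV. u $ e a - l $ e a) * ennreal (\<Prod>j\<in>- range e. u $ j - l $ j)
      = ennreal ((\<Prod>j\<in>range e. u $ j - l $ j) * (\<Prod>j\<in>- range e. u $ j - l $ j))"
    using le by (simp add: ennreal_mult prod_nonneg prod.reindex[OF assms])
  also have "(\<Prod>j\<in>range e. u $ j - l $ j) * (\<Prod>j\<in>- range e. u $ j - l $ j) = (\<Prod>i\<in>range e \<union> - range e. u $ i - l $ i)"
    by (rule prod.union_disjoint[symmetric]) auto
  finally show "emeasure (distr (lborel \<Otimes>\<^sub>M ?P) borel (\<lambda>(z, w). glue e z w)) (box l u)
      = ennreal (\<Prod>i\<in>UNIV. u $ i - l $ i)" by simp
qed simp

text \<open>
  Volume as the integral over \<open>z\<close> of the volumes of the slices of \<open>B\<close> with first part \<open>z\<close>.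
\<close>

lemma emeasure_lborel_glue:
  fixes e :: "'r::finite \<Rightarrow> 'n::finite" and B :: "(real^'n) set"
  assumes "inj e" "B \<in> sets borel"
  defines "h \<equiv> \<lambda>z. emeasure (lborel_on (- range e))
                     {w \<in> space (lborel_on (- range e)). glue e z w \<in> B}"
  shows "h \<in> borel_measurable borel" "emeasure lborel B = (\<integral>\<^sup>+z. h z \<partial>lborel)"
    and "\<And>z. {w \<in> space (lborel_on (- range e)). glue e z w \<in> B} \<in> sets (lborel_on (- range e))"
proof -
  let ?P = "lborel_on (- range e)"
  interpret product_sigma_finite "\<lambda>_::'n. lborel :: real measure"
    by (simp add: product_sigma_finite_def lborel.sigma_finite_measure_axioms)
  interpret P: sigma_finite_measure ?P by (rule sigma_finite) simp
  let ?C = "(\<lambda>(z, w). glue e z w) -` B \<inter> space (lborel \<Otimes>\<^sub>M ?P)"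
  have meas: "(\<lambda>(z, w). glue e z w) \<in> lborel \<Otimes>\<^sub>M ?P \<rightarrow>\<^sub>M borel"
    using glue_measurable[of e] by (simp cong: measurable_cong_sets)
  have C: "?C \<in> sets (lborel \<Otimes>\<^sub>M ?P)" using measurable_sets[OF meas assms(2)] .
  have slice: "Pair z -` ?C = {w \<in> space ?P. glue e z w \<in> B}" for z
    by (auto simp: space_pair_measure)
  show "{w \<in> space ?P. glue e z w \<in> B} \<in> sets ?P" for z
    using sets_Pair1[OF C, of z] by (simp only: slice)
  show "h \<in> borel_measurable borel"
    using P.measurable_emeasure_Pair[OF C] unfolding slice h_def by simp
  have "emeasure lborel B = emeasure (lborel \<Otimes>\<^sub>M ?P) ?C"
    by (subst lborel_eq_distr_glue[OF assms(1)], rule emeasure_distr[OF meas assms(2)])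
  also have "\<dots> = (\<integral>\<^sup>+z. h z \<partial>lborel)"
    unfolding P.emeasure_pair_measure_alt[OF C] slice h_def ..
  finally show "emeasure lborel B = (\<integral>\<^sup>+z. h z \<partial>lborel)" .
qed

text \<open>
  The completion of \<open>\<xi>\<close> to a map between spaces of equal dimension, to which volume formulas apply.
\<close>

definition completed_map :: "('r::finite \<Rightarrow> 'n::finite) \<Rightarrow> ('n \<Rightarrow> real^'n) \<Rightarrow> (real^'n \<Rightarrow> real^'r) \<Rightarrow> real^'n \<Rightarrow> real^'n" where
  "completed_map e u \<xi> x = glue e (\<xi> x) (frame_coords (- range e) u x)"

definition completed_jacobian :: "('r::finite \<Rightarrow> 'n::finite) \<Rightarrow> ('n \<Rightarrow> real^'n) \<Rightarrow> real^'r^'n \<Rightarrow> real^'n^'n" where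
  "completed_jacobian e u g = (\<chi> i j. if i \<in> range e then g $ j $ inv e i else u i $ j)"

lemma completed_map_has_derivative:
  assumes "(\<xi> has_derivative (\<lambda>v. transpose g *v v)) (at x within S)"
  shows "(completed_map e u \<xi> has_derivative (\<lambda>v. completed_jacobian e u g *v v)) (at x within S)"
proof -
  have comp: "((\<lambda>y. \<xi> y $ a) has_derivative (\<lambda>v. (transpose g *v v) $ a)) (at x within S)" for a
    by (rule bounded_linear.has_derivative[OF bounded_linear_vec_nth assms])
  have "((\<lambda>y. completed_map e u \<xi> y $ i) has_derivative (\<lambda>v. (completed_jacobian e u g *v v) $ i)) (at x within S)" for i
  proof (cases "i \<in> range e")
    case True
    then show ?thesis using comp[of "inv e i"]
      by (simp add: completed_map_def completed_jacobian_def glue_def matrix_vector_mult_def transpose_def)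
  next
    case False
    have "((\<lambda>y. u i \<bullet> y) has_derivative (\<lambda>v. u i \<bullet> v)) (at x within S)"
      by (rule bounded_linear_imp_has_derivative[OF bounded_linear_inner_right])
    then show ?thesis using False
      by (simp add: completed_map_def completed_jacobian_def glue_def frame_coords_def
          matrix_vector_mult_def inner_vec_def)
  qed
  then show ?thesis
    by (subst has_derivative_componentwise_within) (auto simp: Basis_vec_def inner_axis)
qed

lemma completed_jacobian_continuous:
  assumes "continuous_on S G"
  shows "continuous_on S (\<lambda>x. completed_jacobian e u (G x))"
proof -
  have "continuous_on S (\<lambda>x. if i \<in> range e then G x $ j $ inv e i else u i $ j)" for i j
    using assms by (cases "i \<in> range e") (auto intro!: continuous_intros)
  then show ?thesis unfolding completed_jacobian_def by (intro continuous_intros)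
qed

text \<open>
  The volume of the image of \<open>S\<close> under the completed map is computed in two ways: as the integral of
  the Jacobian, and by slices. The slice over \<open>z\<close> is the projection of \<open>level_set S \<xi> z\<close> to the
  coordinates of the frame, whose volume is at most the Hausdorff measure of the level set. The
  function \<open>h\<close> is the volume of the slice; the Hausdorff measure of the level set itself is not known
  to be measurable in \<open>z\<close>.
\<close>

lemma coarea_compact:
  fixes \<xi> :: "real^'n \<Rightarrow> real^'r" and G :: "real^'n \<Rightarrow> real^'r^'n"
  assumes "inj e" "orthonormal_on (- range e) u"
    and "compact S" "\<And>x. x \<in> S \<Longrightarrow> (\<xi> has_derivative (\<lambda>v. transpose (G x) *v v)) (at x within S)"
    and "continuous_on S G" "inj_on (completed_map e u \<xi>) S"
  shows "\<exists>h\<in>borel_measurable borel.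
     (\<integral>\<^sup>+x. ennreal \<bar>det (completed_jacobian e u (G x))\<bar> * indicator S x \<partial>lborel) = (\<integral>\<^sup>+z. h z \<partial>lborel) \<and>
     (\<forall>z. h z \<le> hausdorff_outer (card (- range e)) (level_set S \<xi> z))"
proof -
  let ?P = "lborel_on (- range e)"
  let ?\<Xi> = "completed_map e u \<xi>"
  note der = completed_map_has_derivative[OF assms(4)]
  have area: "emeasure lborel (?\<Xi> ` S) =
      (\<integral>\<^sup>+x. ennreal \<bar>det (completed_jacobian e u (G x))\<bar> * indicator S x \<partial>lborel)"
    by (intro emeasure_image_compact der completed_jacobian_continuous assms)
  have "compact (?\<Xi> ` S)"
    using der assms(3) by (intro compact_continuous_image)
      (auto simp: continuous_on_eq_continuous_within intro: has_derivative_continuous)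
  then have B: "?\<Xi> ` S \<in> sets borel" by (simp add: compact_imp_closed borel_closed)
  have "emeasure ?P {w \<in> space ?P. glue e z w \<in> ?\<Xi> ` S} \<le> hausdorff_outer (card (- range e)) (level_set S \<xi> z)" for z
  proof (rule emeasure_frame_coords_le_hausdorff_outer[OF _ assms(2)])
    show "{w \<in> space ?P. glue e z w \<in> ?\<Xi> ` S} \<subseteq> frame_coords (- range e) u ` level_set S \<xi> z"
    proof clarify
      fix w x assume w: "w \<in> space ?P" and x: "x \<in> S" and eq: "glue e z w = ?\<Xi> x"
      have "z $ a = \<xi> x $ a" for a
        using arg_cong[OF eq, of "\<lambda>v. v $ e a"] \<open>inj e\<close> by (simp add: completed_map_def glue_def)
      then have "\<xi> x = z" by (simp add: vec_eq_iff)
      moreover have "w i = frame_coords (- range e) u x i" for i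
      proof (cases "i \<in> range e")
        case True
        then show ?thesis using w by (auto simp: frame_coords_def space_PiM PiE_def extensional_def)
      next
        case False
        then show ?thesis using arg_cong[OF eq, of "\<lambda>v. v $ i"] by (simp add: completed_map_def glue_def)
      qed
      ultimately show "w \<in> frame_coords (- range e) u ` level_set S \<xi> z"
        using x by (intro image_eqI[of _ _ x]) (auto simp: level_set_def)
    qed
  qed (use emeasure_lborel_glue(3)[OF assms(1) B] in auto)
  then show ?thesis
    using emeasure_lborel_glue(1,2)[OF assms(1) B] area
    by (intro bexI[of _ "\<lambda>z. emeasure ?P {w \<in> space ?P. glue e z w \<in> ?\<Xi> ` S}"] conjI allI) simp_all
qed

text \<open>
  If the frame is orthogonal to the gradients, the product of the Jacobian with its transpose is block
  diagonal, with the Gram matrix and the identity as blocks.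
\<close>

lemma det_completed_jacobian:
  fixes g :: "real^'r^'n"
  assumes "inj e" "orthonormal_on (- range e) u"
    and "\<And>i a. i \<in> - range e \<Longrightarrow> u i \<bullet> column a g = 0"
  shows "\<bar>det (completed_jacobian e u g)\<bar> = sqrt (det (transpose g ** g))"
proof -
  let ?D = "completed_jacobian e u g"
  have "det (?D ** transpose ?D) = det (transpose g ** g)"
  proof (rule det_block_identity_rows[OF assms(1)])
    show "(?D ** transpose ?D) $ e a $ e b = (transpose g ** g) $ a $ b" for a b
      using assms(1) by (simp add: completed_jacobian_def matrix_matrix_mult_def transpose_def)
    fix i j assume i: "i \<notin> range e"
    show "(?D ** transpose ?D) $ i $ j = (if i = j then 1 else 0)"
    proof (cases "j \<in> range e")
      case True
      then obtain b where b: "j = e b" by auto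
      have "(?D ** transpose ?D) $ i $ j = u i \<bullet> column b g"
        using i b assms(1) by (simp add: completed_jacobian_def matrix_matrix_mult_def transpose_def
            inner_vec_def column_def)
      then show ?thesis using assms(3) i True by auto
    next
      case False
      have "(?D ** transpose ?D) $ i $ j = u i \<bullet> u j"
        using i False by (simp add: completed_jacobian_def matrix_matrix_mult_def transpose_def inner_vec_def)
      then show ?thesis using assms(2) i False by (auto simp: orthonormal_on_def)
    qed
  qed
  then have "(det ?D)\<^sup>2 = det (transpose g ** g)"
    by (simp add: det_mul power2_eq_square)
  then show ?thesis by (metis real_sqrt_abs)
qed

lemma exists_orthonormal_complement_frame:
  fixes g :: "real^'r^'n" and e :: "'r \<Rightarrow> 'n"
  assumes "inj e"
  shows "\<exists>u. orthonormal_on (- range e) u \<and> (\<forall>i\<in>- range e. \<forall>a. u i \<bullet> column a g = 0)"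
proof -
  let ?C = "span (columns g)"
  let ?S = "{y \<in> UNIV. \<forall>x\<in>?C. orthogonal x y}"
  have "columns g = range (\<lambda>a. column a g)" by (auto simp: columns_def)
  then have "card (columns g) \<le> CARD('r)" by (simp add: card_image_le)
  then have dC: "dim ?C \<le> CARD('r)"
    using dim_le_card'[of "columns g"] \<open>columns g = _\<close> by simp
  have "dim ?S + dim ?C = dim (UNIV :: (real^'n) set)"
    by (rule dim_subspace_orthogonal_to_vectors) auto
  then have dS: "CARD('n) - CARD('r) \<le> dim ?S" using dC by (simp add: dim_UNIV)
  have "subspace ?S" by (auto simp: subspace_def orthogonal_def inner_right_distrib)
  then obtain B where B: "B \<subseteq> ?S" "pairwise orthogonal B" "\<And>x. x \<in> B \<Longrightarrow> norm x = 1"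
      "independent B" "card B = dim ?S" "span B = ?S"
    by (rule orthonormal_basis_subspace) (rule that)
  have "card (- range e) = CARD('n) - CARD('r)"
    using assms by (simp add: Compl_eq_Diff_UNIV card_Diff_subset card_image)
  then have "card (- range e) \<le> card B" using B(5) dS by simp
  moreover have "finite B" using B(4) by (rule independent_imp_finite)
  ultimately obtain u where u: "u ` (- range e) \<subseteq> B" "inj_on u (- range e)"
    using card_le_inj[of "- range e" B] by auto
  have "orthonormal_on (- range e) u"
    unfolding orthonormal_on_def
  proof (intro ballI)
    fix i j assume ij: "i \<in> - range e" "j \<in> - range e"
    show "u i \<bullet> u j = (if i = j then 1 else 0)"
    proof (cases "i = j")
      case True
      then show ?thesis using B(3)[of "u i"] u(1) ij by (auto simp: norm_eq_1)
    next
      case False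
      then have "u i \<noteq> u j" using u(2) ij by (auto simp: inj_on_def)
      then show ?thesis using B(2) u(1) ij False by (auto simp: pairwise_def orthogonal_def)
    qed
  qed
  moreover have "u i \<bullet> column a g = 0" if "i \<in> - range e" for i a
  proof -
    have "column a g \<in> ?C" by (intro span_base) (auto simp: columns_def)
    moreover have "u i \<in> ?S" using u(1) B(1) that by blast
    ultimately have "orthogonal (column a g) (u i)" by blast
    then show ?thesis using orthogonal_commute orthogonal_def by metis
  qed
  ultimately show ?thesis by blast
qed


section \<open>Decomposition into transversal pieces\<close>

text \<open>
  Points near which \<open>f\<close> contracts distances from the point by a factor of at most \<open>m + 1\<close>, at scale
  \<open>1 / (m + 1)\<close>. This replaces the inverse function theorem: \<open>X\<close> is merely measurable, and a
  derivative within \<open>X\<close> gives no control on distances between two nearby points of \<open>X\<close>.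
\<close>

definition expansion_set :: "'a::metric_space set \<Rightarrow> ('a \<Rightarrow> 'b::metric_space) \<Rightarrow> nat \<Rightarrow> 'a set" where
  "expansion_set X f m =
     {x\<in>X. \<forall>y\<in>X. dist x y < 1 / real (Suc m) \<longrightarrow> dist x y \<le> real (Suc m) * dist (f x) (f y)}"

lemma in_expansion_set:
  fixes f :: "'a::euclidean_space \<Rightarrow> 'b::euclidean_space"
  assumes "x \<in> X" and der: "(f has_derivative f') (at x within X)" and "inj f'"
  shows "\<exists>m. x \<in> expansion_set X f m"
proof -
  have "linear f'" using der by (rule has_derivative_linear)
  then obtain B where B: "B > 0" "\<And>v. B * norm v \<le> norm (f' v)"
    using linear_inj_bounded_below_pos[OF _ \<open>inj f'\<close>] by blast
  have "\<exists>d>0. \<forall>y\<in>X. norm (y - x) < d \<longrightarrow> norm (f y - f x - f' (y - x)) \<le> B / 2 * norm (y - x)"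
    using der[unfolded has_derivative_within_alt] B(1) half_gt_zero by blast
  then obtain d where d: "d > 0"
    "\<And>y. y \<in> X \<Longrightarrow> norm (y - x) < d \<Longrightarrow> norm (f y - f x - f' (y - x)) \<le> B / 2 * norm (y - x)"
    by blast
  \<comment> \<open>Half of the lower bound \<open>B\<close> of the derivative absorbs the remainder at distances below \<open>d\<close>.\<close>
  have "0 < min d (B / 2)" using B d by simp
  then obtain m where "1 / real (Suc m) < min d (B / 2)" by (rule nat_approx_posE)
  then have m: "1 / real (Suc m) < d" "1 / real (Suc m) < B / 2" by auto
  have "dist x y \<le> real (Suc m) * dist (f x) (f y)" if y: "y \<in> X" "dist x y < 1 / real (Suc m)" for y
  proof -
    have "norm (f y - f x - f' (y - x)) \<le> B / 2 * norm (y - x)"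
      using y m by (intro d(2)) (auto simp: dist_norm norm_minus_commute)
    moreover have "norm (f' (y - x)) \<le> norm (f y - f x) + norm (f y - f x - f' (y - x))"
      using norm_triangle_sub[of "f' (y - x)" "f y - f x"] by (simp add: norm_minus_commute)
    ultimately have "B / 2 * norm (y - x) \<le> norm (f y - f x)" using B(2)[of "y - x"] by linarith
    moreover have "1 / real (Suc m) * norm (y - x) \<le> B / 2 * norm (y - x)"
      using m(2) by (intro mult_right_mono) auto
    ultimately have "1 / real (Suc m) * norm (y - x) \<le> norm (f y - f x)" by linarith
    then have "norm (y - x) \<le> real (Suc m) * norm (f y - f x)"
      by (simp add: field_simps del: of_nat_Suc)
    then show ?thesis by (simp add: dist_norm norm_minus_commute del: of_nat_Suc)
  qed
  then have "x \<in> expansion_set X f m" using \<open>x \<in> X\<close> by (simp add: expansion_set_def del: of_nat_Suc)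
  then show ?thesis ..
qed

lemma inj_on_expansion_set_ball:
  assumes "S \<subseteq> expansion_set X f m \<inter> ball q (1 / (2 * real (Suc m)))"
  shows "inj_on f S"
proof (rule inj_onI)
  fix x y assume xy: "x \<in> S" "y \<in> S" "f x = f y"
  have "dist q x < 1 / (2 * real (Suc m))" "dist q y < 1 / (2 * real (Suc m))"
    using xy assms by auto
  then have "dist x y < 1 / (2 * real (Suc m)) + 1 / (2 * real (Suc m))"
    using dist_triangle3[of x y q] by linarith
  also have "\<dots> = 1 / real (Suc m)" by (simp add: field_simps del: of_nat_Suc)
  finally have "dist x y < 1 / real (Suc m)" .
  moreover have "x \<in> expansion_set X f m" "y \<in> X" using assms xy by (auto simp: expansion_set_def)
  ultimately have "dist x y \<le> real (Suc m) * dist (f x) (f y)" unfolding expansion_set_def by blast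
  then show "x = y" using xy(3) by simp
qed

lemma closedin_expansion_set:
  assumes "continuous_on X f"
  shows "closedin (top_of_set X) (expansion_set X f m)"
proof (cases "X = {}")
  case True then show ?thesis by (simp add: expansion_set_def)
next
  case False
  have "expansion_set X f m = (\<Inter>y\<in>X. (X \<inter> (\<lambda>x. dist x y) -` {1 / real (Suc m)..}) \<union>
      (X \<inter> (\<lambda>x. real (Suc m) * dist (f x) (f y) - dist x y) -` {0..}))"
    using False by (auto simp: expansion_set_def not_less simp del: of_nat_Suc) (metis not_le)
  moreover have "closedin (top_of_set X) \<dots>"
    using False assms
    by (intro closedin_INT closedin_Un continuous_closedin_preimage continuous_intros) auto
  ultimately show ?thesis by simp
qed

lemma closedin_sets_restrict_borel:
  assumes "closedin (top_of_set X) S"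
  shows "S \<in> sets (restrict_space borel X)"
proof -
  obtain T where "closed T" "S = X \<inter> T" using assms unfolding closedin_closed by blast
  then show ?thesis unfolding sets_restrict_space by (intro image_eqI[of _ _ T] borel_closed)
qed

lemma openin_sets_restrict_borel:
  assumes "openin (top_of_set X) S"
  shows "S \<in> sets (restrict_space borel X)"
proof -
  obtain T where "open T" "S = X \<inter> T" using assms unfolding openin_open by blast
  then show ?thesis unfolding sets_restrict_space by (intro image_eqI[of _ _ T] borel_open)
qed

lemma gram_det_continuous:
  fixes G :: "real^'n \<Rightarrow> real^'r^'n"
  assumes "continuous_on X G"
  shows "continuous_on X (gram_det G)"
  unfolding gram_det_def matrix_matrix_mult_def transpose_def
  using assms by (intro continuous_on_det_cart continuous_intros)

text \<open>
  The sets on which the volume formula for the completed map yields the coarea inequality for \<open>\<xi>\<close> up to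
  the factor \<open>c\<close>.
\<close>

definition transversal_piece ::
  "('r::finite \<Rightarrow> 'n::finite) \<Rightarrow> real \<Rightarrow> (real^'n \<Rightarrow> real^'r) \<Rightarrow> (real^'n \<Rightarrow> real^'r^'n) \<Rightarrow> (real^'n) set \<Rightarrow> ('n \<Rightarrow> real^'n) \<Rightarrow> bool" where
  "transversal_piece e c \<xi> G S u \<longleftrightarrow> orthonormal_on (- range e) u \<and> inj_on (completed_map e u \<xi>) S \<and>
     (\<forall>x\<in>S. c * sqrt (gram_det G x) \<le> \<bar>det (completed_jacobian e u (G x))\<bar>)"

text \<open>
  The Gram determinant is the square of the Jacobian determinant of a completed map.
\<close>

lemma gram_det_nonneg:
  fixes G :: "real^'n \<Rightarrow> real^'r^'n" and e :: "'r \<Rightarrow> 'n"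
  assumes "inj e"
  shows "0 \<le> gram_det G x"
proof -
  obtain u where "orthonormal_on (- range e) u" "\<forall>i\<in>- range e. \<forall>a. u i \<bullet> column a (G x) = 0"
    using exists_orthonormal_complement_frame[OF assms] by blast
  then have "\<bar>det (completed_jacobian e u (G x))\<bar> = sqrt (gram_det G x)"
    unfolding gram_det_def by (intro det_completed_jacobian assms) auto
  then show ?thesis by (metis abs_ge_zero real_sqrt_ge_0_iff)
qed

text \<open>
  For the frame orthogonal to the gradients at \<open>x0\<close> the two sides agree at \<open>x0\<close> for \<open>c = 1\<close>, so a
  factor \<open>c < 1\<close> leaves room for a neighbourhood.
\<close>

lemma exists_transversal_neighbourhood:
  fixes G :: "real^'n \<Rightarrow> real^'r^'n" and e :: "'r \<Rightarrow> 'n"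
  assumes "inj e" "continuous_on X G" "0 < c" "c < 1" "x0 \<in> X" "gram_det G x0 \<noteq> 0"
  shows "\<exists>u U. orthonormal_on (- range e) u \<and> open U \<and> x0 \<in> U \<and>
     (\<forall>x\<in>X \<inter> U. det (completed_jacobian e u (G x)) \<noteq> 0 \<and>
        c * sqrt (gram_det G x) \<le> \<bar>det (completed_jacobian e u (G x))\<bar>)"
proof -
  obtain u where u: "orthonormal_on (- range e) u" "\<forall>i\<in>- range e. \<forall>a. u i \<bullet> column a (G x0) = 0"
    using exists_orthonormal_complement_frame[OF assms(1)] by blast
  let ?d = "\<lambda>x. \<bar>det (completed_jacobian e u (G x))\<bar>"
  let ?g = "\<lambda>x. sqrt (gram_det G x)"
  have eq: "?d x0 = ?g x0"
    unfolding gram_det_def using u by (intro det_completed_jacobian assms) auto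
  have pos: "0 < ?g x0" using gram_det_nonneg[OF assms(1), of G x0] assms(6) by simp
  have cd: "continuous_on X ?d"
    by (intro continuous_intros continuous_on_det_cart completed_jacobian_continuous assms)
  have cg: "continuous_on X ?g"
    by (intro continuous_intros gram_det_continuous assms)
  have "continuous_on X (\<lambda>x. (?d x, ?d x - c * ?g x))"
    by (intro continuous_on_Pair continuous_on_diff continuous_on_mult_left cd cg)
  then have "openin (top_of_set X) (X \<inter> (\<lambda>x. (?d x, ?d x - c * ?g x)) -` ({0<..} \<times> {0<..}))"
    by (rule continuous_openin_preimage_gen) (auto intro: open_Times)
  then obtain U where U: "open U" "X \<inter> (\<lambda>x. (?d x, ?d x - c * ?g x)) -` ({0<..} \<times> {0<..}) = X \<inter> U"
    by (auto simp: openin_open)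
  have "c * ?g x0 < 1 * ?g x0" using pos assms(4) by (intro mult_strict_right_mono)
  then have "x0 \<in> X \<inter> U" unfolding U(2)[symmetric] using eq pos assms(5) by simp
  moreover have "det (completed_jacobian e u (G x)) \<noteq> 0 \<and> c * ?g x \<le> ?d x" if "x \<in> X \<inter> U" for x
    using that unfolding U(2)[symmetric] by auto
  ultimately show ?thesis using u(1) U(1) by blast
qed

text \<open>
  Countably many of the neighbourhoods above cover the set by Lindelof's theorem. Each of them is cut
  further by the expansion sets of its completed map and by balls of half the expansion scale around
  the points of a countable dense set, on which the completed map is injective.
\<close>

lemma transversal_decomposition:
  fixes \<xi> :: "real^'n \<Rightarrow> real^'r" and G :: "real^'n \<Rightarrow> real^'r^'n" and e :: "'r \<Rightarrow> 'n"
  assumes "inj e" and der: "\<And>x. x \<in> X \<Longrightarrow> (\<xi> has_derivative (\<lambda>v. transpose (G x) *v v)) (at x within X)"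
    and G: "continuous_on X G" and c: "0 < c" "c < 1"
  shows "\<exists>K :: nat \<Rightarrow> (real^'n) set. disjoint_family K \<and> (\<Union>n. K n) = {x\<in>X. gram_det G x \<noteq> 0} \<and>
    (\<forall>n. K n \<in> sets (restrict_space borel X)) \<and> (\<forall>n. \<exists>u. transversal_piece e c \<xi> G (K n) u)"
proof -
  define X0 where "X0 = {x\<in>X. gram_det G x \<noteq> 0}"
  have "\<forall>x0\<in>X0. \<exists>uU. orthonormal_on (- range e) (fst uU) \<and> open (snd uU) \<and> x0 \<in> snd uU \<and>
     (\<forall>x\<in>X \<inter> snd uU. det (completed_jacobian e (fst uU) (G x)) \<noteq> 0 \<and>
        c * sqrt (gram_det G x) \<le> \<bar>det (completed_jacobian e (fst uU) (G x))\<bar>)"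
    using exists_transversal_neighbourhood[OF assms(1) G c] by (simp add: X0_def)
  from bchoice[OF this] obtain uU where uU: "\<And>x0. x0 \<in> X0 \<Longrightarrow> orthonormal_on (- range e) (fst (uU x0))"
    "\<And>x0. x0 \<in> X0 \<Longrightarrow> open (snd (uU x0))" "\<And>x0. x0 \<in> X0 \<Longrightarrow> x0 \<in> snd (uU x0)"
    "\<And>x0 x. x0 \<in> X0 \<Longrightarrow> x \<in> X \<inter> snd (uU x0) \<Longrightarrow> det (completed_jacobian e (fst (uU x0)) (G x)) \<noteq> 0"
    "\<And>x0 x. x0 \<in> X0 \<Longrightarrow> x \<in> X \<inter> snd (uU x0) \<Longrightarrow>
        c * sqrt (gram_det G x) \<le> \<bar>det (completed_jacobian e (fst (uU x0)) (G x))\<bar>"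
    by blast
  define U where "U = (\<lambda>x0. snd (uU x0))"
  define u where "u = (\<lambda>x0. fst (uU x0))"
  obtain F where F: "F \<subseteq> U ` X0" "countable F" "\<Union>F = \<Union>(U ` X0)"
    using Lindelof[of "U ` X0"] uU(2) by (metis U_def imageE)
  obtain C where C: "countable C" "C \<subseteq> X0" "F = U ` C"
    using countable_subset_image[of F U X0] F(1,2) by auto
  obtain D :: "(real^'n) set" where D: "countable D" "\<And>T. open T \<Longrightarrow> T \<noteq> {} \<Longrightarrow> \<exists>d\<in>D. d \<in> T"
    using countable_dense_setE by blast
  define P where "P = (\<lambda>(x0, m, q). X0 \<inter> U x0 \<inter> expansion_set X (completed_map e (u x0) \<xi>) m \<inter> ball q (1 / (2 * real (Suc m))))"
  let ?I = "C \<times> (UNIV :: nat set) \<times> D"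
  have cI: "countable ?I" using C(1) D(1) by simp
  note cont_gram = gram_det_continuous[OF G]
  have X0_open: "openin (top_of_set X) X0"
  proof -
    have "X0 = X \<inter> gram_det G -` (- {0})" by (auto simp: X0_def)
    then show ?thesis
      using continuous_openin_preimage_gen[OF cont_gram open_Compl[OF closed_singleton]] by metis
  qed
  have P_sets: "P i \<in> sets (restrict_space borel X)" if iI: "i \<in> ?I" for i
  proof -
    obtain x0 m q where i: "i = (x0, m, q)" "x0 \<in> X0" using iI C(2) by auto
    have "continuous_on X (completed_map e (u x0) \<xi>)"
      using completed_map_has_derivative[OF der]
      by (auto simp: continuous_on_eq_continuous_within intro: has_derivative_continuous)
    then have "closedin (top_of_set X) (expansion_set X (completed_map e (u x0) \<xi>) m)"
      by (rule closedin_expansion_set)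
    then have "X0 \<inter> (X \<inter> (U x0 \<inter> ball q (1 / (2 * real (Suc m))))) \<inter> expansion_set X (completed_map e (u x0) \<xi>) m
        \<in> sets (restrict_space borel X)"
      using uU(2)[OF i(2)]
      by (intro sets.Int closedin_sets_restrict_borel openin_sets_restrict_borel X0_open openin_open_Int open_Int)
        (auto simp: U_def)
    also have "X0 \<inter> (X \<inter> (U x0 \<inter> ball q (1 / (2 * real (Suc m))))) \<inter> expansion_set X (completed_map e (u x0) \<xi>) m = P i"
      by (auto simp: P_def i X0_def)
    finally show ?thesis .
  qed
  have P_piece: "\<exists>u. transversal_piece e c \<xi> G S u" if iI: "i \<in> ?I" "S \<subseteq> P i" for i S
  proof -
    obtain x0 m q where i: "i = (x0, m, q)" "x0 \<in> X0" using iI C(2) by auto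
    have "inj_on (completed_map e (u x0) \<xi>) S"
      using that by (intro inj_on_expansion_set_ball[of _ X _ m q]) (auto simp: P_def i)
    moreover have "c * sqrt (gram_det G x) \<le> \<bar>det (completed_jacobian e (u x0) (G x))\<bar>" if "x \<in> S" for x
      unfolding u_def using \<open>S \<subseteq> P i\<close> that i by (intro uU(5)) (auto simp: P_def U_def X0_def)
    ultimately have "transversal_piece e c \<xi> G S (u x0)"
      using uU(1)[OF i(2)] by (simp add: transversal_piece_def u_def)
    then show ?thesis by (intro exI[of _ "u x0"])
  qed
  have P_cover: "(\<Union>i\<in>?I. P i) = X0"
  proof
    show "X0 \<subseteq> (\<Union>i\<in>?I. P i)"
    proof
      fix x assume x: "x \<in> X0"
      then have "x \<in> \<Union>F" unfolding F(3) using uU(3) U_def by auto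
      then obtain x0 where x0: "x0 \<in> C" "x \<in> U x0" using C(3) by auto
      have "det (completed_jacobian e (u x0) (G x)) \<noteq> 0"
        unfolding u_def using x x0 C(2) by (intro uU(4)) (auto simp: U_def X0_def)
      then have "inj ((*v) (completed_jacobian e (u x0) (G x)))"
        by (metis inj_matrix_vector_mult invertible_det_nz)
      then have "\<exists>m. x \<in> expansion_set X (completed_map e (u x0) \<xi>) m"
        using x by (intro in_expansion_set[OF _ completed_map_has_derivative[OF der]]) (auto simp: X0_def)
      then obtain m where m: "x \<in> expansion_set X (completed_map e (u x0) \<xi>) m" by blast
      obtain q where q: "q \<in> D" "q \<in> ball x (1 / (2 * real (Suc m)))"
        using D(2)[of "ball x (1 / (2 * real (Suc m)))"] by (auto simp del: of_nat_Suc)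
      have "x \<in> P (x0, m, q)" using x x0 m q by (simp add: P_def dist_commute del: of_nat_Suc)
      then show "x \<in> (\<Union>i\<in>?I. P i)" using x0 q by blast
    qed
  qed (auto simp: P_def)
  show ?thesis
  proof (cases "X0 = {}")
    case True
    then have "transversal_piece e c \<xi> G {} u \<longleftrightarrow> orthonormal_on (- range e) u" for u
      by (simp add: transversal_piece_def)
    moreover obtain u :: "'n \<Rightarrow> real^'n" where "orthonormal_on (- range e) u"
      using exists_orthonormal_complement_frame[OF assms(1)] by blast
    ultimately show ?thesis using True X0_def by (intro exI[of _ "\<lambda>_. {}"]) (auto simp: disjoint_family_on_def)
  next
    case False
    then have ne: "?I \<noteq> {}" using P_cover by auto
    define E where "E n = P (from_nat_into ?I n)" for n
    have inI: "from_nat_into ?I n \<in> ?I" for n using from_nat_into[OF ne] .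
    have "(\<Union>n. E n) = X0"
    proof -
      have "range (from_nat_into ?I) = ?I" by (rule range_from_nat_into[OF ne cI])
      then show ?thesis unfolding E_def P_cover[symmetric] by (metis image_image)
    qed
    moreover have "range E \<subseteq> sets (restrict_space borel X)" unfolding E_def using P_sets[OF inI] by blast
    then have "disjointed E n \<in> sets (restrict_space borel X)" for n
      using sets.range_disjointed_sets[of E] by auto
    moreover have "\<exists>u. transversal_piece e c \<xi> G (disjointed E n) u" for n
      using P_piece[OF inI, of "disjointed E n" n] disjointed_subset[of E n] by (auto simp: E_def)
    moreover have "(\<Union>n. disjointed E n) = (\<Union>n. E n)" by (rule UN_disjointed_eq)
    ultimately show ?thesis
      using disjoint_family_disjointed[of E] unfolding X0_def
      by (intro exI[of _ "disjointed E"] conjI allI) simp_all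
  qed
qed


section \<open>The coarea inequality\<close>

text \<open>
  A Lebesgue measurable set is an increasing union of compact sets up to a null set, and a null set
  contributes nothing to the left-hand side.
\<close>

lemma coarea_piece:
  fixes \<xi> :: "real^'n \<Rightarrow> real^'r" and G :: "real^'n \<Rightarrow> real^'r^'n" and e :: "'r \<Rightarrow> 'n"
  assumes "inj e" "\<And>x. x \<in> B \<Longrightarrow> (\<xi> has_derivative (\<lambda>v. transpose (G x) *v v)) (at x within B)"
    and G: "continuous_on B G" and c: "0 < c" and B: "B \<in> sets lebesgue"
    and u: "transversal_piece e c \<xi> G B u"
  shows "\<exists>h\<in>borel_measurable borel.
     (\<integral>\<^sup>+x. ennreal (c * sqrt (gram_det G x)) * indicator B x \<partial>lebesgue) \<le> (\<integral>\<^sup>+z. h z \<partial>lborel) \<and>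
     (\<forall>z. h z \<le> hausdorff_outer (card (- range e)) (level_set B \<xi> z))"
proof -
  let ?d = "\<lambda>x. \<bar>det (completed_jacobian e u (G x))\<bar>"
  obtain C T where CT: "fsigma C" "T \<in> null_sets lebesgue" "C \<union> T = B"
    using lebesgue_set_almost_fsigma[OF B] .
  obtain F :: "nat \<Rightarrow> (real^'n) set" where F0: "range F \<subseteq> Collect compact" and FC: "C = \<Union>(range F)"
    using fsigma_Union_compact[THEN iffD1, OF CT(1)] by (elim exE conjE) (rule that)
  have F: "\<And>n. compact (F n)" "C = (\<Union>n. F n)" using F0 FC by auto
  \<comment> \<open>An increasing sequence of compact sets that exhausts \<open>B\<close> up to the null set \<open>T\<close>.\<close>
  define S where "S n = (\<Union>i\<le>n. F i)" for n
  have S: "compact (S n)" "S n \<subseteq> B" for n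
    using F CT(3) by (auto simp: S_def intro!: compact_UN)
  have S_inc: "incseq S" unfolding S_def incseq_def by (intro allI impI UN_mono) auto
  have S_Un: "(\<Union>n. S n) = C" using F(2) by (auto simp: S_def)
  let ?P = "\<lambda>n h. (\<integral>\<^sup>+x. ennreal (?d x) * indicator (S n) x \<partial>lborel) = (\<integral>\<^sup>+z. h z \<partial>lborel) \<and>
     (\<forall>z. h z \<le> hausdorff_outer (card (- range e)) (level_set (S n) \<xi> z))"
  have "\<forall>n. \<exists>h. h \<in> borel_measurable borel \<and> ?P n h"
  proof
    fix n
    have "\<exists>h\<in>borel_measurable borel. ?P n h"
    proof (rule coarea_compact[OF assms(1) _ S(1)])
      show "(\<xi> has_derivative (\<lambda>v. transpose (G x) *v v)) (at x within S n)" if "x \<in> S n" for x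
        using assms(2)[of x] that S(2)[of n] by (auto intro: has_derivative_subset)
      show "inj_on (completed_map e u \<xi>) (S n)"
        using u S(2) by (auto simp: transversal_piece_def intro: inj_on_subset)
    qed (use u G S(2) in \<open>auto simp: transversal_piece_def intro: continuous_on_subset\<close>)
    then show "\<exists>h. h \<in> borel_measurable borel \<and> ?P n h" by blast
  qed
  from choice[OF this] obtain h where h: "\<And>n. h n \<in> borel_measurable borel"
    "\<And>n. (\<integral>\<^sup>+x. ennreal (?d x) * indicator (S n) x \<partial>lborel) = (\<integral>\<^sup>+z. h n z \<partial>lborel)"
    "\<And>n z. h n z \<le> hausdorff_outer (card (- range e)) (level_set (S n) \<xi> z)"
    by blast
  have meas: "(\<lambda>x. ennreal (?d x) * indicator (S n) x) \<in> borel_measurable lborel" for n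
  proof -
    have "continuous_on (S n) ?d"
      using G S(2) by (intro continuous_intros continuous_on_det_cart completed_jacobian_continuous)
        (auto intro: continuous_on_subset)
    then have "(\<lambda>x. indicator (S n) x *\<^sub>R ?d x) \<in> borel_measurable borel"
      using S(1) by (intro borel_measurable_continuous_on_indicator borel_closed compact_imp_closed)
    then have "(\<lambda>x. ennreal (indicator (S n) x *\<^sub>R ?d x)) \<in> borel_measurable lborel" by simp
    also have "(\<lambda>x. ennreal (indicator (S n) x *\<^sub>R ?d x)) = (\<lambda>x. ennreal (?d x) * indicator (S n) x)"
      by (auto simp: fun_eq_iff indicator_def)
    finally show ?thesis .
  qed
  have "(\<integral>\<^sup>+x. ennreal (c * sqrt (gram_det G x)) * indicator B x \<partial>lebesgue)
      \<le> (\<integral>\<^sup>+x. (SUP n. ennreal (?d x) * indicator (S n) x) \<partial>lebesgue)"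
  proof (rule nn_integral_mono_AE)
    have "AE x in lebesgue. x \<notin> T" using CT(2) by (rule AE_not_in)
    then show "AE x in lebesgue. ennreal (c * sqrt (gram_det G x)) * indicator B x
        \<le> (SUP n. ennreal (?d x) * indicator (S n) x)"
    proof eventually_elim
      case (elim x)
      show ?case
      proof (cases "x \<in> B")
        case True
        then have "x \<in> (\<Union>n. S n)" using elim CT(3) S_Un by auto
        then obtain n where "x \<in> S n" by auto
        moreover have "c * sqrt (gram_det G x) \<le> ?d x"
          using u True by (simp add: transversal_piece_def)
        ultimately have "ennreal (c * sqrt (gram_det G x)) * indicator B x \<le> ennreal (?d x) * indicator (S n) x"
          using True by (simp add: ennreal_leI)
        then show ?thesis by (rule SUP_upper2[OF UNIV_I])
      qed simp
    qed
  qed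
  also have "\<dots> = (\<integral>\<^sup>+x. (SUP n. ennreal (?d x) * indicator (S n) x) \<partial>lborel)"
    by (rule nn_integral_completion)
  also have "\<dots> = (SUP n. (\<integral>\<^sup>+x. ennreal (?d x) * indicator (S n) x \<partial>lborel))"
  proof (rule nn_integral_monotone_convergence_SUP[OF _ meas])
    show "incseq (\<lambda>n x. ennreal (?d x) * indicator (S n) x)"
      using S_inc by (auto simp: incseq_def le_fun_def indicator_def)
  qed
  also have "\<dots> = (SUP n. (\<integral>\<^sup>+z. h n z \<partial>lborel))" by (simp add: h(2))
  also have "\<dots> \<le> (\<integral>\<^sup>+z. (SUP n. h n z) \<partial>lborel)"
    by (intro SUP_least nn_integral_mono SUP_upper) auto
  finally have "(\<integral>\<^sup>+x. ennreal (c * sqrt (gram_det G x)) * indicator B x \<partial>lebesgue)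
      \<le> (\<integral>\<^sup>+z. (SUP n. h n z) \<partial>lborel)" .
  moreover have "(SUP n. h n z) \<le> hausdorff_outer (card (- range e)) (level_set B \<xi> z)" for z
  proof (rule SUP_least)
    fix n
    have "level_set (S n) \<xi> z \<subseteq> level_set B \<xi> z" using S(2) by (auto simp: level_set_def)
    then show "h n z \<le> hausdorff_outer (card (- range e)) (level_set B \<xi> z)"
      by (rule order_trans[OF h(3) hausdorff_outer_mono])
  qed
  moreover have "(\<lambda>z. SUP n. h n z) \<in> borel_measurable borel"
    using h(1) by measurable
  ultimately show ?thesis by (intro bexI[of _ "\<lambda>z. SUP n. h n z"]) auto
qed

lemma sets_restrict_borel_lebesgue:
  assumes "X \<in> sets lebesgue" "A \<in> sets (restrict_space borel X)"
  shows "A \<in> sets lebesgue"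
proof -
  obtain B where "A = X \<inter> B" "B \<in> sets borel" using assms(2) unfolding sets_restrict_space by auto
  then show ?thesis using assms(1) by auto
qed

lemma level_set_Int_sets_borel:
  assumes "level_set X \<xi> z \<in> sets borel" "S \<in> sets (restrict_space borel X)"
  shows "level_set X \<xi> z \<inter> S \<in> sets borel"
proof -
  obtain T where "S = X \<inter> T" "T \<in> sets borel" using assms(2) unfolding sets_restrict_space by auto
  moreover from this have "level_set X \<xi> z \<inter> S = level_set X \<xi> z \<inter> T" by (auto simp: level_set_def)
  ultimately show ?thesis using assms(1) by simp
qed

lemma measurable_continuous_times_indicator:
  fixes g :: "'a::euclidean_space \<Rightarrow> real"
  assumes "continuous_on S g" "S \<in> sets lebesgue"
  shows "(\<lambda>x. ennreal (g x) * indicator S x) \<in> borel_measurable lebesgue"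
proof -
  have "g \<in> borel_measurable (restrict_space lebesgue S)"
    using assms by (rule continuous_imp_measurable_on_sets_lebesgue)
  then have "(\<lambda>x. ennreal (g x)) \<in> borel_measurable (restrict_space lebesgue S)" by simp
  then show ?thesis using assms(2) by (subst (asm) borel_measurable_restrict_space_iff_ennreal) auto
qed

text \<open>
  Hausdorff measure is countably additive on the disjoint Borel parts that the pieces cut out of a
  level set, so the bounds for the pieces add up.
\<close>

lemma coarea_set_constant:
  fixes \<xi> :: "real^'n \<Rightarrow> real^'r" and G :: "real^'n \<Rightarrow> real^'r^'n" and e :: "'r \<Rightarrow> 'n"
  assumes "inj e" and X: "X \<in> sets lebesgue"
    and der: "\<And>x. x \<in> X \<Longrightarrow> (\<xi> has_derivative (\<lambda>v. transpose (G x) *v v)) (at x within X)"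
    and G: "continuous_on X G" and level: "\<And>z. level_set X \<xi> z \<in> sets borel"
    and c: "0 < c" "c < 1" and A: "A \<in> sets (restrict_space borel X)"
  shows "\<exists>h\<in>borel_measurable borel.
     ennreal c * (\<integral>\<^sup>+x. ennreal (sqrt (gram_det G x)) * indicator A x \<partial>lebesgue) \<le> (\<integral>\<^sup>+z. h z \<partial>lborel) \<and>
     (\<forall>z. h z \<le> emeasure (hausdorff_measure (card (- range e))) (level_set X \<xi> z \<inter> A))"
proof -
  let ?k = "card (- range e)"
  have "\<exists>K :: nat \<Rightarrow> (real^'n) set. disjoint_family K \<and> (\<Union>n. K n) = {x\<in>X. gram_det G x \<noteq> 0} \<and>
    (\<forall>n. K n \<in> sets (restrict_space borel X)) \<and> (\<forall>n. \<exists>u. transversal_piece e c \<xi> G (K n) u)"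
    by (rule transversal_decomposition[OF assms(1) der G c])
  then obtain K :: "nat \<Rightarrow> (real^'n) set" where K: "disjoint_family K" "(\<Union>n. K n) = {x\<in>X. gram_det G x \<noteq> 0}"
    "\<And>n. K n \<in> sets (restrict_space borel X)" "\<And>n. \<exists>u. transversal_piece e c \<xi> G (K n) u"
    by blast
  define B where "B n = K n \<inter> A" for n
  have B_sets: "B n \<in> sets (restrict_space borel X)" for n using K(3) A by (auto simp: B_def)
  then have B_leb: "B n \<in> sets lebesgue" for n using sets_restrict_borel_lebesgue[OF X] by blast
  have BX: "B n \<subseteq> X" for n using sets.sets_into_space[OF B_sets, of n] by (simp add: space_restrict_space)
  have B_disj: "disjoint_family B" using K(1) by (auto simp: B_def disjoint_family_on_def)
  let ?P = "\<lambda>n h. (\<integral>\<^sup>+x. ennreal (c * sqrt (gram_det G x)) * indicator (B n) x \<partial>lebesgue) \<le> (\<integral>\<^sup>+z. h z \<partial>lborel) \<and>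
     (\<forall>z. h z \<le> hausdorff_outer ?k (level_set (B n) \<xi> z))"
  have "\<forall>n. \<exists>h. h \<in> borel_measurable borel \<and> ?P n h"
  proof
    fix n
    obtain u where "transversal_piece e c \<xi> G (K n) u" using K(4) by blast
    then have u: "transversal_piece e c \<xi> G (B n) u"
      by (auto simp: transversal_piece_def B_def intro: inj_on_subset)
    have "\<exists>h\<in>borel_measurable borel. ?P n h"
    proof (rule coarea_piece[OF assms(1) _ _ c(1) B_leb u])
      show "(\<xi> has_derivative (\<lambda>v. transpose (G x) *v v)) (at x within B n)" if "x \<in> B n" for x
        using der[of x] that BX[of n] by (auto intro: has_derivative_subset)
      show "continuous_on (B n) G" using G BX by (rule continuous_on_subset)
    qed
    then show "\<exists>h. h \<in> borel_measurable borel \<and> ?P n h" by blast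
  qed
  from choice[OF this] obtain h where h: "\<And>n. h n \<in> borel_measurable borel"
    "\<And>n. (\<integral>\<^sup>+x. ennreal (c * sqrt (gram_det G x)) * indicator (B n) x \<partial>lebesgue) \<le> (\<integral>\<^sup>+z. h n z \<partial>lborel)"
    "\<And>n z. h n z \<le> hausdorff_outer ?k (level_set (B n) \<xi> z)"
    by blast
  note cont_gram = gram_det_continuous[OF G]
  have meas: "(\<lambda>x. ennreal (c * sqrt (gram_det G x)) * indicator (B n) x) \<in> borel_measurable lebesgue" for n
    using continuous_on_subset[OF cont_gram BX] B_leb
    by (intro measurable_continuous_times_indicator continuous_intros)
  have "ennreal c * (\<integral>\<^sup>+x. ennreal (sqrt (gram_det G x)) * indicator A x \<partial>lebesgue)
      = (\<integral>\<^sup>+x. ennreal c * (ennreal (sqrt (gram_det G x)) * indicator A x) \<partial>lebesgue)"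
  proof (rule nn_integral_cmult[symmetric])
    have AX: "A \<subseteq> X" "A \<in> sets lebesgue"
      using sets.sets_into_space[OF A] sets_restrict_borel_lebesgue[OF X A] by (auto simp: space_restrict_space)
    show "(\<lambda>x. ennreal (sqrt (gram_det G x)) * indicator A x) \<in> borel_measurable lebesgue"
      using continuous_on_subset[OF cont_gram AX(1)] AX(2)
      by (intro measurable_continuous_times_indicator continuous_intros)
  qed
  also have "\<dots> \<le> (\<integral>\<^sup>+x. (\<Sum>n. ennreal (c * sqrt (gram_det G x)) * indicator (B n) x) \<partial>lebesgue)"
  proof (rule nn_integral_mono)
    fix x
    show "ennreal c * (ennreal (sqrt (gram_det G x)) * indicator A x)
        \<le> (\<Sum>n. ennreal (c * sqrt (gram_det G x)) * indicator (B n) x)"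
    proof (cases "x \<in> A \<and> gram_det G x \<noteq> 0")
      case True
      then have "x \<in> X" using sets.sets_into_space[OF A] by (auto simp: space_restrict_space)
      with True K(2) obtain n where "x \<in> K n" by auto
      then have "x \<in> B n" using True by (simp add: B_def)
      then have "ennreal c * (ennreal (sqrt (gram_det G x)) * indicator A x)
          = (\<Sum>n\<in>{n}. ennreal (c * sqrt (gram_det G x)) * indicator (B n) x)"
        using True c by (simp add: ennreal_mult' )
      also have "\<dots> \<le> (\<Sum>n. ennreal (c * sqrt (gram_det G x)) * indicator (B n) x)"
        by (intro sum_le_suminf) auto
      finally show ?thesis .
    qed auto
  qed
  also have "\<dots> = (\<Sum>n. \<integral>\<^sup>+x. ennreal (c * sqrt (gram_det G x)) * indicator (B n) x \<partial>lebesgue)"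
    by (rule nn_integral_suminf[OF meas])
  also have "\<dots> \<le> (\<Sum>n. \<integral>\<^sup>+z. h n z \<partial>lborel)" by (intro suminf_le h(2)) auto
  also have "\<dots> = (\<integral>\<^sup>+z. (\<Sum>n. h n z) \<partial>lborel)"
    using h(1) by (intro nn_integral_suminf[symmetric]) simp
  finally have "ennreal c * (\<integral>\<^sup>+x. ennreal (sqrt (gram_det G x)) * indicator A x \<partial>lebesgue)
      \<le> (\<integral>\<^sup>+z. (\<Sum>n. h n z) \<partial>lborel)" .
  moreover have "(\<Sum>n. h n z) \<le> emeasure (hausdorff_measure ?k) (level_set X \<xi> z \<inter> A)" for z
  proof -
    note in_borel = level_set_Int_sets_borel[OF level]
    have "level_set (B n) \<xi> z = level_set X \<xi> z \<inter> B n" for n using BX by (auto simp: level_set_def)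
    then have "(\<Sum>n. h n z) \<le> (\<Sum>n. emeasure (hausdorff_measure ?k) (level_set X \<xi> z \<inter> B n))"
      using h(3)[of _ z] in_borel[OF B_sets] by (intro suminf_le) (auto simp: emeasure_hausdorff_measure)
    also have "\<dots> = emeasure (hausdorff_measure ?k) (\<Union>n. level_set X \<xi> z \<inter> B n)"
      using in_borel[OF B_sets] B_disj unfolding disjoint_family_on_def
      by (intro suminf_emeasure) (simp_all add: disjoint_family_on_def, blast+)
    also have "\<dots> \<le> emeasure (hausdorff_measure ?k) (level_set X \<xi> z \<inter> A)"
      using in_borel[OF A] by (intro emeasure_mono) (auto simp: B_def)
    finally show ?thesis .
  qed
  moreover have "(\<lambda>z. \<Sum>n. h n z) \<in> borel_measurable borel"
    using h(1) by measurable
  ultimately show ?thesis by (intro bexI[of _ "\<lambda>z. \<Sum>n. h n z"]) auto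
qed

lemma ennreal_le_of_constant_factors:
  fixes a b :: ennreal
  assumes "\<And>c :: real. 0 < c \<Longrightarrow> c < 1 \<Longrightarrow> ennreal c * a \<le> b"
  shows "a \<le> b"
proof (rule ennreal_approx_unit)
  fix x :: ennreal assume x: "0 < x" "x < 1"
  show "x * a \<le> b"
  proof (cases x)
    case (real r)
    then show ?thesis using assms[of r] x by (simp add: ennreal_less_one_iff)
  next
    case top then show ?thesis using x by simp
  qed
qed

lemma measurable_lebesgue_on_of_restrict_borel:
  assumes "f \<in> restrict_space borel X \<rightarrow>\<^sub>M N"
  shows "f \<in> lebesgue_on X \<rightarrow>\<^sub>M N"
proof -
  have "(\<lambda>x. x) \<in> lebesgue_on X \<rightarrow>\<^sub>M restrict_space borel X"
    by (intro measurable_restrict_space3) (auto simp: measurable_def)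
  from measurable_compose[OF this assms] show ?thesis .
qed

lemma coarea_set:
  fixes \<xi> :: "real^'n \<Rightarrow> real^'r" and G :: "real^'n \<Rightarrow> real^'r^'n" and e :: "'r \<Rightarrow> 'n"
  assumes "inj e" and X: "X \<in> sets lebesgue"
    and der: "\<And>x. x \<in> X \<Longrightarrow> (\<xi> has_derivative (\<lambda>v. transpose (G x) *v v)) (at x within X)"
    and G: "continuous_on X G" and level: "\<And>z. level_set X \<xi> z \<in> sets borel"
    and A: "A \<in> sets (restrict_space borel X)"
  shows "\<exists>h\<in>borel_measurable borel.
     (\<integral>\<^sup>+x. ennreal (sqrt (gram_det G x)) * indicator A x \<partial>lebesgue) \<le> (\<integral>\<^sup>+z. h z \<partial>lborel) \<and>
     (\<forall>z. h z \<le> emeasure (hausdorff_measure (card (- range e))) (level_set X \<xi> z \<inter> A))"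
proof -
  \<comment> \<open>Shifted by two so that all factors lie strictly between \<open>0\<close> and \<open>1\<close>.\<close>
  define c where "c n = 1 - 1 / real (n + 2)" for n
  have c: "0 < c n" "c n < 1" for n by (auto simp: c_def)
  let ?I = "\<integral>\<^sup>+x. ennreal (sqrt (gram_det G x)) * indicator A x \<partial>lebesgue"
  have "\<forall>n. \<exists>h. h \<in> borel_measurable borel \<and> ennreal (c n) * ?I \<le> (\<integral>\<^sup>+z. h z \<partial>lborel) \<and>
     (\<forall>z. h z \<le> emeasure (hausdorff_measure (card (- range e))) (level_set X \<xi> z \<inter> A))"
    using coarea_set_constant[OF assms(1) X der G level c A] by blast
  from choice[OF this] obtain h where h: "\<And>n. h n \<in> borel_measurable borel"
    "\<And>n. ennreal (c n) * ?I \<le> (\<integral>\<^sup>+z. h n z \<partial>lborel)"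
    "\<And>n z. h n z \<le> emeasure (hausdorff_measure (card (- range e))) (level_set X \<xi> z \<inter> A)"
    by blast
  let ?h = "\<lambda>z. SUP n. h n z"
  have "?I \<le> (\<integral>\<^sup>+z. ?h z \<partial>lborel)"
  proof (rule ennreal_le_of_constant_factors)
    fix b :: real assume b: "0 < b" "b < 1"
    then have "0 < 1 - b" by simp
    then obtain n where "1 / real (Suc n) < 1 - b" by (rule nat_approx_posE)
    moreover have "1 / real (n + 2) \<le> 1 / real (Suc n)" by (intro divide_left_mono) auto
    ultimately have "b \<le> c n" by (simp add: c_def)
    then have "ennreal b * ?I \<le> ennreal (c n) * ?I" by (intro mult_right_mono ennreal_leI) auto
    also have "\<dots> \<le> (\<integral>\<^sup>+z. h n z \<partial>lborel)" by (rule h(2))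
    also have "\<dots> \<le> (\<integral>\<^sup>+z. ?h z \<partial>lborel)" by (intro nn_integral_mono SUP_upper) simp
    finally show "ennreal b * ?I \<le> (\<integral>\<^sup>+z. ?h z \<partial>lborel)" .
  qed
  moreover have "?h z \<le> emeasure (hausdorff_measure (card (- range e))) (level_set X \<xi> z \<inter> A)" for z
    by (intro SUP_least h(3))
  moreover have "?h \<in> borel_measurable borel" using h(1) by measurable
  ultimately show ?thesis by (intro bexI[of _ ?h]) auto
qed

lemma measurable_on_level_set:
  assumes "g \<in> borel_measurable (restrict_space borel X)"
  shows "g \<in> borel_measurable (restrict_space (hausdorff_measure k) (level_set X \<xi> z))"
proof -
  have "g \<in> borel_measurable (restrict_space borel (level_set X \<xi> z))"
    using assms by (rule measurable_restrict_mono) (auto simp: level_set_def)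
  then show ?thesis by (simp add: sets_restrict_space cong: measurable_cong_sets)
qed

text \<open>
  The function \<open>h\<close> stands for a measurable minorant of the integrals over the level sets. Such minorants
  are compatible with sums, multiples and suprema, so the inequality passes from sets to functions.
\<close>

theorem coarea_inequality:
  fixes \<xi> :: "real^'n \<Rightarrow> real^'r" and G :: "real^'n \<Rightarrow> real^'r^'n" and e :: "'r \<Rightarrow> 'n"
  assumes "inj e" and X: "X \<in> sets lebesgue"
    and der: "\<And>x. x \<in> X \<Longrightarrow> (\<xi> has_derivative (\<lambda>v. transpose (G x) *v v)) (at x within X)"
    and G: "continuous_on X G" and level: "\<And>z. level_set X \<xi> z \<in> sets borel"
    and f: "f \<in> borel_measurable (restrict_space borel X)"
  shows "\<exists>h\<in>borel_measurable borel.
     (\<integral>\<^sup>+x. f x * ennreal (sqrt (gram_det G x)) \<partial>lebesgue_on X) \<le> (\<integral>\<^sup>+z. h z \<partial>lborel) \<and>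
     (\<forall>z. h z \<le> (\<integral>\<^sup>+x. f x \<partial>restrict_space (hausdorff_measure (card (- range e))) (level_set X \<xi> z)))"
proof -
  let ?H = "\<lambda>z. restrict_space (hausdorff_measure (card (- range e))) (level_set X \<xi> z)"
  let ?J = "\<lambda>x. ennreal (sqrt (gram_det G x))"
  have "(\<lambda>x. sqrt (gram_det G x)) \<in> borel_measurable (restrict_space borel X)"
    by (intro borel_measurable_continuous_on_restrict continuous_intros gram_det_continuous G)
  then have J: "?J \<in> borel_measurable (lebesgue_on X)"
    by (intro measurable_lebesgue_on_of_restrict_borel) simp
  note toL = measurable_lebesgue_on_of_restrict_borel
  show ?thesis
    using f
  proof (induction f rule: borel_measurable_induct)
    case (cong f g)
    have "(\<integral>\<^sup>+x. f x * ?J x \<partial>lebesgue_on X) = (\<integral>\<^sup>+x. g x * ?J x \<partial>lebesgue_on X)"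
      using cong(3) by (intro nn_integral_cong) (auto simp: space_restrict_space)
    moreover have "(\<integral>\<^sup>+x. f x \<partial>?H z) = (\<integral>\<^sup>+x. g x \<partial>?H z)" for z
      using cong(3) by (intro nn_integral_cong) (auto simp: space_restrict_space level_set_def)
    ultimately show ?case using cong(4) by simp
  next
    case (set A)
    have AX: "A \<subseteq> X" using sets.sets_into_space[OF set] by (simp add: space_restrict_space)
    have lhs: "(\<integral>\<^sup>+x. indicator A x * ?J x \<partial>lebesgue_on X) = (\<integral>\<^sup>+x. ?J x * indicator A x \<partial>lebesgue)"
      using X AX by (subst nn_integral_restrict_space) (auto intro!: nn_integral_cong simp: indicator_def)
    have rhs: "emeasure (hausdorff_measure (card (- range e))) (level_set X \<xi> z \<inter> A) = (\<integral>\<^sup>+x. indicator A x \<partial>?H z)" for z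
    proof -
      note LA = level_set_Int_sets_borel[OF level set]
      have "(\<integral>\<^sup>+x. indicator A x \<partial>?H z) = (\<integral>\<^sup>+x. indicator (level_set X \<xi> z \<inter> A) x \<partial>hausdorff_measure (card (- range e)))"
        using level by (subst nn_integral_restrict_space) (auto intro!: nn_integral_cong simp: indicator_def)
      also have "\<dots> = emeasure (hausdorff_measure (card (- range e))) (level_set X \<xi> z \<inter> A)"
        using LA by (intro nn_integral_indicator) simp
      finally show ?thesis by simp
    qed
    show ?case using coarea_set[OF assms(1) X der G level set] unfolding lhs rhs .
  next
    case (mult u c)
    then obtain h where h: "h \<in> borel_measurable borel"
      "(\<integral>\<^sup>+x. u x * ?J x \<partial>lebesgue_on X) \<le> (\<integral>\<^sup>+z. h z \<partial>lborel)" "\<And>z. h z \<le> (\<integral>\<^sup>+x. u x \<partial>?H z)" by blast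
    have "(\<integral>\<^sup>+x. c * u x * ?J x \<partial>lebesgue_on X) = c * (\<integral>\<^sup>+x. u x * ?J x \<partial>lebesgue_on X)"
      using toL[OF mult(2)] J by (subst nn_integral_cmult[symmetric]) (auto simp: mult.assoc)
    also have "\<dots> \<le> c * (\<integral>\<^sup>+z. h z \<partial>lborel)" by (intro mult_left_mono h(2)) simp
    also have "\<dots> = (\<integral>\<^sup>+z. c * h z \<partial>lborel)" using h(1) by (subst nn_integral_cmult) auto
    finally have "(\<integral>\<^sup>+x. c * u x * ?J x \<partial>lebesgue_on X) \<le> (\<integral>\<^sup>+z. c * h z \<partial>lborel)" .
    moreover have "c * h z \<le> (\<integral>\<^sup>+x. c * u x \<partial>?H z)" for z
      using h(3)[of z] measurable_on_level_set[OF mult(2)] by (subst nn_integral_cmult) (auto intro: mult_left_mono)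
    ultimately show ?case using h(1) by (intro bexI[of _ "\<lambda>z. c * h z"]) auto
  next
    case (add u v)
    then obtain h where h: "h \<in> borel_measurable borel"
      "(\<integral>\<^sup>+x. u x * ?J x \<partial>lebesgue_on X) \<le> (\<integral>\<^sup>+z. h z \<partial>lborel)" "\<And>z. h z \<le> (\<integral>\<^sup>+x. u x \<partial>?H z)" by blast
    from add obtain g where g: "g \<in> borel_measurable borel"
      "(\<integral>\<^sup>+x. v x * ?J x \<partial>lebesgue_on X) \<le> (\<integral>\<^sup>+z. g z \<partial>lborel)" "\<And>z. g z \<le> (\<integral>\<^sup>+x. v x \<partial>?H z)" by blast
    have "(\<integral>\<^sup>+x. (v x + u x) * ?J x \<partial>lebesgue_on X)
        = (\<integral>\<^sup>+x. v x * ?J x \<partial>lebesgue_on X) + (\<integral>\<^sup>+x. u x * ?J x \<partial>lebesgue_on X)"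
      using toL[OF add.hyps(1)] toL[OF add.hyps(3)] J by (subst nn_integral_add[symmetric]) (auto simp: distrib_right)
    also have "\<dots> \<le> (\<integral>\<^sup>+z. g z \<partial>lborel) + (\<integral>\<^sup>+z. h z \<partial>lborel)" by (intro add_mono g h)
    also have "\<dots> = (\<integral>\<^sup>+z. g z + h z \<partial>lborel)" using g h by (subst nn_integral_add) auto
    finally have "(\<integral>\<^sup>+x. (v x + u x) * ?J x \<partial>lebesgue_on X) \<le> (\<integral>\<^sup>+z. g z + h z \<partial>lborel)" .
    moreover have "g z + h z \<le> (\<integral>\<^sup>+x. v x + u x \<partial>?H z)" for z
      using h(3)[of z] g(3)[of z] measurable_on_level_set[OF add.hyps(1)] measurable_on_level_set[OF add.hyps(3)]
      by (subst nn_integral_add) (auto intro: add_mono)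
    ultimately show ?case using g(1) h(1) by (intro bexI[of _ "\<lambda>z. g z + h z"]) auto
  next
    case (seq U)
    have "\<forall>n. \<exists>h. h \<in> borel_measurable borel \<and>
      (\<integral>\<^sup>+x. U n x * ?J x \<partial>lebesgue_on X) \<le> (\<integral>\<^sup>+z. h z \<partial>lborel) \<and> (\<forall>z. h z \<le> (\<integral>\<^sup>+x. U n x \<partial>?H z))"
      using seq.IH by blast
    from choice[OF this] obtain h where h: "\<And>n. h n \<in> borel_measurable borel"
      "\<And>n. (\<integral>\<^sup>+x. U n x * ?J x \<partial>lebesgue_on X) \<le> (\<integral>\<^sup>+z. h n z \<partial>lborel)"
      "\<And>n z. h n z \<le> (\<integral>\<^sup>+x. U n x \<partial>?H z)" by blast
    have "(\<integral>\<^sup>+x. (SUP i. U i) x * ?J x \<partial>lebesgue_on X) = (\<integral>\<^sup>+x. (SUP n. U n x * ?J x) \<partial>lebesgue_on X)"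
      by (simp add: SUP_mult_right_ennreal image_image)
    also have "\<dots> = (SUP n. \<integral>\<^sup>+x. U n x * ?J x \<partial>lebesgue_on X)"
    proof (rule nn_integral_monotone_convergence_SUP)
      show "incseq (\<lambda>n x. U n x * ?J x)"
        using seq.hyps(3) by (auto simp: incseq_def le_fun_def intro: mult_right_mono)
      show "(\<lambda>x. U n x * ?J x) \<in> borel_measurable (lebesgue_on X)" for n
        using toL[OF seq.hyps(1)] J by simp
    qed
    also have "\<dots> \<le> (SUP n. \<integral>\<^sup>+z. h n z \<partial>lborel)" by (intro SUP_mono') (rule h(2))
    also have "\<dots> \<le> (\<integral>\<^sup>+z. (SUP n. h n z) \<partial>lborel)"
      by (intro SUP_least nn_integral_mono SUP_upper) auto
    finally have "(\<integral>\<^sup>+x. (SUP i. U i) x * ?J x \<partial>lebesgue_on X) \<le> (\<integral>\<^sup>+z. (SUP n. h n z) \<partial>lborel)" .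
    moreover have "(SUP n. h n z) \<le> (\<integral>\<^sup>+x. (SUP i. U i) x \<partial>?H z)" for z
      by (intro SUP_least order_trans[OF h(3)] nn_integral_mono) (auto intro: SUP_upper)
    moreover have "(\<lambda>z. SUP n. h n z) \<in> borel_measurable borel" using h(1) by measurable
    ultimately show ?case by (intro bexI[of _ "\<lambda>z. SUP n. h n z"]) auto
  qed
qed

lemma locally_compact_Euclidean_space: "locally_compact_space (Euclidean_space n)"
proof -
  have "locally_compact_space euclideanreal"
    unfolding locally_compact_space_def
  proof
    fix x :: real
    have "openin euclideanreal {x - 1<..<x + 1} \<and> compactin euclideanreal {x - 1..x + 1} \<and>
        x \<in> {x - 1<..<x + 1} \<and> {x - 1<..<x + 1} \<subseteq> {x - 1..x + 1}" by auto
    then show "\<exists>U K. openin euclideanreal U \<and> compactin euclideanreal K \<and> x \<in> U \<and> U \<subseteq> K" by blast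
  qed
  then have "locally_compact_space (product_topology (\<lambda>i. euclideanreal) {..<n})"
    unfolding locally_compact_space_product_topology by simp
  then show ?thesis
    using homeomorphic_locally_compact_space[OF homeomorphic_Euclidean_space_product_topology] by blast
qed

text \<open>
  A manifold is locally compact, hence by Lindelof's theorem a countable union of compact sets.
\<close>

lemma topological_manifold_imp_borel:
  fixes S :: "'a::euclidean_space set"
  assumes "topological_manifold k (top_of_set S)"
  shows "S \<in> sets borel"
proof -
  let ?F = "{W. openin (top_of_set S) W \<and> (\<exists>K. compact K \<and> W \<subseteq> K \<and> K \<subseteq> S)}"
  have cover: "\<Union>?F = S"
  proof
    show "S \<subseteq> \<Union>?F"
    proof
      fix x assume x: "x \<in> S"
      then obtain U V where UV: "openin (top_of_set S) U" "x \<in> U" "openin (Euclidean_space k) V"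
        "subtopology (top_of_set S) U homeomorphic_space subtopology (Euclidean_space k) V"
        using assms unfolding topological_manifold_def by (metis topspace_euclidean_subtopology)
      have "Hausdorff_space (Euclidean_space k)"
        by (rule metrizable_imp_Hausdorff_space[OF metrizable_Euclidean_space])
      then have "locally_compact_space (subtopology (Euclidean_space k) V)"
        using UV(3) locally_compact_Euclidean_space by (intro locally_compact_space_open_subset) auto
      then have "locally_compact_space (subtopology (top_of_set S) U)"
        using homeomorphic_locally_compact_space[OF UV(4)] by blast
      moreover have US: "U \<subseteq> S" using openin_imp_subset[OF UV(1)] .
      then have "subtopology (top_of_set S) U = top_of_set U" by (simp add: subtopology_subtopology Int_absorb1)
      ultimately have "locally_compact_space (top_of_set U)" by simp
      then obtain W K where WK: "openin (top_of_set U) W" "compactin (top_of_set U) K" "x \<in> W" "W \<subseteq> K"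
        using UV(2) unfolding locally_compact_space_def by auto
      have "openin (top_of_set S) W" using WK(1) UV(1) by (rule openin_trans)
      moreover have "compact K" "K \<subseteq> S" using WK(2) US by (auto simp: compactin_subtopology)
      ultimately show "x \<in> \<Union>?F" using WK by blast
    qed
  qed auto
  obtain F' where F': "F' \<subseteq> ?F" "countable F'" "\<Union>F' = \<Union>?F"
    using Lindelof_openin[of ?F S] by blast
  have "\<forall>W\<in>F'. \<exists>K. compact K \<and> W \<subseteq> K \<and> K \<subseteq> S" using F'(1) by blast
  from bchoice[OF this] obtain K where K: "\<forall>W\<in>F'. compact (K W) \<and> W \<subseteq> K W \<and> K W \<subseteq> S" by blast
  have "\<Union>F' = S" using F'(3) cover by simp
  then have "S = (\<Union>W\<in>F'. K W)" using K by (intro set_eqI) (metis UN_iff UnionE UnionI in_mono)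
  moreover have "(\<Union>W\<in>F'. K W) \<in> sets borel"
    using K F'(2) by (intro sets.countable_UN') (auto intro: borel_closed compact_imp_closed)
  ultimately show ?thesis by simp
qed

text \<open>
  The density of the marginal measures is \<open>w = \<pi> / sqrt (gram_det G)\<close>; the coarea inequality for
  \<open>w * f\<close> cancels its denominator almost everywhere.
\<close>

theorem integral_le_of_marginal_integrals_le:
  fixes \<xi> :: "real^'n \<Rightarrow> real^'r" and G :: "real^'n \<Rightarrow> real^'r^'n"
  assumes dims: "CARD('r) < CARD('n)" and X: "X \<in> sets lebesgue"
    and RC: "smooth_RC X Z \<xi> G" and Z: "Z \<in> sets borel"
    and gram: "AE x in lebesgue_on X. gram_det G x \<noteq> 0"
    and \<pi>: "continuous_on X \<pi>" "\<And>x. x \<in> X \<Longrightarrow> 0 < \<pi> x"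
    and f: "f \<in> borel_measurable (restrict_space borel X)"
    and le: "\<And>x. x \<in> X \<Longrightarrow> (\<integral>\<^sup>+x'. f x' \<partial>marginal_measure X \<pi> \<xi> G (\<xi> x)) \<le> C"
  shows "(\<integral>\<^sup>+x. f x \<partial>density_measure X \<pi>) \<le> C * emeasure lebesgue Z"
proof -
  obtain e :: "'r \<Rightarrow> 'n" where e: "inj e"
    using card_le_inj[of "UNIV :: 'r set" "UNIV :: 'n set"] dims by auto
  have k: "card (- range e) = CARD('n) - CARD('r)"
    using e by (simp add: Compl_eq_Diff_UNIV card_Diff_subset card_image)
  have der: "\<And>x. x \<in> X \<Longrightarrow> (\<xi> has_derivative (\<lambda>v. transpose (G x) *v v)) (at x within X)"
    and G: "continuous_on X G" and range: "\<xi> ` X \<subseteq> Z"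
    using RC by (auto simp: smooth_RC_def continuously_differentiable_def)
  have level: "level_set X \<xi> z \<in> sets borel" for z
  proof (cases "z \<in> Z")
    case True
    then show ?thesis using RC topological_manifold_imp_borel unfolding smooth_RC_def by blast
  next
    case False
    then have "level_set X \<xi> z = {}" using range by (auto simp: level_set_def)
    then show ?thesis by simp
  qed
  define w where "w x = ennreal (\<pi> x) / ennreal (sqrt (gram_det G x))" for x
  have "(\<lambda>x. sqrt (gram_det G x)) \<in> borel_measurable (restrict_space borel X)"
    by (intro borel_measurable_continuous_on_restrict continuous_intros gram_det_continuous G)
  moreover have \<pi>_meas: "\<pi> \<in> borel_measurable (restrict_space borel X)"
    by (intro borel_measurable_continuous_on_restrict \<pi>)
  ultimately have w: "w \<in> borel_measurable (restrict_space borel X)"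
    unfolding w_def by measurable
  have fw: "(\<lambda>x. w x * f x) \<in> borel_measurable (restrict_space borel X)"
    using w f by simp
  obtain h where h: "h \<in> borel_measurable borel"
     "(\<integral>\<^sup>+x. w x * f x * ennreal (sqrt (gram_det G x)) \<partial>lebesgue_on X) \<le> (\<integral>\<^sup>+z. h z \<partial>lborel)"
     "\<And>z. h z \<le> (\<integral>\<^sup>+x. w x * f x \<partial>restrict_space (hausdorff_measure (card (- range e))) (level_set X \<xi> z))"
    using coarea_inequality[OF e X der G level fw] by blast
  \<comment> \<open>For \<open>z\<close> outside the image of \<open>\<xi>\<close> the level set is empty and \<open>h z\<close> vanishes.\<close>
  have h_le: "h z \<le> C * indicator Z z" for z
  proof (cases "z \<in> \<xi> ` X")
    case True
    then obtain x where x: "x \<in> X" "z = \<xi> x" by auto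
    have "h z \<le> (\<integral>\<^sup>+x. w x * f x \<partial>restrict_space (hausdorff_measure (CARD('n) - CARD('r))) (level_set X \<xi> z))"
      using h(3)[of z] k by simp
    also have "\<dots> = (\<integral>\<^sup>+x'. f x' \<partial>marginal_measure X \<pi> \<xi> G z)"
      unfolding marginal_measure_def w_def[symmetric, abs_def]
      by (rule nn_integral_density[symmetric]) (intro measurable_on_level_set w f)+
    also have "\<dots> \<le> C" using le x by simp
    finally show ?thesis using range x by auto
  next
    case False
    then have "level_set X \<xi> z = {}" by (auto simp: level_set_def)
    then have "h z \<le> 0"
      using h(3)[of z] nn_integral_empty[of "restrict_space (hausdorff_measure (card (- range e))) (level_set X \<xi> z)"]
      by (simp add: space_restrict_space)
    then show ?thesis by simp
  qed
  have "(\<integral>\<^sup>+x. f x \<partial>density_measure X \<pi>) = (\<integral>\<^sup>+x. ennreal (\<pi> x) * f x \<partial>lebesgue_on X)"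
    unfolding density_measure_def using f \<pi>_meas
    by (intro nn_integral_density measurable_lebesgue_on_of_restrict_borel) simp_all
  also have "\<dots> = (\<integral>\<^sup>+x. w x * f x * ennreal (sqrt (gram_det G x)) \<partial>lebesgue_on X)"
  proof (rule nn_integral_cong_AE)
    show "AE x in lebesgue_on X. ennreal (\<pi> x) * f x = w x * f x * ennreal (sqrt (gram_det G x))"
      using gram AE_space
    proof eventually_elim
      case (elim x)
      then have "0 < sqrt (gram_det G x)" "0 < \<pi> x"
        using gram_det_nonneg[OF e, of G x] \<pi>(2)[of x] by (auto simp: space_restrict_space)
      then have "w x * ennreal (sqrt (gram_det G x)) = ennreal (\<pi> x)"
        unfolding w_def by (simp add: divide_ennreal ennreal_mult[symmetric])
      then show ?case by (metis mult.assoc mult.commute)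
    qed
  qed
  also have "\<dots> \<le> (\<integral>\<^sup>+z. h z \<partial>lborel)" by (rule h(2))
  also have "\<dots> \<le> (\<integral>\<^sup>+z. C * indicator Z z \<partial>lborel)" by (intro nn_integral_mono h_le)
  also have "\<dots> = C * emeasure lborel Z" using Z by (simp add: nn_integral_cmult)
  also have "emeasure lborel Z = emeasure lebesgue Z" using Z by simp
  finally show ?thesis .
qed


section \<open>Transition densities of a Markov process\<close>

lemma space_state_space [simp]: "space (state_space X) = X"
  by (simp add: state_space_def space_restrict_space)

lemma space_lebesgue_on [simp]: "space (lebesgue_on X) = X"
  by (simp add: space_restrict_space)

lemma measurable_state_space_lebesgue_on:
  "f \<in> state_space X \<rightarrow>\<^sub>M N \<Longrightarrow> f \<in> lebesgue_on X \<rightarrow>\<^sub>M N"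
  unfolding state_space_def by (rule measurable_lebesgue_on_of_restrict_borel)

lemma measurable_ident_state_space: "(\<lambda>x. x) \<in> lebesgue_on X \<rightarrow>\<^sub>M state_space X"
  by (rule measurable_state_space_lebesgue_on) simp

lemma sets_state_space_lebesgue_on:
  "B \<in> sets (state_space X) \<Longrightarrow> B \<in> sets (lebesgue_on X)"
  using measurable_sets[OF measurable_ident_state_space, of B X] sets.sets_into_space[of B "state_space X"]
  by (simp add: Int_absorb2)

lemma measurable_pair_state_space:
  assumes "case_prod f \<in> state_space X \<Otimes>\<^sub>M state_space X \<rightarrow>\<^sub>M N"
    and "A = state_space X \<or> A = lebesgue_on X" "B = state_space X \<or> B = lebesgue_on X"
  shows "case_prod f \<in> A \<Otimes>\<^sub>M B \<rightarrow>\<^sub>M N" "case_prod (\<lambda>y x. f x y) \<in> B \<Otimes>\<^sub>M A \<rightarrow>\<^sub>M N"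
proof -
  have A: "(\<lambda>x. x) \<in> A \<rightarrow>\<^sub>M state_space X" and B: "(\<lambda>x. x) \<in> B \<rightarrow>\<^sub>M state_space X"
    using assms(2,3) measurable_ident_state_space by auto
  have "(\<lambda>z. (fst z, snd z)) \<in> A \<Otimes>\<^sub>M B \<rightarrow>\<^sub>M state_space X \<Otimes>\<^sub>M state_space X"
    by (intro measurable_Pair measurable_compose[OF measurable_fst A] measurable_compose[OF measurable_snd B])
  from measurable_compose[OF this assms(1)] show "case_prod f \<in> A \<Otimes>\<^sub>M B \<rightarrow>\<^sub>M N"
    by (simp add: split_beta')
  have "(\<lambda>z. (snd z, fst z)) \<in> B \<Otimes>\<^sub>M A \<rightarrow>\<^sub>M state_space X \<Otimes>\<^sub>M state_space X"
    by (intro measurable_Pair measurable_compose[OF measurable_fst B] measurable_compose[OF measurable_snd A])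
  from measurable_compose[OF this assms(1)] show "case_prod (\<lambda>y x. f x y) \<in> B \<Otimes>\<^sub>M A \<rightarrow>\<^sub>M N"
    by (simp add: split_beta')
qed

lemma sigma_finite_lebesgue_on:
  fixes X :: "(real^'n) set"
  assumes "X \<in> sets lebesgue"
  shows "sigma_finite_measure (lebesgue_on X)"
proof (rule sigma_finite_measure_restrict_space[OF _ assms])
  obtain A :: "(real^'n) set set" where A: "countable A" "A \<subseteq> sets lborel" "\<Union>A = space lborel"
    "\<forall>a\<in>A. emeasure lborel a \<noteq> \<infinity>"
    using lborel.sigma_finite_countable by auto
  show "sigma_finite_measure (lebesgue :: (real^'n) measure)"
  proof (rule sigma_finite_measure.intro, rule exI[of _ A], intro conjI ballI)
    show "A \<subseteq> sets lebesgue" "\<Union>A = space lebesgue" using A by auto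
    fix a assume "a \<in> A"
    then have "a \<in> sets borel" "emeasure lborel a \<noteq> \<infinity>" using A by auto
    then show "emeasure lebesgue a \<noteq> \<infinity>" by simp
  qed (rule A(1))
qed

text \<open>
  The expectation of a conditional probability is the probability.
\<close>

lemma markov_law_step:
  assumes "markov_process X p P Y" "x \<in> X" "0 \<le> s" "0 < t" "B \<in> sets (state_space X)"
  shows "(\<integral>\<^sup>+\<omega>. indicator B (Y (s + t) \<omega>) \<partial>P x) = (\<integral>\<^sup>+\<omega>. transition_prob X p t (Y s \<omega>) B \<partial>P x)"
proof -
  let ?M = "P x" and ?F = "natural_algebra X (P x) Y s"
  have M: "prob_space ?M" and Y: "\<And>t. 0 \<le> t \<Longrightarrow> Y t \<in> ?M \<rightarrow>\<^sub>M state_space X"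
    and cond: "AE \<omega> in ?M. nn_cond_exp ?M ?F (\<lambda>\<omega>'. indicator B (Y (s + t) \<omega>')) \<omega> = transition_prob X p t (Y s \<omega>) B"
    using assms unfolding markov_process_def by auto
  let ?G = "{Y u -` B \<inter> space ?M |u B. 0 \<le> u \<and> u \<le> s \<and> B \<in> sets (state_space X)}"
  have G: "?G \<subseteq> sets ?M" using measurable_sets[OF Y] by auto
  then have GP: "?G \<subseteq> Pow (space ?M)" using sets.space_closed by blast
  have "subalgebra ?M ?F"
    unfolding subalgebra_def natural_algebra_def space_measure_of[OF GP] sets_measure_of[OF GP]
    using G by (auto intro: sets.sigma_sets_subset[THEN subsetD])
  interpret prob_space ?M by (rule M)
  interpret finite_measure_subalgebra ?M ?F
    by standard (rule \<open>subalgebra ?M ?F\<close>)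
  have meas: "(\<lambda>\<omega>. indicator B (Y (s + t) \<omega>) :: ennreal) \<in> borel_measurable ?M"
    using measurable_compose[OF Y[of "s + t"] borel_measurable_indicator[OF assms(5)]] assms(3,4) by simp
  have "(\<integral>\<^sup>+\<omega>. transition_prob X p t (Y s \<omega>) B \<partial>?M)
      = (\<integral>\<^sup>+\<omega>. 1 * nn_cond_exp ?M ?F (\<lambda>\<omega>'. indicator B (Y (s + t) \<omega>')) \<omega> \<partial>?M)"
    using cond by (intro nn_integral_cong_AE) auto
  also have "\<dots> = (\<integral>\<^sup>+\<omega>. 1 * indicator B (Y (s + t) \<omega>) \<partial>?M)"
    by (rule nn_cond_exp_intg[OF _ meas]) simp
  finally show ?thesis by simp
qed

lemma markov_law:
  assumes "markov_process X p P Y" "x \<in> X" "0 < t" "B \<in> sets (state_space X)"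
  shows "(\<integral>\<^sup>+\<omega>. indicator B (Y t \<omega>) \<partial>P x) = transition_prob X p t x B"
proof -
  have M: "prob_space (P x)" and start: "AE \<omega> in P x. Y 0 \<omega> = x"
    using assms unfolding markov_process_def by auto
  interpret prob_space "P x" by (rule M)
  have "(\<integral>\<^sup>+\<omega>. indicator B (Y (0 + t) \<omega>) \<partial>P x) = (\<integral>\<^sup>+\<omega>. transition_prob X p t (Y 0 \<omega>) B \<partial>P x)"
    by (rule markov_law_step[OF assms(1,2) order_refl assms(3,4)])
  also have "\<dots> = (\<integral>\<^sup>+\<omega>. transition_prob X p t x B \<partial>P x)"
    using start by (intro nn_integral_cong_AE) auto
  finally show ?thesis by (simp add: emeasure_space_1)
qed

lemma transition_density_integral:
  assumes "markov_process X p P Y" "x \<in> X" "0 < t"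
  shows "(\<integral>\<^sup>+y. ennreal (p t x y) \<partial>lebesgue_on X) = 1"
proof -
  have M: "prob_space (P x)" and Y: "Y t \<in> P x \<rightarrow>\<^sub>M state_space X"
    using assms unfolding markov_process_def by auto
  interpret prob_space "P x" by (rule M)
  have X: "X \<in> sets (state_space X)" using sets.top[of "state_space X"] by simp
  have "(\<integral>\<^sup>+y. ennreal (p t x y) \<partial>lebesgue_on X) = transition_prob X p t x X"
    unfolding transition_prob_def by (rule nn_integral_cong) simp
  also have "\<dots> = (\<integral>\<^sup>+\<omega>. indicator X (Y t \<omega>) \<partial>P x)" by (rule markov_law[OF assms X, symmetric])
  also have "\<dots> = (\<integral>\<^sup>+\<omega>. 1 \<partial>P x)"
    using measurable_space[OF Y] by (intro nn_integral_cong) simp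
  finally show ?thesis by (simp add: emeasure_space_1)
qed

lemma markov_density_measurable:
  assumes "markov_process X p P Y" "0 < t"
  shows "case_prod (\<lambda>x y. ennreal (p t x y)) \<in> borel_measurable (state_space X \<Otimes>\<^sub>M state_space X)"
proof -
  have "(\<lambda>(x, y). p t x y) \<in> borel_measurable (state_space X \<Otimes>\<^sub>M state_space X)"
    using assms unfolding markov_process_def by auto
  then have "(\<lambda>z. ennreal ((\<lambda>(x, y). p t x y) z)) \<in> borel_measurable (state_space X \<Otimes>\<^sub>M state_space X)" by simp
  then show ?thesis by (simp add: split_beta')
qed

lemma markov_expectation:
  assumes mp: "markov_process X p P Y" and x: "x \<in> X" and s: "0 < s"
    and f: "f \<in> borel_measurable (state_space X)"
  shows "(\<integral>\<^sup>+\<omega>. f (Y s \<omega>) \<partial>P x) = (\<integral>\<^sup>+u. ennreal (p s x u) * f u \<partial>lebesgue_on X)"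
proof -
  have Y: "Y s \<in> P x \<rightarrow>\<^sub>M state_space X" using mp x s unfolding markov_process_def by auto
  have ps: "(\<lambda>u. ennreal (p s x u)) \<in> borel_measurable (lebesgue_on X)"
    using measurable_Pair2[OF markov_density_measurable[OF mp s], of x] x
    by (intro measurable_state_space_lebesgue_on) simp
  let ?D = "density (lebesgue_on X) (\<lambda>u. ennreal (p s x u))"
  have sub: "subalgebra ?D (state_space X)"
    using sets_state_space_lebesgue_on by (auto simp: subalgebra_def)
  have "distr (P x) (state_space X) (Y s) = restr_to_subalg ?D (state_space X)"
  proof (rule measure_eqI)
    show "sets (distr (P x) (state_space X) (Y s)) = sets (restr_to_subalg ?D (state_space X))"
      by (simp add: sets_restr_to_subalg[OF sub])
    fix B assume "B \<in> sets (distr (P x) (state_space X) (Y s))"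
    then have B: "B \<in> sets (state_space X)" by simp
    have "emeasure (distr (P x) (state_space X) (Y s)) B = (\<integral>\<^sup>+u. indicator B u \<partial>distr (P x) (state_space X) (Y s))"
      using B by simp
    also have "\<dots> = (\<integral>\<^sup>+\<omega>. indicator B (Y s \<omega>) \<partial>P x)"
      using B by (intro nn_integral_distr[OF Y]) simp
    also have "\<dots> = transition_prob X p s x B" by (rule markov_law[OF mp x s B])
    also have "\<dots> = emeasure ?D B"
      unfolding transition_prob_def using ps sets_state_space_lebesgue_on[OF B]
      by (rule emeasure_density[symmetric])
    also have "\<dots> = emeasure (restr_to_subalg ?D (state_space X)) B"
      by (rule emeasure_restr_to_subalg[OF sub B, symmetric])
    finally show "emeasure (distr (P x) (state_space X) (Y s)) B = emeasure (restr_to_subalg ?D (state_space X)) B" .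
  qed
  moreover have "(\<integral>\<^sup>+u. f u \<partial>distr (P x) (state_space X) (Y s)) = (\<integral>\<^sup>+\<omega>. f (Y s \<omega>) \<partial>P x)"
    using f by (intro nn_integral_distr[OF Y]) simp
  ultimately have "(\<integral>\<^sup>+\<omega>. f (Y s \<omega>) \<partial>P x) = (\<integral>\<^sup>+u. f u \<partial>restr_to_subalg ?D (state_space X))"
    by simp
  also have "\<dots> = (\<integral>\<^sup>+u. f u \<partial>?D)" by (rule nn_integral_subalgebra2[OF sub f])
  also have "\<dots> = (\<integral>\<^sup>+u. ennreal (p s x u) * f u \<partial>lebesgue_on X)"
    by (rule nn_integral_density[OF ps measurable_state_space_lebesgue_on[OF f]])
  finally show ?thesis .
qed

text \<open>
  Uniqueness of densities, for the restriction of Lebesgue measure to the Borel subsets of \<open>X\<close>.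
\<close>

lemma AE_lebesgue_on_eq_of_borel_integrals:
  assumes f: "f \<in> borel_measurable (state_space X)" and g: "g \<in> borel_measurable (state_space X)"
    and eq: "\<And>B. B \<in> sets (state_space X) \<Longrightarrow>
       (\<integral>\<^sup>+y\<in>B. f y \<partial>lebesgue_on X) = (\<integral>\<^sup>+y\<in>B. g y \<partial>lebesgue_on X)"
    and fin: "(\<integral>\<^sup>+y. f y \<partial>lebesgue_on X) < \<infinity>"
  shows "AE y in lebesgue_on X. f y = (g y :: ennreal)"
proof -
  have sub: "subalgebra (lebesgue_on X) (state_space X)"
    using sets_state_space_lebesgue_on by (auto simp: subalgebra_def)
  let ?R = "restr_to_subalg (lebesgue_on X) (state_space X)"
  have meas: "h \<in> borel_measurable ?R" if "h \<in> borel_measurable (state_space X)" for h :: "_ \<Rightarrow> ennreal"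
    using that by (simp add: measurable_cong_sets[OF sets_restr_to_subalg[OF sub]])
  have "density ?R f = density ?R g"
  proof (rule measure_eqI)
    fix B assume "B \<in> sets (density ?R f)"
    then have B: "B \<in> sets (state_space X)" by (simp add: sets_restr_to_subalg[OF sub])
    have "emeasure (density ?R h) B = (\<integral>\<^sup>+y\<in>B. h y \<partial>lebesgue_on X)"
      if h: "h \<in> borel_measurable (state_space X)" for h
      using B h by (simp add: emeasure_density meas[OF h] sets_restr_to_subalg[OF sub] nn_integral_subalgebra2[OF sub])
    then show "emeasure (density ?R f) B = emeasure (density ?R g) B" using eq[OF B] f g by simp
  qed simp
  moreover have "(\<integral>\<^sup>+y. f y \<partial>?R) \<noteq> \<infinity>" using fin f by (simp add: nn_integral_subalgebra2[OF sub])
  ultimately have "AE y in ?R. f y = g y"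
    using finite_density_unique[OF meas[OF f] meas[OF g]] by simp
  then show ?thesis by (rule AE_restr_to_subalg[OF sub])
qed

text \<open>
  Both sides are densities of the law of the process at time \<open>s + t\<close>, which is computed by
  conditioning on time \<open>s\<close>.
\<close>

theorem chapman_kolmogorov:
  assumes mp: "markov_process X p P Y" and X: "X \<in> sets lebesgue" and x: "x \<in> X" and st: "0 < s" "0 < t"
  shows "AE y in lebesgue_on X. ennreal (p (s + t) x y) = (\<integral>\<^sup>+u. ennreal (p s x u) * ennreal (p t u y) \<partial>lebesgue_on X)"
proof (rule AE_lebesgue_on_eq_of_borel_integrals)
  interpret L: sigma_finite_measure "lebesgue_on X" by (rule sigma_finite_lebesgue_on[OF X])
  interpret LL: pair_sigma_finite "lebesgue_on X" "lebesgue_on X" ..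
  note pm = markov_density_measurable[OF mp]
  have slice: "(\<lambda>u. ennreal (p r x u)) \<in> borel_measurable (state_space X)" if "0 < r" for r
    using measurable_Pair2[OF pm[OF that], of x] x by simp
  have st0: "0 < s + t" using st by simp
  show "(\<lambda>y. ennreal (p (s + t) x y)) \<in> borel_measurable (state_space X)" by (rule slice[OF st0])
  have ps [measurable]: "(\<lambda>u. ennreal (p s x u)) \<in> borel_measurable (lebesgue_on X)"
    by (rule measurable_state_space_lebesgue_on[OF slice[OF st(1)]])
  have "(\<lambda>(x, y). p s x y) \<in> borel_measurable (state_space X \<Otimes>\<^sub>M state_space X)"
    using mp st unfolding markov_process_def by auto
  from measurable_Pair2[OF this, of x] have "(\<lambda>u. p s x u) \<in> borel_measurable (state_space X)" using x by simp
  then have [measurable]: "(\<lambda>u. p s x u) \<in> borel_measurable (lebesgue_on X)"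
    by (rule measurable_state_space_lebesgue_on)
  have pt1 [measurable]: "(\<lambda>(y, u). ennreal (p t u y)) \<in> borel_measurable (state_space X \<Otimes>\<^sub>M lebesgue_on X)"
    using measurable_pair_state_space(2)[OF pm[OF st(2)], of "lebesgue_on X" "state_space X"] by simp
  have pt2 [measurable]: "(\<lambda>(u, y). ennreal (p t u y)) \<in> borel_measurable (lebesgue_on X \<Otimes>\<^sub>M lebesgue_on X)"
    using measurable_pair_state_space(1)[OF pm[OF st(2)], of "lebesgue_on X" "lebesgue_on X"] by simp
  have pt3 [measurable]: "(\<lambda>(u, y). ennreal (p t u y)) \<in> borel_measurable (state_space X \<Otimes>\<^sub>M lebesgue_on X)"
    using measurable_pair_state_space(1)[OF pm[OF st(2)], of "state_space X" "lebesgue_on X"] by simp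
  show "(\<lambda>y. \<integral>\<^sup>+u. ennreal (p s x u) * ennreal (p t u y) \<partial>lebesgue_on X) \<in> borel_measurable (state_space X)"
    by measurable
  show "(\<integral>\<^sup>+y. ennreal (p (s + t) x y) \<partial>lebesgue_on X) < \<infinity>"
    using transition_density_integral[OF mp x st0] by simp
  fix B assume B: "B \<in> sets (state_space X)"
  have [measurable]: "B \<in> sets (lebesgue_on X)" by (rule sets_state_space_lebesgue_on[OF B])
  have "(\<lambda>u. \<integral>\<^sup>+y. ennreal (p t u y) * indicator B y \<partial>lebesgue_on X) \<in> borel_measurable (state_space X)"
    by measurable
  then have tm: "(\<lambda>u. transition_prob X p t u B) \<in> borel_measurable (state_space X)"
    by (simp add: transition_prob_def)
  have "(\<integral>\<^sup>+y\<in>B. ennreal (p (s + t) x y) \<partial>lebesgue_on X) = transition_prob X p (s + t) x B"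
    by (simp add: transition_prob_def)
  also have "\<dots> = (\<integral>\<^sup>+\<omega>. transition_prob X p t (Y s \<omega>) B \<partial>P x)"
    using markov_law[OF mp x st0 B] markov_law_step[OF mp x _ st(2) B, of s] st by simp
  also have "\<dots> = (\<integral>\<^sup>+u. ennreal (p s x u) * transition_prob X p t u B \<partial>lebesgue_on X)"
    by (rule markov_expectation[OF mp x st(1) tm])
  also have "\<dots> = (\<integral>\<^sup>+u. (\<integral>\<^sup>+y. ennreal (p s x u) * ennreal (p t u y) * indicator B y \<partial>lebesgue_on X) \<partial>lebesgue_on X)"
  proof (rule nn_integral_cong)
    fix u assume "u \<in> space (lebesgue_on X)"
    then have "(\<lambda>y. ennreal (p t u y)) \<in> borel_measurable (lebesgue_on X)"
      using measurable_Pair2[OF pt2, of u] by simp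
    then show "ennreal (p s x u) * transition_prob X p t u B =
        (\<integral>\<^sup>+y. ennreal (p s x u) * ennreal (p t u y) * indicator B y \<partial>lebesgue_on X)"
      unfolding transition_prob_def by (subst nn_integral_cmult[symmetric]) (auto simp: mult.assoc)
  qed
  also have "\<dots> = (\<integral>\<^sup>+y. (\<integral>\<^sup>+u. ennreal (p s x u) * ennreal (p t u y) * indicator B y \<partial>lebesgue_on X) \<partial>lebesgue_on X)"
    by (rule LL.Fubini'[symmetric]) measurable
  also have "\<dots> = (\<integral>\<^sup>+y\<in>B. (\<integral>\<^sup>+u. ennreal (p s x u) * ennreal (p t u y) \<partial>lebesgue_on X) \<partial>lebesgue_on X)"
  proof (rule nn_integral_cong)
    fix y assume "y \<in> space (lebesgue_on X)"
    then have "(\<lambda>u. ennreal (p t u y)) \<in> borel_measurable (lebesgue_on X)"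
      using measurable_Pair1[OF pt2, of y] by simp
    then show "(\<integral>\<^sup>+u. ennreal (p s x u) * ennreal (p t u y) * indicator B y \<partial>lebesgue_on X) =
        (\<integral>\<^sup>+u. ennreal (p s x u) * ennreal (p t u y) \<partial>lebesgue_on X) * indicator B y"
      using ps by (intro nn_integral_multc borel_measurable_times_ennreal)
  qed
  finally show "(\<integral>\<^sup>+y\<in>B. ennreal (p (s + t) x y) \<partial>lebesgue_on X)
      = (\<integral>\<^sup>+y\<in>B. (\<integral>\<^sup>+u. ennreal (p s x u) * ennreal (p t u y) \<partial>lebesgue_on X) \<partial>lebesgue_on X)" .
qed

text \<open>
  The bound survives the default value \<^term>\<open>enn2real top = 0\<close>: if \<open>b\<close> is infinite then so is \<open>d\<close>.
\<close>

lemma abs_enn2real_diff_le: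
  assumes "a \<le> b + d" "b \<le> a + (d :: ennreal)" "a < top"
  shows "ennreal \<bar>enn2real a - enn2real b\<bar> \<le> d"
proof (cases d)
  case (real r)
  have "b < top" using assms(2,3) real by (simp add: le_less_trans less_top)
  then obtain a' b' where ab: "a = ennreal a'" "0 \<le> a'" "b = ennreal b'" "0 \<le> b'"
    using assms(3) by (metis ennreal_cases less_top)
  then have "a' \<le> b' + r" "b' \<le> a' + r"
    using assms(1,2) real by (simp_all add: ennreal_plus[symmetric] del: ennreal_plus)
  then show ?thesis using ab real by (simp add: ennreal_leI abs_le_iff)
qed simp

text \<open>
  By the Chapman-Kolmogorov equation the difference of the two densities is the integral of
  \<open>p s x u - q u\<close> against \<open>p t u y\<close>. Taking absolute values inside and integrating over \<open>y\<close> first,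
  the mass one of \<open>p t u\<close> remains.
\<close>

theorem markov_L1_contraction:
  assumes mp: "markov_process X p P Y" and X: "X \<in> sets lebesgue" and x: "x \<in> X" and st: "0 < s" "0 < t"
    and q: "q \<in> borel_measurable (state_space X)" "\<And>u. u \<in> X \<Longrightarrow> 0 \<le> q u"
  shows "(\<integral>\<^sup>+y. ennreal \<bar>p (s + t) x y - enn2real (\<integral>\<^sup>+u. ennreal (q u) * ennreal (p t u y) \<partial>lebesgue_on X)\<bar> \<partial>lebesgue_on X)
      \<le> (\<integral>\<^sup>+u. ennreal \<bar>p s x u - q u\<bar> \<partial>lebesgue_on X)"
proof -
  interpret L: sigma_finite_measure "lebesgue_on X" by (rule sigma_finite_lebesgue_on[OF X])
  interpret LL: pair_sigma_finite "lebesgue_on X" "lebesgue_on X" ..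
  note pm = markov_density_measurable[OF mp]
  have nonneg: "0 \<le> p r u y" if "0 < r" "u \<in> X" "y \<in> X" for r u y
    using mp that unfolding markov_process_def by auto
  have "(\<lambda>(x, y). p s x y) \<in> borel_measurable (state_space X \<Otimes>\<^sub>M state_space X)"
    using mp st unfolding markov_process_def by auto
  from measurable_Pair2[OF this, of x] have "(\<lambda>u. p s x u) \<in> borel_measurable (state_space X)" using x by simp
  then have ps [measurable]: "(\<lambda>u. p s x u) \<in> borel_measurable (lebesgue_on X)"
    by (rule measurable_state_space_lebesgue_on)
  have qm [measurable]: "q \<in> borel_measurable (lebesgue_on X)"
    by (rule measurable_state_space_lebesgue_on[OF q(1)])
  have pt [measurable]: "(\<lambda>(u, y). ennreal (p t u y)) \<in> borel_measurable (lebesgue_on X \<Otimes>\<^sub>M lebesgue_on X)"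
    using measurable_pair_state_space(1)[OF pm[OF st(2)], of "lebesgue_on X" "lebesgue_on X"] by simp
  let ?a = "\<lambda>y. \<integral>\<^sup>+u. ennreal (p s x u) * ennreal (p t u y) \<partial>lebesgue_on X"
  let ?b = "\<lambda>y. \<integral>\<^sup>+u. ennreal (q u) * ennreal (p t u y) \<partial>lebesgue_on X"
  let ?d = "\<lambda>y. \<integral>\<^sup>+u. ennreal \<bar>p s x u - q u\<bar> * ennreal (p t u y) \<partial>lebesgue_on X"
  have st0: "0 < s + t" using st by simp
  have "(\<integral>\<^sup>+y. ennreal \<bar>p (s + t) x y - enn2real (?b y)\<bar> \<partial>lebesgue_on X) \<le> (\<integral>\<^sup>+y. ?d y \<partial>lebesgue_on X)"
  proof (rule nn_integral_mono_AE)
    show "AE y in lebesgue_on X. ennreal \<bar>p (s + t) x y - enn2real (?b y)\<bar> \<le> ?d y"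
      using chapman_kolmogorov[OF mp X x st] AE_space
    proof eventually_elim
      case (elim y)
      then have y: "y \<in> X" by simp
      then have py [measurable]: "(\<lambda>u. ennreal (p t u y)) \<in> borel_measurable (lebesgue_on X)"
        using measurable_Pair1[OF pt, of y] by simp
      have le: "ennreal v * w \<le> ennreal v' * w + ennreal \<bar>v - v'\<bar> * w"
          "ennreal v' * w \<le> ennreal v * w + ennreal \<bar>v - v'\<bar> * w" if "0 \<le> v" "0 \<le> v'" for v v' :: real and w
        using that by (auto simp: distrib_right[symmetric] ennreal_plus[symmetric]
            simp del: ennreal_plus intro!: mult_right_mono ennreal_leI)
      have "?a y \<le> (\<integral>\<^sup>+u. ennreal (q u) * ennreal (p t u y) + ennreal \<bar>p s x u - q u\<bar> * ennreal (p t u y) \<partial>lebesgue_on X)"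
        using q(2) nonneg[OF st(1) x] by (intro nn_integral_mono le) auto
      then have "?a y \<le> ?b y + ?d y" by (subst (asm) nn_integral_add) auto
      moreover have "?b y \<le> (\<integral>\<^sup>+u. ennreal (p s x u) * ennreal (p t u y) + ennreal \<bar>p s x u - q u\<bar> * ennreal (p t u y) \<partial>lebesgue_on X)"
        using q(2) nonneg[OF st(1) x] by (intro nn_integral_mono le) auto
      then have "?b y \<le> ?a y + ?d y" by (subst (asm) nn_integral_add) auto
      moreover have "?a y < top" unfolding elim(1)[symmetric] by simp
      ultimately have "ennreal \<bar>enn2real (?a y) - enn2real (?b y)\<bar> \<le> ?d y" by (rule abs_enn2real_diff_le)
      moreover have "enn2real (?a y) = p (s + t) x y"
        unfolding elim(1)[symmetric] using nonneg[OF st0 x y] by simp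
      ultimately show ?case by simp
    qed
  qed
  also have "\<dots> = (\<integral>\<^sup>+u. (\<integral>\<^sup>+y. ennreal \<bar>p s x u - q u\<bar> * ennreal (p t u y) \<partial>lebesgue_on X) \<partial>lebesgue_on X)"
    by (rule LL.Fubini') measurable
  also have "\<dots> = (\<integral>\<^sup>+u. ennreal \<bar>p s x u - q u\<bar> \<partial>lebesgue_on X)"
  proof (rule nn_integral_cong)
    fix u assume "u \<in> space (lebesgue_on X)"
    then have u: "u \<in> X" by simp
    then have "(\<lambda>y. ennreal (p t u y)) \<in> borel_measurable (lebesgue_on X)"
      using measurable_Pair2[OF pt, of u] by simp
    then have "(\<integral>\<^sup>+y. ennreal \<bar>p s x u - q u\<bar> * ennreal (p t u y) \<partial>lebesgue_on X)
        = ennreal \<bar>p s x u - q u\<bar> * (\<integral>\<^sup>+y. ennreal (p t u y) \<partial>lebesgue_on X)"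
      by (rule nn_integral_cmult)
    then show "(\<integral>\<^sup>+y. ennreal \<bar>p s x u - q u\<bar> * ennreal (p t u y) \<partial>lebesgue_on X) = ennreal \<bar>p s x u - q u\<bar>"
      using transition_density_integral[OF mp u st(2)] by simp
  qed
  finally show ?thesis .
qed


section \<open>The weighted \<open>L\<^sup>2\<close> space\<close>

text \<open>
  The square of \<^const>\<open>L2_norm\<close>, which behaves well under sums up to constant factors.
\<close>

definition L2_sq :: "(real^'n) set \<Rightarrow> (real^'n \<Rightarrow> real) \<Rightarrow> (real^'n \<Rightarrow> real) \<Rightarrow> ennreal" where
  "L2_sq X \<pi> h = (\<integral>\<^sup>+ y. ennreal (\<bar>h y\<bar>\<^sup>2 / \<pi> y) \<partial>lebesgue_on X)"

lemma L2_norm_eq_sqrt_L2_sq: "L2_norm X \<pi> h = ennreal_sqrt (L2_sq X \<pi> h)"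
  by (simp add: L2_norm_def L2_sq_def)

lemma ennreal_sqrt_power2: "(ennreal_sqrt a)\<^sup>2 = a"
proof (cases a)
  case (real r)
  then show ?thesis by (simp add: ennreal_sqrt_def ennreal_power)
qed (simp add: ennreal_sqrt_def power2_eq_square)

lemma L2_sq_eq: "L2_sq X \<pi> h = (L2_norm X \<pi> h)\<^sup>2"
  by (simp add: L2_norm_eq_sqrt_L2_sq ennreal_sqrt_power2)

lemma le_ennreal_sqrt: "x \<le> ennreal_sqrt a" if "x\<^sup>2 \<le> (a :: ennreal)"
proof (cases a)
  case (real r)
  then have "x \<noteq> top" using that by (auto simp: power2_eq_square ennreal_mult_top top_unique)
  then obtain s where s: "x = ennreal s" "0 \<le> s" by (cases x) auto
  then have "s\<^sup>2 \<le> r" using that real by (simp add: ennreal_power)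
  then show ?thesis using s real by (simp add: ennreal_sqrt_def real_le_rsqrt ennreal_leI)
qed (simp add: ennreal_sqrt_def)

lemma ennreal_sqrt_eq_top_iff: "ennreal_sqrt a = top \<longleftrightarrow> a = top"
  by (simp add: ennreal_sqrt_def)

lemma ennreal_double_sum: "0 \<le> a \<Longrightarrow> 0 \<le> b \<Longrightarrow> 2 * ennreal a + 2 * ennreal b = ennreal (2 * a + 2 * b)"
  unfolding mult_2 by (simp only: ennreal_plus add_nonneg_nonneg)

lemma L2_norm_finite_iff: "L2_norm X \<pi> h < top \<longleftrightarrow> L2_sq X \<pi> h < top"
  by (simp add: L2_norm_eq_sqrt_L2_sq less_top[symmetric] ennreal_sqrt_eq_top_iff)

lemma ennreal_sqrt_measurable [measurable]: "ennreal_sqrt \<in> borel_measurable borel"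
  unfolding ennreal_sqrt_def[abs_def] by measurable

lemma L2_norm_cong_AE:
  assumes "AE y in lebesgue_on X. g y = h y"
  shows "L2_norm X \<pi> g = L2_norm X \<pi> h"
proof -
  have "(\<integral>\<^sup>+ y. ennreal (\<bar>g y\<bar>\<^sup>2 / \<pi> y) \<partial>lebesgue_on X) = (\<integral>\<^sup>+ y. ennreal (\<bar>h y\<bar>\<^sup>2 / \<pi> y) \<partial>lebesgue_on X)"
    using assms by (intro nn_integral_cong_AE) auto
  then show ?thesis by (simp add: L2_norm_def)
qed

text \<open>
  Cauchy-Schwarz for the factors \<open>\<bar>h\<bar> / sqrt \<pi>\<close> and \<open>sqrt \<pi>\<close>.
\<close>

lemma L1_le_L2_norm:
  assumes \<pi>: "\<pi> \<in> borel_measurable (lebesgue_on X)" "\<And>x. x \<in> X \<Longrightarrow> 0 < \<pi> x"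
    and one: "(\<integral>\<^sup>+y. ennreal (\<pi> y) \<partial>lebesgue_on X) = 1"
    and h: "h \<in> borel_measurable (lebesgue_on X)"
  shows "(\<integral>\<^sup>+y. ennreal \<bar>h y\<bar> \<partial>lebesgue_on X) \<le> L2_norm X \<pi> h"
proof -
  note [measurable] = \<pi>(1) h
  let ?f = "\<lambda>y. ennreal (\<bar>h y\<bar> / sqrt (\<pi> y))" and ?g = "\<lambda>y. ennreal (sqrt (\<pi> y))"
  have "(\<integral>\<^sup>+y. ennreal \<bar>h y\<bar> \<partial>lebesgue_on X) = (\<integral>\<^sup>+y. ?f y * ?g y \<partial>lebesgue_on X)"
  proof (rule nn_integral_cong)
    fix y assume "y \<in> space (lebesgue_on X)"
    then have "0 < \<pi> y" using \<pi>(2) by simp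
    then show "ennreal \<bar>h y\<bar> = ?f y * ?g y" by (simp add: ennreal_mult[symmetric])
  qed
  moreover have "(\<integral>\<^sup>+y. ?f y * ?g y \<partial>lebesgue_on X)\<^sup>2 \<le> (\<integral>\<^sup>+y. (?f y)\<^sup>2 \<partial>lebesgue_on X) * (\<integral>\<^sup>+y. (?g y)\<^sup>2 \<partial>lebesgue_on X)"
    by (rule Cauchy_Schwarz_nn_integral) measurable
  moreover have "(\<integral>\<^sup>+y. (?f y)\<^sup>2 \<partial>lebesgue_on X) = L2_sq X \<pi> h"
    unfolding L2_sq_def
  proof (rule nn_integral_cong)
    fix y assume "y \<in> space (lebesgue_on X)"
    then have "0 < \<pi> y" using \<pi>(2) by simp
    then show "(?f y)\<^sup>2 = ennreal (\<bar>h y\<bar>\<^sup>2 / \<pi> y)" by (simp add: ennreal_power power_divide)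
  qed
  moreover have "(\<integral>\<^sup>+y. (?g y)\<^sup>2 \<partial>lebesgue_on X) = (\<integral>\<^sup>+y. ennreal (\<pi> y) \<partial>lebesgue_on X)"
  proof (rule nn_integral_cong)
    fix y assume "y \<in> space (lebesgue_on X)"
    then have "0 < \<pi> y" using \<pi>(2) by simp
    then show "(?g y)\<^sup>2 = ennreal (\<pi> y)" by (simp add: ennreal_power)
  qed
  ultimately show ?thesis
    using one unfolding L2_norm_eq_sqrt_L2_sq by (intro le_ennreal_sqrt) simp
qed

lemma L2_sq_add_le:
  assumes \<pi>: "\<pi> \<in> borel_measurable (lebesgue_on X)" "\<And>x. x \<in> X \<Longrightarrow> 0 < \<pi> x"
    and [measurable]: "g \<in> borel_measurable (lebesgue_on X)" "h \<in> borel_measurable (lebesgue_on X)"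
  shows "L2_sq X \<pi> (\<lambda>y. g y + h y) \<le> 2 * L2_sq X \<pi> g + 2 * L2_sq X \<pi> h"
proof -
  have [measurable]: "\<pi> \<in> borel_measurable (lebesgue_on X)" by (rule \<pi>(1))
  have "L2_sq X \<pi> (\<lambda>y. g y + h y)
      \<le> (\<integral>\<^sup>+ y. 2 * ennreal (\<bar>g y\<bar>\<^sup>2 / \<pi> y) + 2 * ennreal (\<bar>h y\<bar>\<^sup>2 / \<pi> y) \<partial>lebesgue_on X)"
    unfolding L2_sq_def
  proof (rule nn_integral_mono)
    fix y assume "y \<in> space (lebesgue_on X)"
    then have pos: "0 < \<pi> y" using \<pi>(2) by simp
    have "(g y + h y)\<^sup>2 \<le> 2 * (g y)\<^sup>2 + 2 * (h y)\<^sup>2"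
      using sum_squares_bound[of "g y" "h y"] by (simp add: power2_sum)
    then have "(g y + h y)\<^sup>2 / \<pi> y \<le> (2 * (g y)\<^sup>2 + 2 * (h y)\<^sup>2) / \<pi> y"
      using pos by (intro divide_right_mono) auto
    then have "ennreal (\<bar>g y + h y\<bar>\<^sup>2 / \<pi> y) \<le> ennreal (2 * (\<bar>g y\<bar>\<^sup>2 / \<pi> y) + 2 * (\<bar>h y\<bar>\<^sup>2 / \<pi> y))"
      by (intro ennreal_leI) (simp add: add_divide_distrib)
    also have "\<dots> = 2 * ennreal (\<bar>g y\<bar>\<^sup>2 / \<pi> y) + 2 * ennreal (\<bar>h y\<bar>\<^sup>2 / \<pi> y)"
      using pos by (intro ennreal_double_sum[symmetric]) auto
    finally show "ennreal (\<bar>g y + h y\<bar>\<^sup>2 / \<pi> y) \<le> 2 * ennreal (\<bar>g y\<bar>\<^sup>2 / \<pi> y) + 2 * ennreal (\<bar>h y\<bar>\<^sup>2 / \<pi> y)" .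
  qed
  also have "\<dots> = 2 * L2_sq X \<pi> g + 2 * L2_sq X \<pi> h"
    unfolding L2_sq_def by (subst nn_integral_add) (auto simp: nn_integral_cmult)
  finally show ?thesis .
qed

lemma L2_sq_cmult:
  assumes \<pi>: "\<pi> \<in> borel_measurable (lebesgue_on X)" and "h \<in> borel_measurable (lebesgue_on X)"
  shows "L2_sq X \<pi> (\<lambda>y. c * h y) = ennreal (c\<^sup>2) * L2_sq X \<pi> h"
  unfolding L2_sq_def using assms
  by (subst nn_integral_cmult[symmetric]) (auto simp: ennreal_mult'[symmetric] abs_mult power_mult_distrib intro!: nn_integral_cong)

lemma L2_sq_uminus: "L2_sq X \<pi> (\<lambda>y. - h y) = L2_sq X \<pi> h"
  by (simp add: L2_sq_def)

lemma L2_sq_diff_le: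
  assumes \<pi>: "\<pi> \<in> borel_measurable (lebesgue_on X)" "\<And>x. x \<in> X \<Longrightarrow> 0 < \<pi> x"
    and "g \<in> borel_measurable (lebesgue_on X)" "h \<in> borel_measurable (lebesgue_on X)"
  shows "L2_sq X \<pi> (\<lambda>y. g y - h y) \<le> 2 * L2_sq X \<pi> g + 2 * L2_sq X \<pi> h"
  using L2_sq_add_le[OF \<pi> assms(3), of "\<lambda>y. - h y"] assms(4) by (simp add: L2_sq_uminus)

lemma L2_sq_sum_finite:
  assumes \<pi>: "\<pi> \<in> borel_measurable (lebesgue_on X)" "\<And>x. x \<in> X \<Longrightarrow> 0 < \<pi> x"
    and "finite I" and h: "\<And>i. i \<in> I \<Longrightarrow> h i \<in> L2_space X \<pi>"
  shows "\<exists>C::real. 0 \<le> C \<and> (\<forall>c. L2_sq X \<pi> (\<lambda>y. \<Sum>i\<in>I. c i * h i y) \<le> ennreal (C * (\<Sum>i\<in>I. (c i)\<^sup>2)))"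
  using assms(3) h
proof (induction I rule: finite_induct)
  case empty
  then show ?case by (intro exI[of _ 0]) (simp add: L2_sq_def)
next
  case (insert i I)
  then obtain C where C: "0 \<le> C" "\<And>c. L2_sq X \<pi> (\<lambda>y. \<Sum>i\<in>I. c i * h i y) \<le> ennreal (C * (\<Sum>i\<in>I. (c i)\<^sup>2))"
    by auto
  have hm: "h j \<in> borel_measurable (lebesgue_on X)" if "j \<in> insert i I" for j
    using insert.prems[OF that] by (simp add: L2_space_def)
  have "L2_sq X \<pi> (h i) < \<infinity>" using insert.prems[of i] by (simp add: L2_space_def L2_norm_finite_iff)
  then obtain b where b: "L2_sq X \<pi> (h i) = ennreal b" "0 \<le> b" by (cases "L2_sq X \<pi> (h i)") auto
  let ?C = "2 * b + 2 * C"
  have "L2_sq X \<pi> (\<lambda>y. \<Sum>i\<in>insert i I. c i * h i y) \<le> ennreal (?C * (\<Sum>i\<in>insert i I. (c i)\<^sup>2))" for c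
  proof -
    have "L2_sq X \<pi> (\<lambda>y. \<Sum>i\<in>insert i I. c i * h i y)
        = L2_sq X \<pi> (\<lambda>y. c i * h i y + (\<Sum>i\<in>I. c i * h i y))" using insert by simp
    also have "\<dots> \<le> 2 * L2_sq X \<pi> (\<lambda>y. c i * h i y) + 2 * L2_sq X \<pi> (\<lambda>y. \<Sum>i\<in>I. c i * h i y)"
      using hm by (intro L2_sq_add_le \<pi>) auto
    also have "\<dots> \<le> 2 * (ennreal ((c i)\<^sup>2) * ennreal b) + 2 * ennreal (C * (\<Sum>i\<in>I. (c i)\<^sup>2))"
      using hm by (intro add_mono mult_left_mono C) (auto simp: L2_sq_cmult[OF \<pi>(1)] b(1))
    also have "\<dots> = ennreal (2 * ((c i)\<^sup>2 * b) + 2 * (C * (\<Sum>i\<in>I. (c i)\<^sup>2)))"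
      using b(2) C(1) by (simp add: ennreal_mult[symmetric] ennreal_double_sum sum_nonneg)
    also have "\<dots> \<le> ennreal (?C * (\<Sum>i\<in>insert i I. (c i)\<^sup>2))"
    proof (rule ennreal_leI)
      have "0 \<le> b * (\<Sum>i\<in>I. (c i)\<^sup>2)" "0 \<le> C * (c i)\<^sup>2"
        using b(2) C(1) by (auto intro!: mult_nonneg_nonneg sum_nonneg)
      then show "2 * ((c i)\<^sup>2 * b) + 2 * (C * (\<Sum>i\<in>I. (c i)\<^sup>2)) \<le> ?C * (\<Sum>i\<in>insert i I. (c i)\<^sup>2)"
        using insert(1,2) by (simp add: algebra_simps)
    qed
    finally show ?thesis .
  qed
  moreover have "0 \<le> ?C" using b C by simp
  ultimately show ?case by blast
qed

text \<open>
  Within the space the distance is finite, so that the conversion to a real number is faithful.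
\<close>

lemma L2_dist_power2:
  assumes \<pi>: "\<pi> \<in> borel_measurable (lebesgue_on X)" "\<And>x. x \<in> X \<Longrightarrow> 0 < \<pi> x"
    and "g \<in> L2_space X \<pi>" "h \<in> L2_space X \<pi>"
  shows "L2_sq X \<pi> (\<lambda>y. g y - h y) = ennreal ((L2_dist X \<pi> g h)\<^sup>2)"
proof -
  have "L2_sq X \<pi> (\<lambda>y. g y - h y) \<le> 2 * L2_sq X \<pi> g + 2 * L2_sq X \<pi> h"
    using assms(3,4) by (intro L2_sq_diff_le \<pi>) (auto simp: L2_space_def)
  also have "\<dots> < \<infinity>"
    using assms(3,4) by (auto simp: L2_space_def L2_norm_finite_iff ennreal_mult_less_top)
  finally have "L2_norm X \<pi> (\<lambda>y. g y - h y) < \<infinity>" by (simp add: L2_norm_finite_iff)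
  then have eq: "L2_norm X \<pi> (\<lambda>y. g y - h y) = ennreal (L2_dist X \<pi> g h)" by (simp add: L2_dist_def)
  show ?thesis unfolding L2_sq_eq eq by (rule ennreal_power) (simp add: L2_dist_def)
qed

text \<open>
  Differentiability implies continuity: the increment is the sum of the linear part, with square norm
  of order \<open>\<bar>w - x\<bar>\<^sup>2\<close>, and the remainder \<open>?R w\<close>, which is even \<open>o (\<bar>w - x\<bar>)\<close>.
\<close>

lemma L2_dist_tendsto_of_differentiable:
  assumes \<pi>: "\<pi> \<in> borel_measurable (lebesgue_on X)" "\<And>x. x \<in> X \<Longrightarrow> 0 < \<pi> x"
    and Q: "L2_continuously_differentiable X \<pi> Q" and x: "x \<in> X"
  shows "((\<lambda>w. L2_dist X \<pi> (Q w) (Q x)) \<longlongrightarrow> 0) (at x within X)"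
proof -
  obtain D where QL: "\<And>x. x \<in> X \<Longrightarrow> Q x \<in> L2_space X \<pi>" and D: "\<And>i. D x i \<in> L2_space X \<pi>"
    and lim: "((\<lambda>w. L2_dist X \<pi> (\<lambda>y. Q w y - Q x y) (\<lambda>y. \<Sum>i\<in>UNIV. (w - x) $ i * D x i y)
                      / norm (w - x)) \<longlongrightarrow> 0) (at x within X)"
    using Q x unfolding L2_continuously_differentiable_def by blast
  let ?L = "\<lambda>w y. \<Sum>i\<in>UNIV. (w - x) $ i * D x i y"
  let ?R = "\<lambda>w. L2_dist X \<pi> (\<lambda>y. Q w y - Q x y) (?L w)"
  obtain C where C: "0 \<le> C" "\<And>c. L2_sq X \<pi> (\<lambda>y. \<Sum>i\<in>UNIV. c i * D x i y) \<le> ennreal (C * (\<Sum>i\<in>UNIV. (c i)\<^sup>2))"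
    using L2_sq_sum_finite[OF \<pi>, of UNIV "D x"] D by auto
  have Lm: "?L w \<in> L2_space X \<pi>" for w
  proof -
    have [measurable]: "D x i \<in> borel_measurable (lebesgue_on X)" for i using D[of i] by (simp add: L2_space_def)
    have "?L w \<in> borel_measurable (lebesgue_on X)" by measurable
    moreover have "L2_sq X \<pi> (?L w) < \<infinity>" using C(2)[of "\<lambda>i. (w - x) $ i"] by (rule le_less_trans) simp
    ultimately show ?thesis by (simp add: L2_space_def L2_norm_finite_iff)
  qed
  have Qd: "(\<lambda>y. Q w y - Q x y) \<in> L2_space X \<pi>" if "w \<in> X" for w
  proof -
    have "L2_sq X \<pi> (\<lambda>y. Q w y - Q x y) < \<infinity>"
      using L2_dist_power2[OF \<pi> QL[OF that] QL[OF x]] by simp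
    then show ?thesis using QL[OF that] QL[OF x]
      by (simp add: L2_space_def L2_norm_finite_iff borel_measurable_diff)
  qed
  have bound: "(L2_dist X \<pi> (Q w) (Q x))\<^sup>2 \<le> 2 * (?R w)\<^sup>2 + 2 * (C * (norm (w - x))\<^sup>2)" if w: "w \<in> X" for w
  proof -
    have Rm: "(\<lambda>y. Q w y - Q x y) \<in> borel_measurable (lebesgue_on X)" "?L w \<in> borel_measurable (lebesgue_on X)"
      using Qd[OF w] Lm[of w] unfolding L2_space_def by blast+
    have "ennreal ((L2_dist X \<pi> (Q w) (Q x))\<^sup>2) = L2_sq X \<pi> (\<lambda>y. Q w y - Q x y)"
      using L2_dist_power2[OF \<pi> QL[OF w] QL[OF x]] by simp
    also have "\<dots> = L2_sq X \<pi> (\<lambda>y. ((Q w y - Q x y) - ?L w y) + ?L w y)" by simp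
    also have "\<dots> \<le> 2 * L2_sq X \<pi> (\<lambda>y. (Q w y - Q x y) - ?L w y) + 2 * L2_sq X \<pi> (?L w)"
      by (intro L2_sq_add_le \<pi> borel_measurable_diff Rm)
    also have "\<dots> \<le> 2 * ennreal ((?R w)\<^sup>2) + 2 * ennreal (C * (\<Sum>i\<in>UNIV. ((w - x) $ i)\<^sup>2))"
      using L2_dist_power2[OF \<pi> Qd[OF w] Lm] C(2)[of "\<lambda>i. (w - x) $ i"]
      by (intro add_mono mult_left_mono) auto
    also have "(\<Sum>i\<in>UNIV. ((w - x) $ i)\<^sup>2) = (norm (w - x))\<^sup>2"
      unfolding power2_norm_eq_inner by (simp add: inner_vec_def power2_eq_square)
    also have "2 * ennreal ((?R w)\<^sup>2) + 2 * ennreal (C * (norm (w - x))\<^sup>2)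
        = ennreal (2 * (?R w)\<^sup>2 + 2 * (C * (norm (w - x))\<^sup>2))"
      using C(1) by (intro ennreal_double_sum) auto
    finally show ?thesis using C(1) by (subst (asm) ennreal_le_iff) auto
  qed
  have "((\<lambda>w. norm (w - x)) \<longlongrightarrow> norm (x - x)) (at x within X)" by (intro tendsto_intros)
  then have n0: "((\<lambda>w. norm (w - x)) \<longlongrightarrow> 0) (at x within X)" by simp
  have "((\<lambda>w. ?R w / norm (w - x) * norm (w - x)) \<longlongrightarrow> 0 * 0) (at x within X)"
    by (rule tendsto_mult[OF lim n0])
  moreover have "\<forall>\<^sub>F w in at x within X. ?R w / norm (w - x) * norm (w - x) = ?R w"
    by (auto simp: eventually_at_filter)
  ultimately have R0: "(?R \<longlongrightarrow> 0) (at x within X)"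
    using tendsto_cong[of "\<lambda>w. ?R w / norm (w - x) * norm (w - x)" ?R] by simp
  have "((\<lambda>w. 2 * (?R w)\<^sup>2 + 2 * (C * (norm (w - x))\<^sup>2)) \<longlongrightarrow> 2 * 0\<^sup>2 + 2 * (C * 0\<^sup>2)) (at x within X)"
    by (intro tendsto_intros R0 n0)
  then have up: "((\<lambda>w. 2 * (?R w)\<^sup>2 + 2 * (C * (norm (w - x))\<^sup>2)) \<longlongrightarrow> 0) (at x within X)" by simp
  have "((\<lambda>w. (L2_dist X \<pi> (Q w) (Q x))\<^sup>2) \<longlongrightarrow> 0) (at x within X)"
  proof (rule tendsto_sandwich[OF _ _ tendsto_const up])
    show "\<forall>\<^sub>F w in at x within X. (L2_dist X \<pi> (Q w) (Q x))\<^sup>2 \<le> 2 * (?R w)\<^sup>2 + 2 * (C * (norm (w - x))\<^sup>2)"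
      using bound by (auto simp: eventually_at_filter)
  qed simp
  then have "((\<lambda>w. sqrt ((L2_dist X \<pi> (Q w) (Q x))\<^sup>2)) \<longlongrightarrow> sqrt 0) (at x within X)"
    by (intro tendsto_real_sqrt)
  then show ?thesis by (simp add: L2_dist_def)
qed


section \<open>Jointly measurable versions of the projection\<close>

text \<open>
  Approximate \<open>Q x\<close> by the first element, within distance \<open>2\<^sup>-\<^sup>m\<close>, of a sequence \<open>q\<close> that is dense in the
  image of \<open>Q\<close>. For each \<open>m\<close> this is a jointly measurable step function of \<open>x\<close> whose value depends on
  \<open>Q x\<close> only. The square distances are summable, so the approximations converge almost everywhere, and
  the lower limit is the required version.
\<close>

lemma exists_measurable_version:
  fixes Q :: "real^'n \<Rightarrow> real^'n \<Rightarrow> real"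
  assumes ne: "X \<noteq> {}"
    and \<pi>: "\<pi> \<in> borel_measurable (lebesgue_on X)" "\<And>x. x \<in> X \<Longrightarrow> 0 < \<pi> x"
    and QM: "\<And>x. x \<in> X \<Longrightarrow> Q x \<in> M" and M_L2: "M \<subseteq> L2_space X \<pi>"
    and met: "Metric_space M (L2_dist X \<pi>)"
    and cont: "\<And>x. x \<in> X \<Longrightarrow> ((\<lambda>w. L2_dist X \<pi> (Q w) (Q x)) \<longlongrightarrow> 0) (at x within X)"
    and Mm: "\<And>q. q \<in> M \<Longrightarrow> q \<in> borel_measurable (state_space X)"
    and M0: "\<And>q y. q \<in> M \<Longrightarrow> y \<in> X \<Longrightarrow> 0 \<le> q y"
  shows "\<exists>F :: (real^'n \<Rightarrow> real) \<Rightarrow> real^'n \<Rightarrow> real. (\<forall>q y. 0 \<le> F q y) \<and>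
     (\<lambda>(x, y). F (Q x) y) \<in> borel_measurable (state_space X \<Otimes>\<^sub>M state_space X) \<and>
     (\<forall>x\<in>X. AE y in lebesgue_on X. F (Q x) y = Q x y)"
proof -
  interpret Metric_space M "L2_dist X \<pi>" by (rule met)
  obtain T where T: "countable T" "T \<subseteq> X" "X \<subseteq> closure T" using separable .
  then have "T \<noteq> {}" using ne by auto
  define q where "q i = Q (from_nat_into T i)" for i
  have s: "from_nat_into T i \<in> X" for i using from_nat_into[OF \<open>T \<noteq> {}\<close>] T(2) by blast
  have qM: "q i \<in> M" for i using QM[OF s] by (simp add: q_def)
  have dense: "\<exists>i. L2_dist X \<pi> (Q x) (q i) < e" if x: "x \<in> X" and e: "0 < e" for x e
  proof -
    obtain \<delta> where \<delta>: "0 < \<delta>" "\<And>w. w \<in> X \<Longrightarrow> w \<noteq> x \<Longrightarrow> dist w x < \<delta> \<Longrightarrow> dist (L2_dist X \<pi> (Q w) (Q x)) 0 < e"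
      using cont[OF x] e unfolding Lim_within by (metis dist_pos_lt)
    obtain w where w: "w \<in> T" "dist w x < \<delta>"
      using T(3) x \<delta>(1) closure_approachable by blast
    then obtain i where i: "from_nat_into T i = w" using from_nat_into_surj[OF T(1)] by blast
    have "L2_dist X \<pi> (Q x) (Q w) < e"
    proof (cases "w = x")
      case True then show ?thesis using e QM[OF x] by simp
    next
      case False
      then show ?thesis using \<delta>(2)[of w] w T(2) commute[of "Q x" "Q w"] by auto
    qed
    then show ?thesis using i by (auto simp: q_def)
  qed
  define I where "I m r = (LEAST i. L2_dist X \<pi> r (q i) < (1/2) ^ m)" for m :: nat and r
  have I: "L2_dist X \<pi> (Q x) (q (I m (Q x))) < (1/2) ^ m" if "x \<in> X" for x m
    unfolding I_def by (rule LeastI_ex) (rule dense[OF that], simp)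
  define F where "F r y = enn2real (liminf (\<lambda>m. ennreal (q (I m r) y)))" for r y
  have dist_meas [measurable]: "(\<lambda>x. L2_dist X \<pi> (Q x) (q i)) \<in> borel_measurable (state_space X)" for i
    unfolding state_space_def
  proof (rule borel_measurable_continuous_on_restrict, unfold continuous_on_def, intro ballI)
    fix x assume x: "x \<in> X"
    show "((\<lambda>w. L2_dist X \<pi> (Q w) (q i)) \<longlongrightarrow> L2_dist X \<pi> (Q x) (q i)) (at x within X)"
    proof (rule LIM_zero_cancel, rule Lim_null_comparison[OF _ cont[OF x]])
      have "norm (L2_dist X \<pi> (Q w) (q i) - L2_dist X \<pi> (Q x) (q i)) \<le> L2_dist X \<pi> (Q w) (Q x)" if "w \<in> X" for w
        using triangle[OF QM[OF that] QM[OF x] qM[of i]] triangle[OF QM[OF x] QM[OF that] qM[of i]]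
          commute[of "Q x" "Q w"] by (simp add: abs_le_iff)
      then show "\<forall>\<^sub>F w in at x within X. norm (L2_dist X \<pi> (Q w) (q i) - L2_dist X \<pi> (Q x) (q i)) \<le> L2_dist X \<pi> (Q w) (Q x)"
        by (auto simp: eventually_at_filter)
    qed
  qed
  have I_meas: "(\<lambda>z. I m (Q (fst z))) \<in> state_space X \<Otimes>\<^sub>M state_space X \<rightarrow>\<^sub>M count_space UNIV" for m
  proof -
    have "(\<lambda>x. I m (Q x)) \<in> state_space X \<rightarrow>\<^sub>M count_space UNIV"
      unfolding I_def by measurable
    from measurable_compose[OF measurable_fst this] show ?thesis .
  qed
  have "(\<lambda>z. ennreal (q (I m (Q (fst z))) (snd z))) \<in> borel_measurable (state_space X \<Otimes>\<^sub>M state_space X)" for m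
  proof (rule measurable_compose_countable[OF _ I_meas])
    fix i
    have "(\<lambda>y. ennreal (q i y)) \<in> borel_measurable (state_space X)" using Mm[OF qM] by simp
    from measurable_compose[OF measurable_snd this]
    show "(\<lambda>z. ennreal (q i (snd z))) \<in> borel_measurable (state_space X \<Otimes>\<^sub>M state_space X)" .
  qed
  then have "(\<lambda>z. F (Q (fst z)) (snd z)) \<in> borel_measurable (state_space X \<Otimes>\<^sub>M state_space X)"
    unfolding F_def by measurable
  then have F_meas: "(\<lambda>(x, y). F (Q x) y) \<in> borel_measurable (state_space X \<Otimes>\<^sub>M state_space X)"
    by (simp add: split_beta')
  have "AE y in lebesgue_on X. F (Q x) y = Q x y" if x: "x \<in> X" for x
  proof -
    define g where "g m = q (I m (Q x))" for m
    have gM: "g m \<in> M" for m by (simp add: g_def qM)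
    have [measurable]: "r \<in> borel_measurable (lebesgue_on X)" if "r \<in> M" for r
      using M_L2 that by (auto simp: L2_space_def)
    note [measurable] = \<pi>(1) QM[OF x] gM
    \<comment> \<open>Summable square distances give almost everywhere convergence of the whole sequence.\<close>
    have "(\<integral>\<^sup>+y. (\<Sum>m. ennreal (\<bar>Q x y - g m y\<bar>\<^sup>2 / \<pi> y)) \<partial>lebesgue_on X)
        = (\<Sum>m. L2_sq X \<pi> (\<lambda>y. Q x y - g m y))"
      unfolding L2_sq_def by (rule nn_integral_suminf) measurable
    also have "\<dots> \<le> (\<Sum>m. ennreal ((1/4) ^ m))"
    proof (rule suminf_le)
      fix m
      have "L2_sq X \<pi> (\<lambda>y. Q x y - g m y) = ennreal ((L2_dist X \<pi> (Q x) (g m))\<^sup>2)"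
        using QM[OF x] gM M_L2 by (intro L2_dist_power2 \<pi>) auto
      also have "\<dots> \<le> ennreal (((1/2) ^ m)\<^sup>2)"
        using I[OF x, of m] by (intro ennreal_leI power_mono) (auto simp: g_def)
      also have "((1/2) ^ m)\<^sup>2 = (1/4 :: real) ^ m"
        by (simp add: power2_eq_square power_mult_distrib[symmetric])
      finally show "L2_sq X \<pi> (\<lambda>y. Q x y - g m y) \<le> ennreal ((1/4) ^ m)" .
    qed auto
    also have "\<dots> = ennreal (1 / (1 - 1/4))"
      by (rule suminf_ennreal_eq, simp, rule geometric_sums) simp
    also have "\<dots> < \<infinity>" by simp
    finally have "(\<integral>\<^sup>+y. (\<Sum>m. ennreal (\<bar>Q x y - g m y\<bar>\<^sup>2 / \<pi> y)) \<partial>lebesgue_on X) \<noteq> \<infinity>" by simp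
    then have "AE y in lebesgue_on X. (\<Sum>m. ennreal (\<bar>Q x y - g m y\<bar>\<^sup>2 / \<pi> y)) \<noteq> \<infinity>"
      by (rule nn_integral_PInf_AE[rotated]) measurable
    then show ?thesis
      using AE_space
    proof eventually_elim
      case (elim y)
      then have y: "y \<in> X" and pos: "0 < \<pi> y" using \<pi>(2) by auto
      have "summable (\<lambda>m. \<bar>Q x y - g m y\<bar>\<^sup>2 / \<pi> y)"
        using elim(1) pos by (intro summable_suminf_not_top) auto
      then have "(\<lambda>m. \<bar>Q x y - g m y\<bar>\<^sup>2 / \<pi> y) \<longlonglongrightarrow> 0" by (rule summable_LIMSEQ_zero)
      then have "(\<lambda>m. sqrt (\<bar>Q x y - g m y\<bar>\<^sup>2 / \<pi> y * \<pi> y)) \<longlonglongrightarrow> sqrt (0 * \<pi> y)"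
        by (intro tendsto_intros)
      then have "(\<lambda>m. \<bar>Q x y - g m y\<bar>) \<longlonglongrightarrow> 0" using pos by simp
      then have "(\<lambda>m. Q x y - g m y) \<longlonglongrightarrow> 0" by (rule tendsto_rabs_zero_cancel)
      then have "(\<lambda>m. Q x y - (Q x y - g m y)) \<longlonglongrightarrow> Q x y - 0" by (intro tendsto_intros)
      then have "(\<lambda>m. ennreal (g m y)) \<longlonglongrightarrow> ennreal (Q x y)" by (intro tendsto_ennrealI) simp
      then have "liminf (\<lambda>m. ennreal (g m y)) = ennreal (Q x y)" by (intro lim_imp_Liminf) auto
      then show "F (Q x) y = Q x y" using M0[OF QM[OF x] y] by (simp add: F_def g_def)
    qed
  qed
  moreover have "\<forall>r y. 0 \<le> F r y" by (simp add: F_def)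
  ultimately show ?thesis using F_meas by (intro exI[of _ F]) auto
qed


section \<open>Lumpability\<close>

lemma emeasure_lebesgue_open_pos:
  fixes Z :: "'a::euclidean_space set"
  assumes "open Z" "Z \<noteq> {}"
  shows "0 < emeasure lebesgue Z"
proof -
  have "\<not> negligible Z" using assms by (rule open_not_negligible)
  then have "Z \<notin> null_sets lebesgue" by (simp add: negligible_iff_null_sets)
  then show ?thesis using assms(1) by (auto simp: null_sets_def zero_less_iff_neq_zero)
qed

text \<open>
  An infinite \<open>z\<close> is covered by \<open>1 / \<infinity> = 0\<close> and \<open>0 * \<infinity> = 0\<close>.
\<close>

lemma ennreal_average_le:
  assumes "a \<le> ennreal \<epsilon> * z" "0 < z" "0 \<le> \<epsilon>"
  shows "1 / z * a \<le> ennreal \<epsilon>"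
proof (cases z)
  case (real r)
  then have r: "0 < r" using assms(2) by auto
  have z: "1 / z = ennreal (1 / r)" using real r by (simp add: divide_ennreal[symmetric])
  have "1 / z * a \<le> 1 / z * (ennreal \<epsilon> * z)" using assms(1) by (rule mult_left_mono) simp
  also have "\<dots> = ennreal (1 / r) * (ennreal \<epsilon> * z)" by (simp only: z)
  also have "ennreal (1 / r) * (ennreal \<epsilon> * z) = ennreal \<epsilon>"
    using real r assms(3) by (simp add: ennreal_mult[symmetric])
  finally show ?thesis .
qed simp

theorem proposition3p12:
  fixes X :: "(real ^ 'n) set"
    and \<pi> :: "real ^ 'n \<Rightarrow> real"
    and p :: "real \<Rightarrow> real ^ 'n \<Rightarrow> real ^ 'n \<Rightarrow> real"
    and P :: "real ^ 'n \<Rightarrow> 'w measure"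
    and Y :: "real \<Rightarrow> 'w \<Rightarrow> real ^ 'n"
    and M :: "(real ^ 'n \<Rightarrow> real) set"
    and Q :: "real ^ 'n \<Rightarrow> real ^ 'n \<Rightarrow> real"
    and Z :: "(real ^ 'r) set"
    and E :: "(real ^ 'n \<Rightarrow> real) \<Rightarrow> real ^ 'r"
    and \<xi> :: "real ^ 'n \<Rightarrow> real ^ 'r"
    and G :: "real ^ 'n \<Rightarrow> real ^ 'r ^ 'n"
    and \<epsilon> \<tau> :: real
  assumes "CARD('r) < CARD('n)"
    and "0 < \<epsilon>" and "0 < \<tau>"
    and "reversible_ergodic_process X \<pi> p P Y"
    and "open Z" and "connected Z"
    and "bij_betw E M Z"
    and "\<And>x. x \<in> X \<Longrightarrow> \<xi> x = E (Q x)"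
    and "smooth_RC X Z \<xi> G"
    and "AE x in lebesgue_on X. gram_det G x \<noteq> 0"
    and "weak_transition_manifold X \<pi> p \<epsilon> \<tau> \<xi> G M Q"
  shows "\<exists>pL :: real \<Rightarrow> real ^ 'r \<Rightarrow> real ^ 'n \<Rightarrow> real.
           (\<forall>t>0. \<forall>z\<in>Z. \<forall>y\<in>X. 0 \<le> pL t z y) \<and>
           (\<forall>t\<ge>\<tau>.
              (\<lambda>(x, y). pL t (\<xi> x) y) \<in> borel_measurable (lebesgue_on X \<Otimes>\<^sub>M lebesgue_on X) \<and>
              1 / emeasure lebesgue Z * K_norm X \<pi> (\<lambda>x y. p t x y - pL t (\<xi> x) y) \<le> ennreal \<epsilon>)"
proof -
  have X: "X \<in> sets lebesgue" and mp: "markov_process X p P Y" and \<pi>c: "continuous_on X \<pi>"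
    and \<pi>pos: "\<And>x. x \<in> X \<Longrightarrow> 0 < \<pi> x" and prob: "prob_space (density_measure X \<pi>)"
    using assms(4) by (auto simp: reversible_ergodic_process_def)
  have M_p: "M \<subseteq> p \<tau> ` X" and M_L2: "M \<subseteq> L2_space X \<pi>" and M_met: "Metric_space M (L2_dist X \<pi>)"
    and Q_diff: "L2_continuously_differentiable X \<pi> Q"
    and small: "\<And>x. x \<in> X \<Longrightarrow>
      (\<integral>\<^sup>+ x'. L2_norm X \<pi> (\<lambda>y. Q x y - p \<tau> x' y) \<partial>marginal_measure X \<pi> \<xi> G (\<xi> x)) \<le> ennreal \<epsilon>"
    using assms(11) by (auto simp: weak_transition_manifold_def parametrizable_manifold_def smooth_projection_def)
  have QM: "Q x \<in> M" if "x \<in> X" for x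
    using assms(11) that by (auto simp: weak_transition_manifold_def nearest_point_projection_def is_arg_min_def)
  have \<pi>s: "\<pi> \<in> borel_measurable (state_space X)"
    unfolding state_space_def by (rule borel_measurable_continuous_on_restrict[OF \<pi>c])
  then have \<pi>m: "\<pi> \<in> borel_measurable (lebesgue_on X)" by (rule measurable_state_space_lebesgue_on)
  have one: "(\<integral>\<^sup>+y. ennreal (\<pi> y) \<partial>lebesgue_on X) = 1"
  proof -
    have "1 = emeasure (density_measure X \<pi>) (space (density_measure X \<pi>))"
      using prob_space.emeasure_space_1[OF prob] by simp
    also have "\<dots> = (\<integral>\<^sup>+y. ennreal (\<pi> y) * indicator X y \<partial>lebesgue_on X)"
      unfolding density_measure_def using \<pi>m sets.top[of "lebesgue_on X"] by (subst emeasure_density) auto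
    also have "\<dots> = (\<integral>\<^sup>+y. ennreal (\<pi> y) \<partial>lebesgue_on X)" by (rule nn_integral_cong) simp
    finally show ?thesis by simp
  qed
  have X_ne: "X \<noteq> {}"
    using prob_space.not_empty[OF prob] by (simp add: density_measure_def)
  have p_meas: "(\<lambda>(x, y). p t x y) \<in> borel_measurable (state_space X \<Otimes>\<^sub>M state_space X)" if "0 < t" for t
    using mp that by (auto simp: markov_process_def)
  have M_meas: "q \<in> borel_measurable (state_space X)" if "q \<in> M" for q
    using M_p that measurable_Pair2[OF p_meas[OF assms(3)]] by auto
  have M_nonneg: "0 \<le> q y" if "q \<in> M" "y \<in> X" for q y
    using M_p that mp assms(3) by (auto simp: markov_process_def)
  have Q_cont: "((\<lambda>w. L2_dist X \<pi> (Q w) (Q x)) \<longlongrightarrow> 0) (at x within X)" if "x \<in> X" for x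
    by (rule L2_dist_tendsto_of_differentiable[OF \<pi>m _ Q_diff that]) (rule \<pi>pos)
  have "\<exists>F :: (real^'n \<Rightarrow> real) \<Rightarrow> real^'n \<Rightarrow> real. (\<forall>q y. 0 \<le> F q y) \<and>
     (\<lambda>(x, y). F (Q x) y) \<in> borel_measurable (state_space X \<Otimes>\<^sub>M state_space X) \<and>
     (\<forall>x\<in>X. AE y in lebesgue_on X. F (Q x) y = Q x y)"
    by (rule exists_measurable_version[OF X_ne \<pi>m _ _ M_L2 M_met]) (fact \<pi>pos QM Q_cont M_meas M_nonneg)+
  then obtain F :: "(real^'n \<Rightarrow> real) \<Rightarrow> real^'n \<Rightarrow> real" where F_nonneg: "\<And>q y. 0 \<le> F q y"
    and F_meas: "(\<lambda>(x, y). F (Q x) y) \<in> borel_measurable (state_space X \<Otimes>\<^sub>M state_space X)"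
    and F_AE: "\<And>x. x \<in> X \<Longrightarrow> AE y in lebesgue_on X. F (Q x) y = Q x y"
    by blast
  \<comment> \<open>On the manifold \<open>E\<close> is injective, so the element of \<open>M\<close> with coordinate \<open>z\<close> is \<open>inv_into M E z\<close>. The value
    for times below \<open>\<tau>\<close> is arbitrary; \<open>0\<close> keeps \<open>pL\<close> nonnegative.\<close>
  define pL where "pL t z y = (if t = \<tau> then F (inv_into M E z) y
      else if \<tau> < t then enn2real (\<integral>\<^sup>+u. ennreal (F (inv_into M E z) u) * ennreal (p (t - \<tau>) u y) \<partial>lebesgue_on X)
      else 0)" for t z y
  have inv_E: "inv_into M E (\<xi> x) = Q x" if "x \<in> X" for x
    using assms(7,8) QM that by (simp add: bij_betw_def inv_into_f_f)
  have F_slice: "F (Q x) \<in> borel_measurable (state_space X)" if "x \<in> X" for x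
    using measurable_Pair2[OF F_meas, of x] that by simp
  define f where "f x = L2_norm X \<pi> (\<lambda>y. F (Q x) y - p \<tau> x y)" for x
  have f_meas: "f \<in> borel_measurable (restrict_space borel X)"
  proof -
    have [measurable]: "(\<lambda>(x, y). F (Q x) y) \<in> borel_measurable (state_space X \<Otimes>\<^sub>M lebesgue_on X)"
      "(\<lambda>(x, y). p \<tau> x y) \<in> borel_measurable (state_space X \<Otimes>\<^sub>M lebesgue_on X)"
      using measurable_pair_state_space(1)[OF F_meas, of "state_space X" "lebesgue_on X"]
        measurable_pair_state_space(1)[OF p_meas[OF assms(3)], of "state_space X" "lebesgue_on X"] by auto
    note [measurable] = \<pi>m
    interpret L: sigma_finite_measure "lebesgue_on X" by (rule sigma_finite_lebesgue_on[OF X])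
    have "(\<lambda>x. \<integral>\<^sup>+ y. ennreal (\<bar>F (Q x) y - p \<tau> x y\<bar>\<^sup>2 / \<pi> y) \<partial>lebesgue_on X) \<in> borel_measurable (state_space X)"
      by measurable
    then have "(\<lambda>x. ennreal_sqrt (\<integral>\<^sup>+ y. ennreal (\<bar>F (Q x) y - p \<tau> x y\<bar>\<^sup>2 / \<pi> y) \<partial>lebesgue_on X)) \<in> borel_measurable (state_space X)"
      by (rule measurable_compose[OF _ ennreal_sqrt_measurable])
    then show ?thesis by (simp add: f_def[abs_def] L2_norm_def state_space_def)
  qed
  have f_marginal: "(\<integral>\<^sup>+ x'. f x' \<partial>marginal_measure X \<pi> \<xi> G (\<xi> x)) \<le> ennreal \<epsilon>" if x: "x \<in> X" for x
  proof -
    have "(\<integral>\<^sup>+ x'. f x' \<partial>marginal_measure X \<pi> \<xi> G (\<xi> x))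
        = (\<integral>\<^sup>+ x'. L2_norm X \<pi> (\<lambda>y. Q x y - p \<tau> x' y) \<partial>marginal_measure X \<pi> \<xi> G (\<xi> x))"
    proof (rule nn_integral_cong)
      fix x' assume "x' \<in> space (marginal_measure X \<pi> \<xi> G (\<xi> x))"
      then have x': "x' \<in> X" "\<xi> x' = \<xi> x"
        by (auto simp: marginal_measure_def space_restrict_space level_set_def)
      \<comment> \<open>Level sets of \<open>\<xi>\<close> are level sets of \<open>Q\<close>.\<close>
      then have "Q x' = Q x" using inv_E x by metis
      then show "f x' = L2_norm X \<pi> (\<lambda>y. Q x y - p \<tau> x' y)"
        unfolding f_def using F_AE[OF x] by (intro L2_norm_cong_AE) auto
    qed
    then show ?thesis using small[OF x] by simp
  qed
  have total: "(\<integral>\<^sup>+x. f x \<partial>density_measure X \<pi>) \<le> ennreal \<epsilon> * emeasure lebesgue Z"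
    using assms(5) by (intro integral_le_of_marginal_integrals_le[OF assms(1) X assms(9) _ assms(10) \<pi>c \<pi>pos f_meas f_marginal]) auto
  have L1: "(\<integral>\<^sup>+y. ennreal \<bar>p t x y - pL t (\<xi> x) y\<bar> \<partial>lebesgue_on X) \<le> f x" if t: "\<tau> \<le> t" and x: "x \<in> X" for t x
  proof -
    have "(\<integral>\<^sup>+y. ennreal \<bar>p t x y - pL t (\<xi> x) y\<bar> \<partial>lebesgue_on X)
        \<le> (\<integral>\<^sup>+y. ennreal \<bar>p \<tau> x y - F (Q x) y\<bar> \<partial>lebesgue_on X)"
    proof (cases "t = \<tau>")
      case True
      then show ?thesis using inv_E[OF x] by (simp add: pL_def)
    next
      case False
      then have "0 < t - \<tau>" "\<tau> < t" using t by auto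
      then show ?thesis
        using markov_L1_contraction[OF mp X x assms(3) _ F_slice[OF x] F_nonneg, of "t - \<tau>"] inv_E[OF x]
        by (simp add: pL_def)
    qed
    also have "\<dots> = (\<integral>\<^sup>+y. ennreal \<bar>F (Q x) y - p \<tau> x y\<bar> \<partial>lebesgue_on X)"
      by (simp add: abs_minus_commute)
    also have "\<dots> \<le> f x"
      unfolding f_def
    proof (rule L1_le_L2_norm[OF \<pi>m \<pi>pos one])
      have "p \<tau> x \<in> borel_measurable (state_space X)"
        using measurable_Pair2[OF p_meas[OF assms(3)], of x] x by simp
      then show "(\<lambda>y. F (Q x) y - p \<tau> x y) \<in> borel_measurable (lebesgue_on X)"
        using F_slice[OF x] by (intro measurable_state_space_lebesgue_on borel_measurable_diff)
    qed
    finally show ?thesis .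
  qed
  show ?thesis
  proof (intro exI[of _ pL] conjI allI impI ballI)
    show "0 \<le> pL t z y" for t z y by (simp add: pL_def F_nonneg)
    fix t assume t: "\<tau> \<le> t"
    show "(\<lambda>(x, y). pL t (\<xi> x) y) \<in> borel_measurable (lebesgue_on X \<Otimes>\<^sub>M lebesgue_on X)"
    proof -
      have "(\<lambda>(x, y). if t = \<tau> then F (Q x) y
          else enn2real (\<integral>\<^sup>+u. ennreal (F (Q x) u) * ennreal (p (t - \<tau>) u y) \<partial>lebesgue_on X))
          \<in> borel_measurable (lebesgue_on X \<Otimes>\<^sub>M lebesgue_on X)"
      proof (cases "t = \<tau>")
        case True
        then show ?thesis
          using measurable_pair_state_space(1)[OF F_meas, of "lebesgue_on X" "lebesgue_on X"] by simp
      next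
        case False
        then have "0 < t - \<tau>" using t by simp
        then have [measurable]: "(\<lambda>(x, u). F (Q x) u) \<in> borel_measurable (lebesgue_on X \<Otimes>\<^sub>M lebesgue_on X)"
          "(\<lambda>(u, y). p (t - \<tau>) u y) \<in> borel_measurable (lebesgue_on X \<Otimes>\<^sub>M lebesgue_on X)"
          using measurable_pair_state_space(1)[OF F_meas, of "lebesgue_on X" "lebesgue_on X"]
            measurable_pair_state_space(1)[OF p_meas, of "t - \<tau>" "lebesgue_on X" "lebesgue_on X"] by auto
        interpret L: sigma_finite_measure "lebesgue_on X" by (rule sigma_finite_lebesgue_on[OF X])
        show ?thesis using False by simp measurable
      qed
      moreover have "(\<lambda>(x, y). pL t (\<xi> x) y) z = (\<lambda>(x, y). if t = \<tau> then F (Q x) y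
          else enn2real (\<integral>\<^sup>+u. ennreal (F (Q x) u) * ennreal (p (t - \<tau>) u y) \<partial>lebesgue_on X)) z"
        if "z \<in> space (lebesgue_on X \<Otimes>\<^sub>M lebesgue_on X)" for z
        using that t inv_E by (auto simp: pL_def space_pair_measure)
      ultimately show ?thesis by (subst measurable_cong) auto
    qed
    have "K_norm X \<pi> (\<lambda>x y. p t x y - pL t (\<xi> x) y) \<le> (\<integral>\<^sup>+x. f x \<partial>density_measure X \<pi>)"
      unfolding K_norm_def using L1[OF t] by (intro nn_integral_mono) (simp add: density_measure_def)
    also note total
    finally have "K_norm X \<pi> (\<lambda>x y. p t x y - pL t (\<xi> x) y) \<le> ennreal \<epsilon> * emeasure lebesgue Z" .
    moreover have "Z \<noteq> {}" using X_ne QM assms(7) by (auto simp: bij_betw_def)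
    ultimately show "1 / emeasure lebesgue Z * K_norm X \<pi> (\<lambda>x y. p t x y - pL t (\<xi> x) y) \<le> ennreal \<epsilon>"
      using assms(2) emeasure_lebesgue_open_pos[OF assms(5)] by (intro ennreal_average_le) auto
  qed
qed

end
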